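(* Let $m\ge 0$ be an integer and let $(X_t)_{t\in\mathbb{Z}}$ be a real-valued, strictly stationary, $m$-dependent sequence which is regularly varying with index $\alpha=2$, has $\mathbb{E}[X]=0$ and $\mathrm{var}(X)=\infty$, and has spectral tail process $(\Theta_t)_{t\in\mathbb{Z}}$. Let $S_n=X_1+\cdots+X_n$ and let $(a_n)$ be the normalizing sequence defined by $$n\,\mathbb{P}(|X|>a_n)+\frac{n}{a_n^2}\,\mathbb{E}\big[X^2\,\mathbf 1(|X|\le a_n)\big]=1 .$$ Then $$a_n^{-1}S_n\ \stackrel{d}{\to}\ N(0,\sigma^2),\qquad n\to\infty,$$ where $$\sigma^2=\mathbb{E}\Big[\Big(\sum_{t=0}^m\Theta_t\Big)^2\,\mathbf 1\big(\Theta_{-i}=0,\ i=1,\ldots,m\big)\Big].$$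
   Context: $X$ denotes a generic element of $(X_t)$, i.e. $X$ has the law of $X_0$. A strictly stationary real-valued sequence $(X_t)$ is regularly varying with index $\alpha=2$ if (i) there exist a slowly varying function $L$ and constants $p_\pm\ge 0$ such that $\mathbb{P}(|X|>x)=L(x)x^{-2}$ for $x>0$ and $\mathbb{P}(\pm X>x)/\mathbb{P}(|X|>x)\to p_\pm$ as $x\to\infty$; and (ii) there exist a random variable $Y_2$ with $\mathbb{P}(Y_2>x)=x^{-2}$, $x>1$, and a sequence of random variables $(\Theta_t)_{t\in\mathbb{Z}}$ independent of $Y_2$ such that for every $h\ge 0$, $$\mathbb{P}\big(x^{-1}(X_{-h},\ldots,X_h)\in\cdot\ \big|\ |X_0|>x\big)\ \stackrel{w}{\to}\ \mathbb{P}\big(Y_2(\Theta_{-h},\ldots,\Theta_h)\in\cdot\big),\qquad x\to\infty .$$ The process $(\Theta_t)$ is called the spectral tail process of $(X_t)$. For an $m$-dependent sequence $\Theta_t=0$ for $|t|>m$. The sequence $(a_n)$ is uniquely defined by its equation for all sufficiently large $n$. $N(0,0)$ is the point mass at $0$. *)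

theory Defs
  imports "HOL-Probability.Probability"
begin

text \<open>A real-valued process indexed by the integers is a family \<open>X :: int \<Rightarrow> 'a \<Rightarrow> real\<close> on a measure
  space; its law lives on the product sigma-algebra over all integers.\<close>

definition strictly_stationary :: "'a measure \<Rightarrow> (int \<Rightarrow> 'a \<Rightarrow> real) \<Rightarrow> bool" where
  "strictly_stationary M X \<longleftrightarrow>
     (\<forall>t. X t \<in> borel_measurable M) \<and>
     (\<forall>k. distr M (PiM UNIV (\<lambda>_. borel)) (\<lambda>\<omega> t. X (t + k) \<omega>)
        = distr M (PiM UNIV (\<lambda>_. borel)) (\<lambda>\<omega> t. X t \<omega>))"

definition m_dependent :: "nat \<Rightarrow> 'a measure \<Rightarrow> (int \<Rightarrow> 'a \<Rightarrow> real) \<Rightarrow> bool" where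
  "m_dependent m M X \<longleftrightarrow>
     (\<forall>t. prob_space.indep_var M
        (PiM {..t} (\<lambda>_. borel)) (\<lambda>\<omega>. \<lambda>s\<in>{..t}. X s \<omega>)
        (PiM {t + int m<..} (\<lambda>_. borel)) (\<lambda>\<omega>. \<lambda>s\<in>{t + int m<..}. X s \<omega>))"

definition slowly_varying :: "(real \<Rightarrow> real) \<Rightarrow> bool" where
  "slowly_varying L \<longleftrightarrow>
     L \<in> borel_measurable (restrict_space borel {0<..}) \<and>
     (\<forall>x>0. L x > 0) \<and>
     (\<forall>c>0. ((\<lambda>x. L (c * x) / L x) \<longlongrightarrow> 1) at_top)"

text \<open>Weak convergence of laws of random vectors indexed by a finite set \<open>I\<close>, along a filter. Such a
  vector is a function in \<open>PiE I (\<lambda>_. UNIV)\<close>, i.e. one fixed to \<open>undefined\<close> off \<open>I\<close>; as a subspace of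
  the product space \<open>'i \<Rightarrow> real\<close> this set is a copy of the Euclidean space with coordinates in \<open>I\<close>.\<close>

definition weak_conv_vec ::
    "'i set \<Rightarrow> ('c \<Rightarrow> ('i \<Rightarrow> real) measure) \<Rightarrow> ('i \<Rightarrow> real) measure \<Rightarrow> 'c filter \<Rightarrow> bool" where
  "weak_conv_vec I \<mu> \<nu> F \<longleftrightarrow>
     (\<forall>g :: ('i \<Rightarrow> real) \<Rightarrow> real.
        continuous_on (PiE I (\<lambda>_. UNIV)) g \<and> bounded (g ` PiE I (\<lambda>_. UNIV)) \<longrightarrow>
        ((\<lambda>x. integral\<^sup>L (\<mu> x) g) \<longlongrightarrow> integral\<^sup>L \<nu> g) F)"

definition regularly_varying_marginal :: "real \<Rightarrow> 'a measure \<Rightarrow> ('a \<Rightarrow> real) \<Rightarrow> bool" where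
  "regularly_varying_marginal \<alpha> M Z \<longleftrightarrow>
     (\<exists>L. slowly_varying L \<and> (\<forall>x>0. \<P>(\<omega> in M. \<bar>Z \<omega>\<bar> > x) = L x * x powr (- \<alpha>))) \<and>
     (\<exists>p\<ge>0. ((\<lambda>x. \<P>(\<omega> in M. Z \<omega> > x) / \<P>(\<omega> in M. \<bar>Z \<omega>\<bar> > x)) \<longlongrightarrow> p) at_top) \<and>
     (\<exists>q\<ge>0. ((\<lambda>x. \<P>(\<omega> in M. - Z \<omega> > x) / \<P>(\<omega> in M. \<bar>Z \<omega>\<bar> > x)) \<longlongrightarrow> q) at_top)"

text \<open>Independence of two random variables with different value types; for equal types this is
  \<open>indep_var\<close>.\<close>

definition indep_rvs ::
    "'a measure \<Rightarrow> 'b measure \<Rightarrow> ('a \<Rightarrow> 'b) \<Rightarrow> 'c measure \<Rightarrow> ('a \<Rightarrow> 'c) \<Rightarrow> bool" where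
  "indep_rvs M S U T V \<longleftrightarrow>
     U \<in> measurable M S \<and> V \<in> measurable M T \<and>
     prob_space.indep_set M {U -` A \<inter> space M | A. A \<in> sets S} {V -` B \<inter> space M | B. B \<in> sets T}"

text \<open>\<open>\<Theta>\<close> lives on a probability space \<open>N\<close> of its own, which also carries the Pareto variable \<open>Y\<close>.
  The conditional law given \<open>\<bar>X 0\<bar> > x\<close> is the law under \<open>uniform_measure M {\<bar>X 0\<bar> > x}\<close>.\<close>

definition spectral_tail_process ::
    "real \<Rightarrow> 'a measure \<Rightarrow> (int \<Rightarrow> 'a \<Rightarrow> real) \<Rightarrow> 'b measure \<Rightarrow> (int \<Rightarrow> 'b \<Rightarrow> real) \<Rightarrow> bool" where
  "spectral_tail_process \<alpha> M X N \<Theta> \<longleftrightarrow>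
     prob_space N \<and>
     (\<exists>Y. (\<forall>x>1. \<P>(\<omega> in N. Y \<omega> > x) = x powr (- \<alpha>)) \<and>
        indep_rvs N borel Y (PiM UNIV (\<lambda>_. borel)) (\<lambda>\<omega> t. \<Theta> t \<omega>) \<and>
        (\<forall>h::nat. weak_conv_vec {- int h..int h}
           (\<lambda>x. distr (uniform_measure M {\<omega> \<in> space M. \<bar>X 0 \<omega>\<bar> > x})
                  (PiM {- int h..int h} (\<lambda>_. borel))
                  (\<lambda>\<omega>. \<lambda>t\<in>{- int h..int h}. X t \<omega> / x))
           (distr N (PiM {- int h..int h} (\<lambda>_. borel))
                  (\<lambda>\<omega>. \<lambda>t\<in>{- int h..int h}. Y \<omega> * \<Theta> t \<omega>))
           at_top))"

text \<open>Regular variation of index \<open>\<alpha>\<close> of the stationary sequence \<open>X\<close>, naming the spectral tail process.\<close>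

definition regularly_varying ::
    "real \<Rightarrow> 'a measure \<Rightarrow> (int \<Rightarrow> 'a \<Rightarrow> real) \<Rightarrow> 'b measure \<Rightarrow> (int \<Rightarrow> 'b \<Rightarrow> real) \<Rightarrow> bool" where
  "regularly_varying \<alpha> M X N \<Theta> \<longleftrightarrow>
     regularly_varying_marginal \<alpha> M (X 0) \<and> spectral_tail_process \<alpha> M X N \<Theta>"

text \<open>\<open>normal_law \<mu> v\<close> takes the variance \<open>v\<close> (not the standard deviation); \<open>v = 0\<close> gives a point mass.\<close>

definition normal_law :: "real \<Rightarrow> real \<Rightarrow> real measure" where
  "normal_law \<mu> v =
     (if v = 0 then return borel \<mu> else density lborel (\<lambda>x. ennreal (normal_density \<mu> (sqrt v) x)))"

end

theory Submission
  imports Defs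
begin

text \<open>Write \<open>T(x)\<close> for the tail \<open>P(|X\<^sub>0| > x)\<close> and \<open>K(x)\<close> for the truncated second moment
  \<open>E[X\<^sub>0\<^sup>2; |X\<^sub>0| \<le> x]\<close>. At the critical index 2 the second moment is infinite, but only barely:
  any fixed number of dyadic scales below \<open>x\<close> contribute about equally to \<open>K(x)\<close>, so \<open>x\<^sup>2 T(x)\<close>, the
  order of a single contribution, is negligible compared with \<open>K(x)\<close>. With \<open>a\<^sub>n\<close> chosen such that
  \<open>n K(a\<^sub>n) \<sim> a\<^sub>n\<^sup>2\<close> it follows that \<open>n T(a\<^sub>n) \<rightarrow> 0\<close>. Hence the variables may be truncated at level
  \<open>a\<^sub>n\<close>, and the truncated and scaled variables have total second moment tending to 1 and total
  third absolute moment tending to 0. This is the regime of a normal limit.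

  The dependence enters through the covariances of the truncated variables. Since all scales
  contribute and the path near a value of size \<open>u\<close> looks like \<open>u\<close> times the spectral tail process,
  averaging over \<open>u\<close> shows that \<open>E[F(X); |X\<^sub>0| \<le> x] / K(x)\<close> tends to \<open>E[F(\<Theta>)]\<close> for every
  continuous local functional \<open>F\<close> that is homogeneous of degree 2 and bounded by a multiple of
  \<open>X\<^sub>0\<^sup>2\<close> (\<open>functional_limit\<close>). Approximating products of coordinates by such functionals gives the
  limits \<open>E[\<Theta>\<^sub>0 \<Theta>\<^sub>h]\<close> of the scaled autocovariances (\<open>autocovariance_limit\<close>). Comparing the limits
  obtained with truncation of \<open>X\<^sub>0\<close> and of \<open>X\<^sub>p\<close>, which differ by \<open>O(x\<^sup>2 T(x))\<close>, and using
  stationarity gives the time-change formula (\<open>time_change\<close>, \<open>tail_process_shift\<close>).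

  The natural limiting variance is therefore the sum of \<open>E[\<Theta>\<^sub>0 \<Theta>\<^sub>h]\<close> over \<open>|h| \<le> m\<close>. To turn it into
  the variance of the theorem, split according to the position \<open>-j\<close> of the first nonzero coordinate
  of \<open>\<Theta>\<close> and move that coordinate to the origin by the time change: the sum becomes
  \<open>E[\<Sigma>\<^sub>j \<Sigma>\<^sub>h \<Theta>\<^sub>j \<Theta>\<^sub>j\<^sub>+\<^sub>h; \<Theta>\<^sub>i = 0 for i < 0]\<close>, and the double sum is a square (\<open>cluster_variance\<close>).

  The central limit theorem itself is Bernstein's block method: blocks of a fixed length \<open>k\<close> separated
  by gaps of length \<open>m\<close> are independent, their sums are treated by a second-order expansion of the
  characteristic function (\<open>block_char_limit\<close>), and the gaps carry a fraction of the variance of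
  order \<open>m / (k + m)\<close> (\<open>remainder_L1_limit\<close>), which vanishes when \<open>k\<close> tends to infinity after \<open>n\<close>.\<close>

section \<open>Truncated moments of a variable with tail index 2\<close>

definition trunc :: "real \<Rightarrow> real \<Rightarrow> real" where
  "trunc c z = (if \<bar>z\<bar> \<le> c then z else 0)"

lemma trunc_measurable [measurable]: "trunc c \<in> borel_measurable borel"
  unfolding trunc_def by measurable

lemma abs_trunc_le: "\<bar>trunc c z\<bar> \<le> \<bar>z\<bar>"
  by (simp add: trunc_def)

lemma abs_trunc_le_level: "0 \<le> c \<Longrightarrow> \<bar>trunc c z\<bar> \<le> c"
  by (simp add: trunc_def)

lemma trunc_square_mono: "c \<le> d \<Longrightarrow> (trunc c z)\<^sup>2 \<le> (trunc d z)\<^sup>2"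
  by (auto simp: trunc_def)

lemma integrable_of_bounded_increasing:
  fixes f :: "nat \<Rightarrow> 'a \<Rightarrow> real"
  assumes int: "\<And>n. integrable M (f n)" and mono: "AE \<omega> in M. incseq (\<lambda>n. f n \<omega>)"
    and lim: "AE \<omega> in M. (\<lambda>n. f n \<omega>) \<longlonglongrightarrow> u \<omega>"
    and bdd: "\<And>n. integral\<^sup>L M (f n) \<le> B" and [measurable]: "u \<in> borel_measurable M"
  shows "integrable M u"
proof -
  have "incseq (\<lambda>n. integral\<^sup>L M (f n))"
    using mono by (intro incseq_SucI integral_mono_AE int) (auto simp: incseq_Suc_iff)
  then obtain l where "(\<lambda>n. integral\<^sup>L M (f n)) \<longlonglongrightarrow> l"
    using incseq_convergent bdd by blast
  with int mono lim show ?thesis by (rule integrable_monotone_convergence) simp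
qed

locale heavy_tail = prob_space M for M :: "'a measure" +
  fixes Z :: "'a \<Rightarrow> real" and L :: "real \<Rightarrow> real"
  assumes Z_measurable [measurable]: "Z \<in> borel_measurable M"
    and L_sv: "slowly_varying L"
    and tail_L: "0 < x \<Longrightarrow> prob {\<omega> \<in> space M. x < \<bar>Z \<omega>\<bar>} = L x * x powr (-2)"
    and integrable_Z: "integrable M Z"
    and infinite_second_moment: "(\<integral>\<^sup>+\<omega>. ennreal ((Z \<omega>)\<^sup>2) \<partial>M) = \<infinity>"
begin

definition tail :: "real \<Rightarrow> real" where
  "tail x = prob {\<omega> \<in> space M. x < \<bar>Z \<omega>\<bar>}"

definition trunc_moment :: "real \<Rightarrow> real" where
  "trunc_moment x = expectation (\<lambda>\<omega>. (trunc x (Z \<omega>))\<^sup>2)"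

definition mean_excess :: "real \<Rightarrow> real" where
  "mean_excess x = expectation (\<lambda>\<omega>. \<bar>Z \<omega> - trunc x (Z \<omega>)\<bar>)"

lemma square_tail: "0 < x \<Longrightarrow> x\<^sup>2 * tail x = L x"
  unfolding tail_def by (simp add: tail_L powr_minus field_simps powr_numeral)

lemma tail_eq: "0 < x \<Longrightarrow> tail x = L x / x\<^sup>2"
  using square_tail[of x] by (simp add: field_simps)

lemma L_pos: "0 < x \<Longrightarrow> 0 < L x"
  using L_sv by (simp add: slowly_varying_def)

lemma L_scale: "0 < c \<Longrightarrow> ((\<lambda>x. L (c * x) / L x) \<longlongrightarrow> 1) at_top"
  using L_sv by (simp add: slowly_varying_def)

lemma tail_mono: "x \<le> y \<Longrightarrow> tail y \<le> tail x"
  unfolding tail_def by (intro finite_measure_mono) auto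

lemma tail_nonneg [simp]: "0 \<le> tail x"
  by (simp add: tail_def)

lemma tail_pos: "0 < tail x"
proof -
  have "0 < tail (max x 1)"
    using L_pos[of "max x 1"] by (simp add: tail_eq)
  also have "\<dots> \<le> tail x" by (rule tail_mono) simp
  finally show ?thesis .
qed

lemma expectation_tail: "expectation (\<lambda>\<omega>. indicat_real {z. x < \<bar>z\<bar>} (Z \<omega>)) = tail x"
proof -
  have "expectation (\<lambda>\<omega>. indicat_real {z. x < \<bar>z\<bar>} (Z \<omega>))
      = expectation (indicat_real {\<omega> \<in> space M. x < \<bar>Z \<omega>\<bar>})"
    by (intro Bochner_Integration.integral_cong) (auto simp: indicator_def)
  then show ?thesis by (simp add: tail_def)
qed

lemma integrable_tail: "integrable M (\<lambda>\<omega>. indicat_real {z. x < \<bar>z\<bar>} (Z \<omega>))"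
  by (rule integrable_const_bound[where B = 1]) (auto simp: indicator_def)

lemma integrable_trunc_power: "integrable M (\<lambda>\<omega>. (trunc x (Z \<omega>))^k)"
proof (rule integrable_const_bound[where B = "\<bar>x\<bar>^k"])
  have "\<bar>trunc x z\<bar> \<le> \<bar>x\<bar>" for z by (auto simp: trunc_def)
  then show "AE \<omega> in M. norm (trunc x (Z \<omega>) ^ k) \<le> \<bar>x\<bar> ^ k"
    by (simp add: power_abs power_mono)
qed simp

lemma tail_scale:
  assumes "0 < c"
  shows "((\<lambda>x. tail (c * x) / tail x) \<longlongrightarrow> 1 / c\<^sup>2) at_top"
proof (rule Lim_transform_eventually)
  show "((\<lambda>x. L (c * x) / L x * (1 / c\<^sup>2)) \<longlongrightarrow> 1 / c\<^sup>2) at_top"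
    using tendsto_mult[OF L_scale[OF assms] tendsto_const[of "1 / c\<^sup>2"]] by simp
  show "\<forall>\<^sub>F x in at_top. L (c * x) / L x * (1 / c\<^sup>2) = tail (c * x) / tail x"
    using eventually_gt_at_top[of 0]
  proof eventually_elim
    case (elim x)
    with assms show ?case by (simp add: tail_eq power_mult_distrib)
  qed
qed

lemma trunc_moment_nonneg: "0 \<le> trunc_moment x"
  by (simp add: trunc_moment_def)

lemma trunc_moment_mono: "x \<le> y \<Longrightarrow> trunc_moment x \<le> trunc_moment y"
  unfolding trunc_moment_def
  by (intro integral_mono integrable_trunc_power trunc_square_mono)

text \<open>Values between \<open>y\<close> and \<open>x\<close> contribute at least \<open>y\<^sup>2\<close> each; this turns tail
  probabilities into lower bounds for the truncated moment.\<close>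

lemma trunc_moment_step:
  assumes "0 < y" "y \<le> x"
  shows "trunc_moment y + y\<^sup>2 * (tail y - tail x) \<le> trunc_moment x"
proof -
  let ?I = "\<lambda>x z. indicat_real {z. x < \<bar>z\<bar>} z"
  have pw: "(trunc y z)\<^sup>2 + y\<^sup>2 * (?I y z - ?I x z) \<le> (trunc x z)\<^sup>2" for z
    using assms abs_le_square_iff[of y z] by (auto simp: trunc_def indicator_def)
  have "trunc_moment y + y\<^sup>2 * (tail y - tail x)
      = expectation (\<lambda>\<omega>. (trunc y (Z \<omega>))\<^sup>2 + y\<^sup>2 * (?I y (Z \<omega>) - ?I x (Z \<omega>)))"
    unfolding trunc_moment_def using integrable_trunc_power[of y 2] integrable_tail[of y] integrable_tail[of x]
    by (simp add: expectation_tail)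
  also have "\<dots> \<le> trunc_moment x"
    unfolding trunc_moment_def using integrable_trunc_power[of _ 2] integrable_tail pw
    by (intro integral_mono) auto
  finally show ?thesis .
qed

text \<open>This is the hypothesis of infinite variance, by monotone convergence.\<close>

lemma trunc_moment_at_top: "filterlim trunc_moment at_top at_top"
  unfolding filterlim_at_top
proof
  fix B
  have "\<exists>n::nat. B \<le> trunc_moment (real n)"
  proof (rule ccontr)
    assume "\<not> ?thesis"
    then have le: "trunc_moment (real n) \<le> B" for n by (meson linorder_linear)
    have "integrable M (\<lambda>\<omega>. (Z \<omega>)\<^sup>2)"
    proof (rule integrable_of_bounded_increasing)
      show "integrable M (\<lambda>\<omega>. (trunc (real n) (Z \<omega>))\<^sup>2)" for n
        by (rule integrable_trunc_power)
      show "AE \<omega> in M. incseq (\<lambda>n. (trunc (real n) (Z \<omega>))\<^sup>2)"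
        by (intro AE_I2 incseq_SucI trunc_square_mono) simp
      show "AE \<omega> in M. (\<lambda>n. (trunc (real n) (Z \<omega>))\<^sup>2) \<longlonglongrightarrow> (Z \<omega>)\<^sup>2"
      proof (intro AE_I2 tendsto_eventually)
        fix \<omega>
        obtain N where N: "\<bar>Z \<omega>\<bar> \<le> real N" using real_arch_simple by blast
        show "\<forall>\<^sub>F n in sequentially. (trunc (real n) (Z \<omega>))\<^sup>2 = (Z \<omega>)\<^sup>2"
          using eventually_ge_at_top[of N]
        proof eventually_elim
          case (elim n)
          then have "\<bar>Z \<omega>\<bar> \<le> real n" using N by (meson of_nat_mono order_trans)
          then show ?case by (simp add: trunc_def)
        qed
      qed
      show "expectation (\<lambda>\<omega>. (trunc (real n) (Z \<omega>))\<^sup>2) \<le> B" for n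
        using le by (simp add: trunc_moment_def)
    qed simp
    then have "(\<integral>\<^sup>+\<omega>. ennreal ((Z \<omega>)\<^sup>2) \<partial>M) < \<infinity>"
      by (simp add: integrable_iff_bounded)
    then show False using infinite_second_moment by simp
  qed
  then obtain n where n: "B \<le> trunc_moment (real n)" by blast
  show "\<forall>\<^sub>F x in at_top. B \<le> trunc_moment x"
    using eventually_ge_at_top[of "real n"]
    by eventually_elim (use n trunc_moment_mono order_trans in blast)
qed

lemma trunc_moment_pos: "\<forall>\<^sub>F x in at_top. 0 < trunc_moment x"
  using trunc_moment_at_top by (simp add: filterlim_at_top_dense)

text \<open>The dyadic shells between \<open>x / 2\<^sup>N\<close> and \<open>x\<close> have nearly the same \<open>L\<close>-value, because \<open>L\<close> is slowly
  varying, and each adds a fixed multiple of \<open>L x\<close> to the truncated moment. So \<open>trunc_moment x\<close> exceeds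
  any given multiple of \<open>L x\<close> in the end. This is the part of Karamata's theorem that is used.\<close>

lemma L_le_trunc_moment: "\<forall>\<^sub>F x in at_top. real N * L x \<le> 4 * trunc_moment x"
proof -
  have half: "\<forall>\<^sub>F y in at_top. L y \<le> 2 * L (1/2 * y)"
  proof -
    have "\<forall>\<^sub>F y in at_top. 1/2 < L (1/2 * y) / L y"
      by (rule order_tendstoD[OF L_scale]) simp_all
    then show ?thesis using eventually_gt_at_top[of 0]
    proof eventually_elim
      case (elim y) then show ?case using L_pos[of y] by (simp add: field_simps)
    qed
  qed
  then obtain y0 where y0: "\<And>y. y0 \<le> y \<Longrightarrow> L y \<le> 2 * L (1/2 * y)"
    by (auto simp: eventually_at_top_linorder)
  have step: "L (y/2) \<le> 2 * (trunc_moment y - trunc_moment (y/2)) * 4" if "0 < y" "y0 \<le> y" for y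
  proof -
    have "trunc_moment (y/2) + (y/2)\<^sup>2 * (tail (y/2) - tail y) \<le> trunc_moment y"
      using that by (intro trunc_moment_step) auto
    moreover have "(y/2)\<^sup>2 * (tail (y/2) - tail y) = L (y/2) - L y / 4"
      using that square_tail[of "y/2"] square_tail[of y]
      by (simp add: algebra_simps power2_eq_square)
    ultimately show ?thesis using y0[OF that(2)] L_pos[of y] L_pos[of "y/2"] that
      by (simp add: algebra_simps)
  qed
  have "\<forall>\<^sub>F x in at_top. real N * L x \<le> 16 * (trunc_moment x - trunc_moment (x / 2^N))" for N
  proof (induction N)
    case 0 then show ?case by simp
  next
    case (Suc N)
    have "\<forall>\<^sub>F x in at_top. 1/2 < L ((1/2^Suc N) * x) / L x"
      by (rule order_tendstoD[OF L_scale]) simp_all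
    then show ?case using Suc eventually_gt_at_top[of 0] eventually_ge_at_top[of "y0 * 2^N"]
    proof eventually_elim
      case (elim x)
      have "L x \<le> 2 * L (x / 2^N / 2)"
        using elim L_pos[of x] by (simp add: field_simps)
      also have "\<dots> \<le> 2 * (2 * (trunc_moment (x/2^N) - trunc_moment (x/2^N/2)) * 4)"
        using elim by (intro mult_left_mono step) (auto simp: field_simps)
      finally show ?case using elim(2) by (simp add: algebra_simps)
    qed
  qed
  \<comment> \<open>The induction yields the constant 16; running it for 4N shells gives the constant 4.\<close>
  from this[of "4 * N"] show ?thesis
  proof eventually_elim
    case (elim x)
    then show ?case using trunc_moment_nonneg[of "x / 2^(4*N)"] by simp
  qed
qed

text \<open>The fact that makes the limit normal: a single large value at level \<open>x\<close> is negligible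
  compared with the accumulated truncated moment.\<close>

lemma square_tail_negligible: "((\<lambda>x. x\<^sup>2 * tail x / trunc_moment x) \<longlongrightarrow> 0) at_top"
proof (rule order_tendstoI)
  fix e :: real assume "e < 0"
  show "\<forall>\<^sub>F x in at_top. e < x\<^sup>2 * tail x / trunc_moment x"
    by (rule always_eventually)
      (use \<open>e < 0\<close> trunc_moment_nonneg tail_nonneg in \<open>auto intro!: less_le_trans[OF \<open>e < 0\<close>]\<close>)
next
  fix e :: real assume e: "0 < e"
  then obtain N where N: "4 / e < real N" using reals_Archimedean2 by blast
  show "\<forall>\<^sub>F x in at_top. x\<^sup>2 * tail x / trunc_moment x < e"
    using L_le_trunc_moment[of N] trunc_moment_pos eventually_gt_at_top[of 0]
  proof eventually_elim
    case (elim x)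
    have "4 < e * real N" using N e by (simp add: field_simps)
    then have "4 * L x < e * real N * L x" using L_pos elim by simp
    also have "\<dots> \<le> e * (4 * trunc_moment x)" using elim e by (simp add: mult.assoc)
    finally show ?case unfolding square_tail[OF elim(3)] using elim by (simp add: field_simps)
  qed
qed

text \<open>Going from \<open>x\<close> to \<open>2x\<close> divides the tail by almost 4, hence by more than 3, so the dyadic
  contributions \<open>2\<^sup>j\<^sup>+\<^sup>1 x T(2\<^sup>j x)\<close> to the mean excess are dominated by a geometric series with
  ratio 2/3.\<close>

lemma first_moment_tail:
  "\<forall>\<^sub>F x in at_top. mean_excess x \<le> 6 * x * tail x"
proof -
  let ?I = "\<lambda>x z. indicat_real {z. x < \<bar>z\<bar>} z"
  have int: "integrable M (\<lambda>\<omega>. \<bar>Z \<omega> - trunc x (Z \<omega>)\<bar>)" for x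
    using integrable_Z integrable_trunc_power[of x 1] by auto
  have step: "mean_excess x \<le> 2 * x * tail x + mean_excess (2 * x)" if "0 < x" for x
  proof -
    have pw: "\<bar>z - trunc x z\<bar> \<le> 2 * x * ?I x z + \<bar>z - trunc (2*x) z\<bar>" for z
      using that by (auto simp: trunc_def indicator_def)
    have "mean_excess x \<le> expectation (\<lambda>\<omega>. 2 * x * ?I x (Z \<omega>) + \<bar>Z \<omega> - trunc (2*x) (Z \<omega>)\<bar>)"
      unfolding mean_excess_def using int integrable_tail[of x] pw by (intro integral_mono) auto
    also have "\<dots> = 2 * x * tail x + mean_excess (2 * x)"
      using int[of "2*x"] integrable_tail[of x] by (simp add: expectation_tail mean_excess_def)
    finally show ?thesis .
  qed
  have "\<forall>\<^sub>F x in at_top. tail (2 * x) / tail x < 1/3"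
    by (rule order_tendstoD[OF tail_scale]) simp_all
  then obtain x0 where x0: "\<And>x. x0 \<le> x \<Longrightarrow> tail (2 * x) / tail x < 1/3"
    by (auto simp: eventually_at_top_linorder)
  have third: "tail (2 * x) \<le> tail x / 3" if "x0 \<le> x" for x
    using x0[OF that] tail_pos[of x] by (simp add: field_simps)
  have iter: "mean_excess x \<le> 6 * x * tail x + mean_excess (2^N * x)" if "0 < x" "x0 \<le> x" for x N
  proof -
    \<comment> \<open>The subtracted term is the tail of the geometric series; it makes the induction close.\<close>
    have "mean_excess x \<le> 6 * x * tail x - 6 * (2^N * x) * tail (2^N * x) + mean_excess (2^N * x)"
    proof (induction N)
      case 0 then show ?case by simp
    next
      case (Suc N)
      let ?y = "2^N * x"
      have "?y \<ge> 1 * x" using that by (intro mult_right_mono) auto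
      then have y: "?y \<ge> x0" "0 < ?y" using that by linarith+
      have "mean_excess ?y \<le> 2 * ?y * tail ?y + mean_excess (2 * ?y)" using step y by blast
      moreover have "6 * (2 * ?y) * tail (2 * ?y) \<le> 6 * (2 * ?y) * (tail ?y / 3)"
        using third[OF y(1)] y by (intro mult_left_mono) auto
      ultimately show ?case using Suc by (simp add: algebra_simps)
    qed
    moreover have "0 \<le> 6 * (2^N * x) * tail (2^N * x)" using that by simp
    ultimately show ?thesis by linarith
  qed
  have lim: "(\<lambda>N. mean_excess (2^N * x)) \<longlonglongrightarrow> 0" if "0 < x" for x
  proof -
    have "(\<lambda>N. mean_excess (2^N * x)) \<longlonglongrightarrow> expectation (\<lambda>\<omega>. 0)"
      unfolding mean_excess_def
    proof (rule integral_dominated_convergence[where w = "\<lambda>\<omega>. \<bar>Z \<omega>\<bar>"])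
      show "AE \<omega> in M. (\<lambda>N. \<bar>Z \<omega> - trunc (2^N * x) (Z \<omega>)\<bar>) \<longlonglongrightarrow> 0"
      proof (intro AE_I2 tendsto_eventually)
        fix \<omega>
        obtain k where k: "\<bar>Z \<omega>\<bar> / x < 2^k" using real_arch_pow[of 2 "\<bar>Z \<omega>\<bar> / x"] by auto
        show "\<forall>\<^sub>F N in sequentially. \<bar>Z \<omega> - trunc (2^N * x) (Z \<omega>)\<bar> = 0"
          using eventually_ge_at_top[of k]
        proof eventually_elim
          case (elim N)
          then have "(2::real)^k \<le> 2^N" by simp
          then have "2^k * x \<le> 2^N * x" using that by simp
          moreover have "\<bar>Z \<omega>\<bar> < 2^k * x" using k that by (simp add: field_simps)
          ultimately have "\<bar>Z \<omega>\<bar> \<le> 2^N * x" by linarith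
          then show ?case by (simp add: trunc_def)
        qed
      qed
      show "AE \<omega> in M. norm \<bar>Z \<omega> - trunc (2 ^ N * x) (Z \<omega>)\<bar> \<le> \<bar>Z \<omega>\<bar>" for N
        by (auto simp: trunc_def)
    qed (use integrable_Z in auto)
    then show ?thesis by simp
  qed
  show ?thesis using eventually_ge_at_top[of "max 1 x0"]
  proof eventually_elim
    case (elim x)
    have "(\<lambda>N. 6 * x * tail x + mean_excess (2^N * x)) \<longlonglongrightarrow> 6 * x * tail x + 0"
      using elim by (intro tendsto_intros lim) auto
    then have "mean_excess x \<le> 6 * x * tail x + 0"
      by (rule LIMSEQ_le_const) (use iter elim in auto)
    then show ?case by simp
  qed
qed

text \<open>Values up to \<open>d x\<close> contribute at most \<open>d x\<close> times the truncated second moment, and larger ones at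
  most \<open>x\<^sup>3 T(d x)\<close>, which is negligible for every fixed \<open>d > 0\<close>.\<close>

lemma third_moment_negligible:
  "((\<lambda>x. expectation (\<lambda>\<omega>. \<bar>trunc x (Z \<omega>)\<bar>^3) / (x * trunc_moment x)) \<longlongrightarrow> 0) at_top"
proof (rule order_tendstoI)
  fix e :: real assume "e < 0"
  show "\<forall>\<^sub>F x in at_top. e < expectation (\<lambda>\<omega>. \<bar>trunc x (Z \<omega>)\<bar>^3) / (x * trunc_moment x)"
    using eventually_ge_at_top[of 0]
  proof eventually_elim
    case (elim x)
    have "0 \<le> expectation (\<lambda>\<omega>. \<bar>trunc x (Z \<omega>)\<bar>^3) / (x * trunc_moment x)"
      using elim trunc_moment_nonneg by simp
    then show ?case using \<open>e < 0\<close> by linarith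
  qed
next
  fix e :: real assume e: "0 < e"
  define d where "d = min 1 (e/2)"
  have d: "0 < d" "d \<le> 1" "d \<le> e/2" using e by (auto simp: d_def)
  let ?I = "\<lambda>x z. indicat_real {z. x < \<bar>z\<bar>} z"
  have "((\<lambda>x. tail (d * x) / tail x * (x\<^sup>2 * tail x / trunc_moment x)) \<longlongrightarrow> 1/d\<^sup>2 * 0) at_top"
    by (intro tendsto_mult tail_scale square_tail_negligible d)
  then have "\<forall>\<^sub>F x in at_top. tail (d * x) / tail x * (x\<^sup>2 * tail x / trunc_moment x) < e/2"
    by (rule order_tendstoD) (use e in simp)
  then show "\<forall>\<^sub>F x in at_top. expectation (\<lambda>\<omega>. \<bar>trunc x (Z \<omega>)\<bar>^3) / (x * trunc_moment x) < e"
    using trunc_moment_pos eventually_gt_at_top[of 0]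
  proof eventually_elim
    case (elim x)
    have pw: "\<bar>trunc x z\<bar>^3 \<le> d * x * (trunc x z)\<^sup>2 + x^3 * ?I (d * x) z" for z
    proof (cases "\<bar>z\<bar> \<le> d * x")
      case True
      have "\<bar>trunc x z\<bar>^3 = \<bar>trunc x z\<bar> * (trunc x z)\<^sup>2" by (simp add: power3_eq_cube power2_eq_square)
      also have "\<dots> \<le> d * x * (trunc x z)\<^sup>2"
        using True abs_trunc_le[of x z] by (intro mult_right_mono) auto
      finally show ?thesis using True by (simp add: indicator_def)
    next
      case False
      have "\<bar>trunc x z\<bar>^3 \<le> x^3" using elim by (intro power_mono abs_trunc_le_level) auto
      moreover have "0 \<le> d * x * (trunc x z)\<^sup>2" using d elim by simp
      ultimately show ?thesis using False by (simp add: indicator_def)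
    qed
    have "expectation (\<lambda>\<omega>. \<bar>trunc x (Z \<omega>)\<bar>^3)
        \<le> expectation (\<lambda>\<omega>. d * x * (trunc x (Z \<omega>))\<^sup>2 + x^3 * ?I (d * x) (Z \<omega>))"
      using integrable_trunc_power[of x 2] integrable_tail[of "d * x"] pw
        integrable_abs[OF integrable_trunc_power[of x 3]]
      by (intro integral_mono) (auto simp: power_abs)
    also have "\<dots> = d * x * trunc_moment x + x^3 * tail (d * x)"
      using integrable_trunc_power[of x 2] integrable_tail[of "d * x"]
      by (simp add: expectation_tail trunc_moment_def)
    finally have le: "expectation (\<lambda>\<omega>. \<bar>trunc x (Z \<omega>)\<bar>^3) \<le> d * x * trunc_moment x + x^3 * tail (d * x)" .
    have "x\<^sup>2 * tail (d * x) < e/2 * trunc_moment x"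
      using elim tail_pos[of x] by (simp add: field_simps)
    then have "x * (x\<^sup>2 * tail (d * x)) < x * (e/2 * trunc_moment x)" using elim by simp
    moreover have "d * x * trunc_moment x \<le> e/2 * x * trunc_moment x"
      using d elim by (intro mult_right_mono) auto
    ultimately have "expectation (\<lambda>\<omega>. \<bar>trunc x (Z \<omega>)\<bar>^3) < e * (x * trunc_moment x)"
      using le by (simp add: algebra_simps power3_eq_cube power2_eq_square)
    then show ?case using elim by (simp add: field_simps)
  qed
qed

end

section \<open>Stationarity, m-dependence and the spectral tail process\<close>

lemma (in prob_space) integral_uniform_measure_event:
  fixes f :: "'a \<Rightarrow> real"
  assumes A [measurable]: "A \<in> events" and pos: "0 < prob A" and f [measurable]: "f \<in> borel_measurable M"
  shows "integral\<^sup>L (uniform_measure M A) f = expectation (\<lambda>\<omega>. f \<omega> * indicator A \<omega>) / prob A"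
proof -
  have "uniform_measure M A = density M (\<lambda>\<omega>. ennreal (indicator A \<omega> / prob A))"
    unfolding uniform_measure_def
  proof (rule density_cong)
    show "AE \<omega> in M. indicator A \<omega> / emeasure M A = ennreal (indicator A \<omega> / prob A)"
      using pos by (auto simp: emeasure_eq_measure indicator_def divide_ennreal[symmetric])
  qed simp_all
  then have "integral\<^sup>L (uniform_measure M A) f
      = expectation (\<lambda>\<omega>. (indicator A \<omega> / prob A) *\<^sub>R f \<omega>)"
    by (simp add: integral_density)
  also have "\<dots> = expectation (\<lambda>\<omega>. (f \<omega> * indicator A \<omega>) * (1 / prob A))"
    by (intro Bochner_Integration.integral_cong) auto
  finally show ?thesis by (simp del: of_bool_eq mult_indicator_cong)
qed

lemma (in prob_space) indep_set_sym: "indep_set A B \<Longrightarrow> indep_set B A"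
  unfolding indep_sets2_eq by (metis Int_commute mult.commute)

lemma continuous_on_borel_PiM:
  fixes F :: "(int \<Rightarrow> real) \<Rightarrow> real"
  assumes "continuous_on UNIV F"
  shows "F \<in> borel_measurable (PiM UNIV (\<lambda>_. borel))"
  using borel_measurable_continuous_onI[OF assms] measurable_cong_sets[OF sets_PiM_equal_borel refl]
  by blast

text \<open>Only finitely many coordinates of a path are seen by the convergence that defines the tail process.
  Test functions live on full paths and are required to depend on a symmetric window.\<close>

definition window :: "nat \<Rightarrow> int set" where
  "window h = {- int h..int h}"

definition depends_on_window :: "nat \<Rightarrow> ((int \<Rightarrow> real) \<Rightarrow> real) \<Rightarrow> bool" where
  "depends_on_window h F \<longleftrightarrow> (\<forall>z z'. (\<forall>t\<in>window h. z t = z' t) \<longrightarrow> F z = F z')"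

lemma restrict_measurable_PiM_UNIV:
  "(\<lambda>z. restrict z I) \<in> measurable (PiM I (\<lambda>_. borel)) (PiM UNIV (\<lambda>_. borel))"
proof (rule measurable_PiM_single')
  fix i
  show "(\<lambda>z. restrict z I i) \<in> borel_measurable (PiM I (\<lambda>_. borel))"
    by (cases "i \<in> I") auto
qed auto

text \<open>A discrete layer-cake formula: \<open>s\<close> is \<open>min v y\<close> rounded up. The error of at
  most 1 is harmless since it is compared with quantities tending to infinity, and the sum avoids a
  double integral.\<close>

lemma layer_sum:
  fixes v y :: real
  assumes "0 \<le> v" "0 \<le> y"
  defines "s \<equiv> (\<Sum>i<nat \<lceil>y\<rceil>. indicat_real {i. real i < v} i)"
  shows "min v y \<le> s" "s \<le> min v y + 1"
proof -
  have "{..<nat \<lceil>y\<rceil>} \<inter> {i. real i < v} = {..<nat \<lceil>min v y\<rceil>}"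
    using assms(1,2) by (auto simp: zless_nat_eq_int_zless less_ceiling_iff)
  then have "s = real (nat \<lceil>min v y\<rceil>)"
    unfolding s_def indicator_def by (simp add: sum.If_cases)
  then show "min v y \<le> s" "s \<le> min v y + 1"
    using assms(1,2) by linarith+
qed

text \<open>A continuous substitute for the indicator of \<open>|r| > a\<close>, as weak convergence only tests continuous
  functions.\<close>

definition ramp :: "real \<Rightarrow> real \<Rightarrow> real \<Rightarrow> real" where
  "ramp a b r = min 1 (max 0 ((\<bar>r\<bar> - a) / (b - a)))"

lemma ramp_bounds:
  assumes "a < b"
  shows "0 \<le> ramp a b r" "ramp a b r \<le> 1" "b \<le> \<bar>r\<bar> \<Longrightarrow> ramp a b r = 1" "\<bar>r\<bar> \<le> a \<Longrightarrow> ramp a b r = 0"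
  using assms by (auto simp: ramp_def max_def min_def field_simps divide_le_0_iff)

lemma ramp_measurable [measurable]: "ramp a b \<in> borel_measurable borel"
  unfolding ramp_def by measurable

locale tail_process = heavy_tail M "X 0" L + N: prob_space N
  for M :: "'a measure" and X :: "int \<Rightarrow> 'a \<Rightarrow> real" and L and N :: "'b measure" +
  fixes \<Theta> :: "int \<Rightarrow> 'b \<Rightarrow> real" and Y :: "'b \<Rightarrow> real" and m :: nat
  assumes stationary: "strictly_stationary M X"
    and mdep: "m_dependent m M X"
    and Y_tail: "1 < x \<Longrightarrow> N.prob {\<omega> \<in> space N. x < Y \<omega>} = x powr (-2)"
    and Y_indep: "indep_rvs N borel Y (PiM UNIV (\<lambda>_. borel)) (\<lambda>\<omega> t. \<Theta> t \<omega>)"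
    and conv: "weak_conv_vec {- int h..int h}
           (\<lambda>x. distr (uniform_measure M {\<omega> \<in> space M. \<bar>X 0 \<omega>\<bar> > x})
                  (PiM {- int h..int h} (\<lambda>_. borel))
                  (\<lambda>\<omega>. \<lambda>t\<in>{- int h..int h}. X t \<omega> / x))
           (distr N (PiM {- int h..int h} (\<lambda>_. borel))
                  (\<lambda>\<omega>. \<lambda>t\<in>{- int h..int h}. Y \<omega> * \<Theta> t \<omega>))
           at_top"
begin

lemma X_measurable [measurable]: "X t \<in> borel_measurable M"
  using stationary by (simp add: strictly_stationary_def)

lemma path_measurable: "(\<lambda>\<omega> t. X (t + k) \<omega>) \<in> measurable M (PiM UNIV (\<lambda>_. borel))"
  by (rule measurable_PiM_single') auto

lemma expectation_shift:
  fixes f :: "(int \<Rightarrow> real) \<Rightarrow> 'c :: {banach, second_countable_topology}"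
  assumes "f \<in> borel_measurable (PiM UNIV (\<lambda>_. borel))"
  shows "expectation (\<lambda>\<omega>. f (\<lambda>t. X (t + k) \<omega>)) = expectation (\<lambda>\<omega>. f (\<lambda>t. X t \<omega>))"
proof -
  have "expectation (\<lambda>\<omega>. f (\<lambda>t. X (t + k) \<omega>))
      = integral\<^sup>L (distr M (PiM UNIV (\<lambda>_. borel)) (\<lambda>\<omega> t. X (t + k) \<omega>)) f"
    by (rule integral_distr[symmetric, OF path_measurable assms])
  also have "\<dots> = integral\<^sup>L (distr M (PiM UNIV (\<lambda>_. borel)) (\<lambda>\<omega> t. X t \<omega>)) f"
    using stationary by (simp add: strictly_stationary_def)
  also have "\<dots> = expectation (\<lambda>\<omega>. f (\<lambda>t. X t \<omega>))"
    using path_measurable[of 0] by (intro integral_distr assms) simp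
  finally show ?thesis .
qed

lemma expectation_marginal:
  fixes f :: "real \<Rightarrow> 'c :: {banach, second_countable_topology}"
  assumes [measurable]: "f \<in> borel_measurable borel"
  shows "expectation (\<lambda>\<omega>. f (X t \<omega>)) = expectation (\<lambda>\<omega>. f (X 0 \<omega>))"
  using expectation_shift[of "\<lambda>z. f (z 0)" t] by simp

lemma integrable_marginal:
  fixes f :: "real \<Rightarrow> real"
  assumes [measurable]: "f \<in> borel_measurable borel" and int: "integrable M (\<lambda>\<omega>. f (X 0 \<omega>))"
  shows "integrable M (\<lambda>\<omega>. f (X t \<omega>))"
proof -
  have eq: "distr M borel (X s) = distr (distr M (PiM UNIV (\<lambda>_. borel)) (\<lambda>\<omega> t. X (t + s) \<omega>)) borel (\<lambda>z. z 0)" for s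
    by (subst distr_distr[OF _ path_measurable]) (auto simp: comp_def)
  have "distr M borel (X t) = distr M borel (X 0)"
    unfolding eq using stationary unfolding strictly_stationary_def by metis
  moreover have "integrable (distr M borel (X 0)) f"
    using int by (simp add: integrable_distr_eq)
  ultimately have "integrable (distr M borel (X t)) f" by simp
  then show ?thesis by (simp add: integrable_distr_eq)
qed

lemma expectation_tail': "expectation (\<lambda>\<omega>. indicat_real {z. x < \<bar>z\<bar>} (X t \<omega>)) = tail x"
  using expectation_marginal[of "indicat_real {z. x < \<bar>z\<bar>}" t] by (simp add: expectation_tail)

lemma integrable_tail': "integrable M (\<lambda>\<omega>. indicat_real {z. x < \<bar>z\<bar>} (X t \<omega>))"
  by (rule integrable_marginal[OF _ integrable_tail]) simp

text \<open>The form of m-dependence used for blocks: functions of the path up to \<open>s\<close> and from \<open>u > s + m\<close> on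
  are independent.\<close>

lemma past_future_indep:
  assumes "int m + s < u" "f \<in> borel_measurable (PiM {..s} (\<lambda>_. borel))"
    "g \<in> borel_measurable (PiM {u..} (\<lambda>_. borel))"
  shows "indep_var borel (\<lambda>\<omega>. f (\<lambda>i\<in>{..s}. X i \<omega>)) borel (\<lambda>\<omega>. g (\<lambda>i\<in>{u..}. X i \<omega>))"
proof -
  have "(\<lambda>z. restrict z {u..}) \<in> measurable (PiM {s + int m<..} (\<lambda>_. borel)) (PiM {u..} (\<lambda>_. borel))"
    by (rule measurable_restrict_subset) (use assms(1) in auto)
  then have g': "g \<circ> (\<lambda>z. restrict z {u..}) \<in> borel_measurable (PiM {s + int m<..} (\<lambda>_. borel))"
    using assms(3) by (rule measurable_comp)
  have sub: "{s + int m<..} \<inter> {u..} = {u..}" using assms(1) by auto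
  have "indep_var (PiM {..s} (\<lambda>_. borel)) (\<lambda>\<omega>. \<lambda>i\<in>{..s}. X i \<omega>)
      (PiM {s + int m<..} (\<lambda>_. borel)) (\<lambda>\<omega>. \<lambda>i\<in>{s + int m<..}. X i \<omega>)"
    using mdep by (simp add: m_dependent_def)
  from indep_var_compose[OF this assms(2) g'] show ?thesis
    by (simp add: comp_def restrict_restrict sub)
qed

lemma indep_coordinates:
  assumes "int m < \<bar>s - t\<bar>"
  shows "indep_var borel (X s) borel (X t)"
proof -
  have *: "indep_var borel (X s) borel (X t)" if "int m + s < t" for s t
    using past_future_indep[OF that, of "\<lambda>z. z s" "\<lambda>z. z t"] by simp
  show ?thesis
  proof (cases "s < t")
    case True then show ?thesis using assms by (intro *) simp
  next
    case False
    then have "indep_var borel (X t) borel (X s)" using assms by (intro *) simp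
    then show ?thesis unfolding indep_var_eq using indep_set_sym by blast
  qed
qed

lemma Y_measurable [measurable]: "Y \<in> borel_measurable N"
  using Y_indep by (simp add: indep_rvs_def)

lemma \<Theta>_path_measurable: "(\<lambda>\<omega> t. \<Theta> t \<omega>) \<in> measurable N (PiM UNIV (\<lambda>_. borel))"
  using Y_indep by (simp add: indep_rvs_def)

lemma \<Theta>_measurable [measurable]: "\<Theta> t \<in> borel_measurable N"
  using measurable_comp[OF \<Theta>_path_measurable measurable_component_singleton[of t UNIV]]
  by (simp add: comp_def)

text \<open>The defining convergence of the tail process, restated with integrals over \<open>M\<close> and with test
  functions on full paths.\<close>

lemma conditional_limit:
  assumes cont: "continuous_on UNIV g" and bdd: "\<And>z. \<bar>g z\<bar> \<le> C" and win: "depends_on_window h g"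
  shows "((\<lambda>x. expectation (\<lambda>\<omega>. g (\<lambda>t. X t \<omega> / x) * indicator {z. x < \<bar>z\<bar>} (X 0 \<omega>)) / tail x)
    \<longlongrightarrow> N.expectation (\<lambda>\<omega>. g (\<lambda>t. Y \<omega> * \<Theta> t \<omega>))) at_top"
proof -
  let ?I = "{- int h..int h}"
  let ?P = "PiM ?I (\<lambda>_. borel :: real measure)"
  have [measurable]: "g \<in> borel_measurable (PiM UNIV (\<lambda>_. borel))"
    by (rule continuous_on_borel_PiM[OF cont])
  have restr: "g (restrict z ?I) = g z" for z
    using win by (auto simp: depends_on_window_def window_def)
  have gP: "g \<in> borel_measurable ?P"
    using measurable_comp[OF restrict_measurable_PiM_UNIV, of g borel ?I] by (simp add: comp_def restr)
  have lim: "((\<lambda>x. integral\<^sup>L (distr (uniform_measure M {\<omega> \<in> space M. \<bar>X 0 \<omega>\<bar> > x}) ?P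
       (\<lambda>\<omega>. \<lambda>t\<in>?I. X t \<omega> / x)) g)
     \<longlongrightarrow> integral\<^sup>L (distr N ?P (\<lambda>\<omega>. \<lambda>t\<in>?I. Y \<omega> * \<Theta> t \<omega>)) g) at_top"
  proof -
    have "continuous_on (PiE ?I (\<lambda>_. UNIV)) g" using cont continuous_on_subset by blast
    moreover have "bounded (g ` PiE ?I (\<lambda>_. UNIV))" using bdd by (auto simp: bounded_iff)
    ultimately show ?thesis using conv[of h] unfolding weak_conv_vec_def by blast
  qed
  have right: "integral\<^sup>L (distr N ?P (\<lambda>\<omega>. \<lambda>t\<in>?I. Y \<omega> * \<Theta> t \<omega>)) g
      = N.expectation (\<lambda>\<omega>. g (\<lambda>t. Y \<omega> * \<Theta> t \<omega>))"
    by (subst integral_distr[OF _ gP]) (auto intro!: measurable_restrict simp: restr)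
  have left: "integral\<^sup>L (distr (uniform_measure M {\<omega> \<in> space M. \<bar>X 0 \<omega>\<bar> > x}) ?P
       (\<lambda>\<omega>. \<lambda>t\<in>?I. X t \<omega> / x)) g
     = expectation (\<lambda>\<omega>. g (\<lambda>t. X t \<omega> / x) * indicator {z. x < \<bar>z\<bar>} (X 0 \<omega>)) / tail x" for x
  proof -
    let ?A = "{\<omega> \<in> space M. \<bar>X 0 \<omega>\<bar> > x}"
    have path: "(\<lambda>\<omega> t. X t \<omega> / x) \<in> measurable M (PiM UNIV (\<lambda>_. borel))"
      by (rule measurable_PiM_single') auto
    have gX: "(\<lambda>\<omega>. g (\<lambda>t. X t \<omega> / x)) \<in> borel_measurable M"
      using measurable_comp[OF path, of g borel] by (simp add: comp_def)
    have "integral\<^sup>L (distr (uniform_measure M ?A) ?P (\<lambda>\<omega>. \<lambda>t\<in>?I. X t \<omega> / x)) g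
        = integral\<^sup>L (uniform_measure M ?A) (\<lambda>\<omega>. g (\<lambda>t. X t \<omega> / x))"
      by (subst integral_distr[OF _ gP]) (auto intro!: measurable_restrict simp: restr)
    also have "\<dots> = expectation (\<lambda>\<omega>. g (\<lambda>t. X t \<omega> / x) * indicator ?A \<omega>) / prob ?A"
      using tail_pos[of x] gX by (intro integral_uniform_measure_event) (auto simp: tail_def)
    also have "\<dots> = expectation (\<lambda>\<omega>. g (\<lambda>t. X t \<omega> / x) * indicator {z. x < \<bar>z\<bar>} (X 0 \<omega>)) / tail x"
      unfolding tail_def
      by (intro arg_cong2[where f = "(/)"] Bochner_Integration.integral_cong) (auto simp: indicator_def)
    finally show ?thesis .
  qed
  show ?thesis using lim unfolding left right .
qed

lemma Y_\<Theta>_product: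
  assumes [measurable]: "A \<in> sets borel" "B \<in> sets borel"
  shows "N.prob {\<omega> \<in> space N. Y \<omega> \<in> A \<and> \<Theta> t \<omega> \<in> B}
    = N.prob {\<omega> \<in> space N. Y \<omega> \<in> A} * N.prob {\<omega> \<in> space N. \<Theta> t \<omega> \<in> B}"
proof -
  let ?P = "PiM UNIV (\<lambda>_. borel :: real measure)"
  let ?S = "(\<lambda>\<omega> t. \<Theta> t \<omega>) -` {z \<in> space ?P. z t \<in> B} \<inter> space N"
  have ind: "N.indep_set {Y -` A \<inter> space N | A. A \<in> sets borel}
      {(\<lambda>\<omega> t. \<Theta> t \<omega>) -` B \<inter> space N | B. B \<in> sets ?P}"
    using Y_indep by (simp add: indep_rvs_def)
  have "N.prob ((Y -` A \<inter> space N) \<inter> ?S) = N.prob (Y -` A \<inter> space N) * N.prob ?S"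
  proof (rule N.indep_setD[OF ind])
    show "Y -` A \<inter> space N \<in> {Y -` A \<inter> space N | A. A \<in> sets borel}" using assms(1) by blast
    have "{z \<in> space ?P. z t \<in> B} \<in> sets ?P" by measurable
    then show "?S \<in> {(\<lambda>\<omega> t. \<Theta> t \<omega>) -` B \<inter> space N | B. B \<in> sets ?P}" by blast
  qed
  moreover have "?S = {\<omega> \<in> space N. \<Theta> t \<omega> \<in> B}" by (auto simp: space_PiM)
  moreover have "Y -` A \<inter> space N = {\<omega> \<in> space N. Y \<omega> \<in> A}" by auto
  moreover have "(Y -` A \<inter> space N) \<inter> {\<omega> \<in> space N. \<Theta> t \<omega> \<in> B} = {\<omega> \<in> space N. Y \<omega> \<in> A \<and> \<Theta> t \<omega> \<in> B}"
    by auto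
  ultimately show ?thesis by metis
qed

lemma AE_Y_gt_1: "AE \<omega> in N. 1 < Y \<omega>"
proof -
  let ?p = "N.prob {\<omega> \<in> space N. 1 < Y \<omega>}"
  have "(\<lambda>n. (1 + inverse (real (Suc n))) powr (-2)) \<longlonglongrightarrow> (1 + 0) powr (-2)"
    by (intro tendsto_intros LIMSEQ_inverse_real_of_nat) auto
  then have "(1 + 0) powr (-2) \<le> ?p"
  proof (rule LIMSEQ_le_const2)
    have "(1 + inverse (real (Suc n))) powr (-2) \<le> ?p" for n
    proof -
      have gt: "1 < 1 + inverse (real (Suc n))" by simp
      have "N.prob {\<omega> \<in> space N. 1 + inverse (real (Suc n)) < Y \<omega>} \<le> ?p"
        using gt by (intro N.finite_measure_mono) (auto simp: less_trans[OF gt])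
      then show ?thesis unfolding Y_tail[OF gt] .
    qed
    then show "\<exists>N. \<forall>n\<ge>N. (1 + inverse (real (Suc n))) powr (-2) \<le> ?p" by blast
  qed
  then have "?p = 1" using N.prob_le_1 by (simp add: antisym)
  then show ?thesis by (simp add: N.prob_Collect_eq_1)
qed

lemma ramp_limit:
  assumes "a < b"
  shows "((\<lambda>x. expectation (\<lambda>\<omega>. ramp a b (X 0 \<omega> / x) * indicator {z. x < \<bar>z\<bar>} (X 0 \<omega>)) / tail x)
    \<longlongrightarrow> N.expectation (\<lambda>\<omega>. ramp a b (Y \<omega> * \<Theta> 0 \<omega>))) at_top"
proof (rule conditional_limit[where C = 1 and h = 0])
  show "continuous_on UNIV (\<lambda>z :: int \<Rightarrow> real. ramp a b (z 0))"
    unfolding ramp_def using assms by (intro continuous_intros) auto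
  show "\<bar>ramp a b (z 0)\<bar> \<le> 1" for z :: "int \<Rightarrow> real" using ramp_bounds[OF assms, of "z 0"] by simp
qed (auto simp: depends_on_window_def window_def)

lemma AE_product_gt:
  assumes "a < 1"
  shows "AE \<omega> in N. a < \<bar>Y \<omega> * \<Theta> 0 \<omega>\<bar>"
proof -
  have "\<forall>\<^sub>F x in at_top. expectation (\<lambda>\<omega>. ramp a 1 (X 0 \<omega> / x) * indicator {z. x < \<bar>z\<bar>} (X 0 \<omega>)) / tail x = 1"
    using eventually_gt_at_top[of 0]
  proof eventually_elim
    case (elim x)
    have "expectation (\<lambda>\<omega>. ramp a 1 (X 0 \<omega> / x) * indicator {z. x < \<bar>z\<bar>} (X 0 \<omega>))
        = expectation (\<lambda>\<omega>. indicator {z. x < \<bar>z\<bar>} (X 0 \<omega>))"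
      using elim assms by (intro Bochner_Integration.integral_cong)
        (auto simp: indicator_def intro!: ramp_bounds(3))
    then show ?case using tail_pos[of x] by (simp add: expectation_tail)
  qed
  from tendsto_unique[OF _ ramp_limit[OF assms] tendsto_eventually[OF this]]
  have E1: "N.expectation (\<lambda>\<omega>. ramp a 1 (Y \<omega> * \<Theta> 0 \<omega>)) = 1" by simp
  have int: "integrable N (\<lambda>\<omega>. ramp a 1 (Y \<omega> * \<Theta> 0 \<omega>))"
    using ramp_bounds[OF assms] by (intro N.integrable_const_bound[where B = 1]) auto
  have "AE \<omega> in N. 1 - ramp a 1 (Y \<omega> * \<Theta> 0 \<omega>) = 0"
    using ramp_bounds[OF assms] int E1
    by (subst integral_nonneg_eq_0_iff_AE[symmetric]) (auto simp: N.prob_space)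
  then show ?thesis
  proof eventually_elim
    case (elim \<omega>)
    then show ?case using ramp_bounds(4)[OF assms, of "Y \<omega> * \<Theta> 0 \<omega>"] by force
  qed
qed

lemma prob_product_ge:
  assumes "1 < b"
  shows "N.prob {\<omega> \<in> space N. b \<le> \<bar>Y \<omega> * \<Theta> 0 \<omega>\<bar>} \<le> 1 / b\<^sup>2"
proof -
  have le: "N.prob {\<omega> \<in> space N. b \<le> \<bar>Y \<omega> * \<Theta> 0 \<omega>\<bar>} \<le> 1 / a\<^sup>2" if a: "1 \<le> a" "a < b" for a
  proof -
    have int: "integrable N (\<lambda>\<omega>. ramp a b (Y \<omega> * \<Theta> 0 \<omega>))"
      using ramp_bounds[OF a(2)] by (intro N.integrable_const_bound[where B = 1]) auto
    have "N.prob {\<omega> \<in> space N. b \<le> \<bar>Y \<omega> * \<Theta> 0 \<omega>\<bar>}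
        = N.expectation (indicator {\<omega> \<in> space N. b \<le> \<bar>Y \<omega> * \<Theta> 0 \<omega>\<bar>})" by simp
    also have "\<dots> \<le> N.expectation (\<lambda>\<omega>. ramp a b (Y \<omega> * \<Theta> 0 \<omega>))"
      using int ramp_bounds[OF a(2)]
      by (intro integral_mono N.integrable_const_bound[where B = 1]) (auto simp: indicator_def)
    also have "\<dots> \<le> 1 / a\<^sup>2"
    proof (rule tendsto_le[OF _ tail_scale ramp_limit[OF a(2)]])
      show "\<forall>\<^sub>F x in at_top. expectation (\<lambda>\<omega>. ramp a b (X 0 \<omega> / x) * indicator {z. x < \<bar>z\<bar>} (X 0 \<omega>)) / tail x
          \<le> tail (a * x) / tail x"
        using eventually_gt_at_top[of 0]
      proof eventually_elim
        case (elim x)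
        have pw: "ramp a b (z / x) * indicator {z. x < \<bar>z\<bar>} z \<le> indicat_real {z. a * x < \<bar>z\<bar>} z" for z
        proof (cases "a * x < \<bar>z\<bar>")
          case False
          then have "ramp a b (z / x) = 0" using elim by (intro ramp_bounds(4) a(2)) (simp add: field_simps)
          then show ?thesis by simp
        qed (use ramp_bounds[OF a(2)] in \<open>simp add: indicator_def\<close>)
        have "expectation (\<lambda>\<omega>. ramp a b (X 0 \<omega> / x) * indicator {z. x < \<bar>z\<bar>} (X 0 \<omega>))
            \<le> expectation (\<lambda>\<omega>. indicat_real {z. a * x < \<bar>z\<bar>} (X 0 \<omega>))"
          using pw ramp_bounds[OF a(2)]
          by (intro integral_mono integrable_tail integrable_const_bound[where B = 1])
            (auto simp: indicator_def)
        then show ?case using tail_pos[of x] by (simp add: expectation_tail divide_right_mono)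
      qed
    qed (use a in auto)
    finally show ?thesis .
  qed
  have "((\<lambda>a. 1 / a\<^sup>2) \<longlongrightarrow> 1 / b\<^sup>2) (at_left b)"
    using assms by (intro tendsto_intros) auto
  moreover have "\<forall>\<^sub>F a in at_left b. N.prob {\<omega> \<in> space N. b \<le> \<bar>Y \<omega> * \<Theta> 0 \<omega>\<bar>} \<le> 1 / a\<^sup>2"
    using eventually_at_left_real[OF assms] by eventually_elim (auto intro: le)
  ultimately show ?thesis
    by (intro tendsto_lowerbound) (auto simp: trivial_limit_at_left_real)
qed

text \<open>Both \<open>Y\<close> and \<open>|Y \<Theta>\<^sub>0|\<close> have the Pareto tail \<open>x\<^sup>-\<^sup>2\<close> on \<open>x > 1\<close>. Since \<open>Y\<close> comes arbitrarily close to 1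
  with positive probability, independence forbids \<open>|\<Theta>\<^sub>0| < 1\<close>; and mass of \<open>|\<Theta>\<^sub>0|\<close> above 1 would make the
  tail of the product too heavy.\<close>

lemma AE_\<Theta>_0: "AE \<omega> in N. \<bar>\<Theta> 0 \<omega>\<bar> = 1"
proof -
  have ge: "AE \<omega> in N. c\<^sup>2 < \<bar>\<Theta> 0 \<omega>\<bar>" if c: "0 < c" "c < 1" for c
  proof -
    have "N.prob {\<omega> \<in> space N. Y \<omega> \<in> {..1/c} \<and> \<Theta> 0 \<omega> \<in> {r. \<bar>r\<bar> \<le> c\<^sup>2}} = 0"
    proof -
      have "AE \<omega> in N. \<not> (Y \<omega> \<in> {..1/c} \<and> \<Theta> 0 \<omega> \<in> {r. \<bar>r\<bar> \<le> c\<^sup>2})"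
        using AE_product_gt[OF c(2)] AE_Y_gt_1
      proof eventually_elim
        case (elim \<omega>)
        have "\<bar>Y \<omega> * \<Theta> 0 \<omega>\<bar> \<le> 1/c * c\<^sup>2" if "Y \<omega> \<le> 1/c" "\<bar>\<Theta> 0 \<omega>\<bar> \<le> c\<^sup>2"
          unfolding abs_mult using that elim c by (intro mult_mono) auto
        then show ?case using elim c by (auto simp: power2_eq_square)
      qed
      then show ?thesis by (subst N.prob_eq_0) auto
    qed
    moreover have "N.prob {\<omega> \<in> space N. Y \<omega> \<in> {..1/c}} = 1 - c\<^sup>2"
    proof -
      have "N.prob {\<omega> \<in> space N. \<not> 1/c < Y \<omega>} = 1 - N.prob {\<omega> \<in> space N. 1/c < Y \<omega>}"
        by (rule N.prob_neg) auto
      also have "N.prob {\<omega> \<in> space N. 1/c < Y \<omega>} = c\<^sup>2"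
        using c by (subst Y_tail) (auto simp: powr_minus powr_numeral field_simps)
      finally show ?thesis by (simp add: not_less)
    qed
    moreover have "c\<^sup>2 < 1" using c by (simp add: power_less_one_iff)
    ultimately have "N.prob {\<omega> \<in> space N. \<Theta> 0 \<omega> \<in> {r. \<bar>r\<bar> \<le> c\<^sup>2}} = 0"
      by (subst (asm) Y_\<Theta>_product) auto
    then show ?thesis by (subst (asm) N.prob_eq_0) (auto simp: not_le)
  qed
  have ge1: "AE \<omega> in N. 1 \<le> \<bar>\<Theta> 0 \<omega>\<bar>"
  proof -
    let ?c = "\<lambda>n::nat. 1 - inverse (real (Suc (Suc n)))"
    have "AE \<omega> in N. \<forall>n. (?c n)\<^sup>2 < \<bar>\<Theta> 0 \<omega>\<bar>"
      unfolding AE_all_countable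
    proof
      fix n
      have "inverse (real (Suc (Suc n))) < 1" by (rule inverse_less_1_iff[THEN iffD2]) simp
      then show "AE \<omega> in N. (?c n)\<^sup>2 < \<bar>\<Theta> 0 \<omega>\<bar>" by (intro ge) auto
    qed
    then show ?thesis
    proof eventually_elim
      case (elim \<omega>)
      have "(\<lambda>n. (?c n)\<^sup>2) \<longlonglongrightarrow> (1 - 0)\<^sup>2"
        by (intro tendsto_intros LIMSEQ_Suc[OF LIMSEQ_inverse_real_of_nat])
      then show ?case using elim
        by (intro LIMSEQ_le_const2[where X = "\<lambda>n. (?c n)\<^sup>2"]) (auto intro: less_imp_le)
    qed
  qed
  have le: "AE \<omega> in N. \<bar>\<Theta> 0 \<omega>\<bar> \<le> d" if d: "1 < d" for d
  proof -
    let ?A = "{\<omega> \<in> space N. Y \<omega> \<in> {d<..} \<and> \<Theta> 0 \<omega> \<in> {r. d < \<bar>r\<bar>}}"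
    let ?B = "{\<omega> \<in> space N. Y \<omega> \<in> {d\<^sup>2<..} \<and> \<Theta> 0 \<omega> \<in> {r. 1 \<le> \<bar>r\<bar> \<and> \<bar>r\<bar> \<le> d}}"
    \<comment> \<open>Compare the tail at \<open>d\<^sup>2\<close>: on \<open>|\<Theta>\<^sub>0| > d\<close> it suffices that \<open>Y > d\<close>.\<close>
    define q where "q = N.prob {\<omega> \<in> space N. \<Theta> 0 \<omega> \<in> {r. d < \<bar>r\<bar>}}"
    have d2: "1 < d\<^sup>2" using d by (simp add: one_less_power)
    have q': "N.prob {\<omega> \<in> space N. \<Theta> 0 \<omega> \<in> {r. 1 \<le> \<bar>r\<bar> \<and> \<bar>r\<bar> \<le> d}} = 1 - q"
    proof -
      have "N.prob {\<omega> \<in> space N. \<Theta> 0 \<omega> \<in> {r. 1 \<le> \<bar>r\<bar> \<and> \<bar>r\<bar> \<le> d}}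
          = N.prob {\<omega> \<in> space N. \<not> \<Theta> 0 \<omega> \<in> {r. d < \<bar>r\<bar>}}"
        by (rule N.finite_measure_eq_AE) (use ge1 in auto)
      also have "\<dots> = 1 - q" unfolding q_def by (rule N.prob_neg) auto
      finally show ?thesis .
    qed
    have "N.prob ?A + N.prob ?B = N.prob (?A \<union> ?B)"
      by (rule N.finite_measure_Union[symmetric]) auto
    also have "\<dots> \<le> N.prob {\<omega> \<in> space N. d\<^sup>2 \<le> \<bar>Y \<omega> * \<Theta> 0 \<omega>\<bar>}"
    proof (intro N.finite_measure_mono subsetI)
      fix \<omega> assume w: "\<omega> \<in> ?A \<union> ?B"
      have "d * d \<le> \<bar>Y \<omega>\<bar> * \<bar>\<Theta> 0 \<omega>\<bar>" if "\<omega> \<in> ?A"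
        using that d by (intro mult_mono) auto
      moreover have "d\<^sup>2 * 1 \<le> \<bar>Y \<omega>\<bar> * \<bar>\<Theta> 0 \<omega>\<bar>" if "\<omega> \<in> ?B"
        using that by (intro mult_mono) auto
      ultimately show "\<omega> \<in> {\<omega> \<in> space N. d\<^sup>2 \<le> \<bar>Y \<omega> * \<Theta> 0 \<omega>\<bar>}"
        using w by (auto simp: abs_mult power2_eq_square)
    qed auto
    also have "\<dots> \<le> 1 / (d\<^sup>2)\<^sup>2" by (rule prob_product_ge[OF d2])
    finally have "N.prob ?A + N.prob ?B \<le> 1 / (d\<^sup>2)\<^sup>2" .
    moreover have "N.prob ?A = q / d\<^sup>2"
      using Y_tail[OF d] d by (subst Y_\<Theta>_product) (auto simp: q_def powr_minus powr_numeral field_simps)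
    moreover have "N.prob ?B = (1 - q) / (d\<^sup>2)\<^sup>2"
      using Y_tail[OF d2] d
      by (subst Y_\<Theta>_product) (auto simp: q'[simplified] powr_minus powr_numeral field_simps)
    ultimately have "q * (d\<^sup>2 - 1) \<le> 0" using d by (simp add: field_simps power2_eq_square)
    then have "q \<le> 0" using d2 by (simp add: mult_le_0_iff)
    then have "q = 0" by (simp add: q_def measure_le_0_iff)
    then show ?thesis unfolding q_def by (subst (asm) N.prob_eq_0) (auto simp: not_less)
  qed
  have "AE \<omega> in N. \<forall>n. \<bar>\<Theta> 0 \<omega>\<bar> \<le> 1 + inverse (real (Suc n))"
    unfolding AE_all_countable by (auto intro!: le)
  then show ?thesis using ge1
  proof eventually_elim
    case (elim \<omega>)
    have "(\<lambda>n. 1 + inverse (real (Suc n))) \<longlonglongrightarrow> 1 + 0"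
      by (intro tendsto_intros LIMSEQ_inverse_real_of_nat)
    then have "\<bar>\<Theta> 0 \<omega>\<bar> \<le> 1 + 0"
      by (rule LIMSEQ_le_const) (use elim in auto)
    then show ?case using elim by simp
  qed
qed

text \<open>Beyond lag \<open>m\<close> conditioning on \<open>|X\<^sub>0| > x\<close> has no effect on \<open>X\<^sub>t\<close>, and \<open>X\<^sub>t / x\<close> tends to 0.\<close>

lemma AE_\<Theta>_eq_0:
  assumes "int m < \<bar>t\<bar>"
  shows "AE \<omega> in N. \<Theta> t \<omega> = 0"
proof -
  have lim: "((\<lambda>x. expectation (\<lambda>\<omega>. min 1 \<bar>X t \<omega> / x\<bar> * indicator {z. x < \<bar>z\<bar>} (X 0 \<omega>)) / tail x)
    \<longlongrightarrow> N.expectation (\<lambda>\<omega>. min 1 \<bar>Y \<omega> * \<Theta> t \<omega>\<bar>)) at_top"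
  proof (rule conditional_limit[where C = 1 and h = "nat \<bar>t\<bar>"])
    show "continuous_on UNIV (\<lambda>z :: int \<Rightarrow> real. min 1 \<bar>z t\<bar>)" by (intro continuous_intros) auto
    have "t \<in> window (nat \<bar>t\<bar>)" by (auto simp: window_def)
    then show "depends_on_window (nat \<bar>t\<bar>) (\<lambda>z :: int \<Rightarrow> real. min 1 \<bar>z t\<bar>)"
      by (simp add: depends_on_window_def)
  qed simp
  have eq: "expectation (\<lambda>\<omega>. min 1 \<bar>X t \<omega> / x\<bar> * indicator {z. x < \<bar>z\<bar>} (X 0 \<omega>)) / tail x
      = expectation (\<lambda>\<omega>. min 1 \<bar>X t \<omega> / x\<bar>)" for x
  proof -
    have "indep_var borel ((\<lambda>z. min 1 \<bar>z / x\<bar>) \<circ> X t) borel (indicat_real {z. x < \<bar>z\<bar>} \<circ> X 0)"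
      by (rule indep_var_compose[OF indep_coordinates]) (use assms in auto)
    moreover have "integrable M (\<lambda>\<omega>. min 1 \<bar>X t \<omega> / x\<bar>)"
      by (rule integrable_const_bound[where B = 1]) auto
    ultimately have "expectation (\<lambda>\<omega>. min 1 \<bar>X t \<omega> / x\<bar> * indicator {z. x < \<bar>z\<bar>} (X 0 \<omega>))
      = expectation (\<lambda>\<omega>. min 1 \<bar>X t \<omega> / x\<bar>) * tail x"
      using indep_var_lebesgue_integral[of "\<lambda>\<omega>. min 1 \<bar>X t \<omega> / x\<bar>" "\<lambda>\<omega>. indicat_real {z. x < \<bar>z\<bar>} (X 0 \<omega>)"]
        integrable_tail[of x] by (simp add: comp_def expectation_tail)
    then show ?thesis using tail_pos[of x] by simp
  qed
  have "((\<lambda>x. expectation (\<lambda>\<omega>. min 1 \<bar>X t \<omega> / x\<bar>)) \<longlongrightarrow> 0) at_top"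
  proof (rule tendsto_sandwich[where f = "\<lambda>_. 0"])
    show "((\<lambda>x. expectation (\<lambda>\<omega>. \<bar>X t \<omega>\<bar>) / x) \<longlongrightarrow> 0) at_top"
      by (intro tendsto_divide_0[OF tendsto_const] filterlim_at_top_imp_at_infinity filterlim_ident)
    show "\<forall>\<^sub>F x in at_top. expectation (\<lambda>\<omega>. min 1 \<bar>X t \<omega> / x\<bar>) \<le> expectation (\<lambda>\<omega>. \<bar>X t \<omega>\<bar>) / x"
      using eventually_gt_at_top[of 0]
    proof eventually_elim
      case (elim x)
      have int: "integrable M (\<lambda>\<omega>. \<bar>X t \<omega>\<bar> / x)"
        using integrable_marginal[of "\<lambda>z. z" t] integrable_Z by auto
      have "expectation (\<lambda>\<omega>. min 1 \<bar>X t \<omega> / x\<bar>) \<le> expectation (\<lambda>\<omega>. \<bar>X t \<omega>\<bar> / x)"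
        using elim int by (intro integral_mono) (auto intro!: integrable_const_bound[where B = 1])
      then show ?case by simp
    qed
  qed (auto intro!: always_eventually)
  with lim have "N.expectation (\<lambda>\<omega>. min 1 \<bar>Y \<omega> * \<Theta> t \<omega>\<bar>) = 0"
    unfolding eq by (intro tendsto_unique[OF _ lim[unfolded eq]]) auto
  then have "AE \<omega> in N. min 1 \<bar>Y \<omega> * \<Theta> t \<omega>\<bar> = 0"
    by (subst integral_nonneg_eq_0_iff_AE[symmetric]) (auto intro!: N.integrable_const_bound[where B = 1])
  with AE_Y_gt_1 show ?thesis by eventually_elim (auto simp: min_def split: if_splits)
qed

end

section \<open>Quadratic functionals and the time-change formula\<close>

text \<open>The functionals for which expectations grow like \<open>K(x)\<close>: homogeneity makes \<open>F(X) / X\<^sub>0\<^sup>2\<close> depend only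
  on the shape of the path, and the bound makes this ratio bounded.\<close>

definition quadratic_functional :: "nat \<Rightarrow> real \<Rightarrow> ((int \<Rightarrow> real) \<Rightarrow> real) \<Rightarrow> bool" where
  "quadratic_functional h C F \<longleftrightarrow>
     continuous_on UNIV F \<and> (\<forall>c>0. \<forall>z. F (\<lambda>t. c * z t) = c\<^sup>2 * F z) \<and>
     depends_on_window h F \<and> (\<forall>z. \<bar>F z\<bar> \<le> C * (z 0)\<^sup>2)"

definition clamp :: "real \<Rightarrow> real \<Rightarrow> real" where
  "clamp b r = max (- b) (min b r)"

lemma abs_clamp_le: "0 \<le> b \<Longrightarrow> \<bar>clamp b r\<bar> \<le> b"
  and abs_clamp_le_arg: "0 \<le> b \<Longrightarrow> \<bar>clamp b r\<bar> \<le> \<bar>r\<bar>"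
  and abs_diff_clamp_le: "0 \<le> b \<Longrightarrow> \<bar>r - clamp b r\<bar> \<le> \<bar>r\<bar>"
  and clamp_eq: "\<bar>r\<bar> \<le> b \<Longrightarrow> clamp b r = r"
  by (auto simp: clamp_def)

lemma clamp_scale: "0 < c \<Longrightarrow> clamp (c * b) (c * r) = c * clamp b r"
  using min_mult_distrib_left[of c b r] max_mult_distrib_left[of c "- b" "min b r"]
  by (simp add: clamp_def)

text \<open>The cutoff level is homogeneous of degree 1 and continuous. As \<open>n\<close> grows it tends to infinity if
  \<open>z\<^sub>0\<close> and \<open>z\<^sub>p\<close> are nonzero and all \<open>z\<^sub>i\<close>, \<open>i \<in> J\<close>, vanish; otherwise it is eventually 0. Clamping two
  coordinates at this level thus approximates their product times the discontinuous indicator of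
  that event by quadratic functionals that are bounded by \<open>n\<^sup>2 z\<^sub>0\<^sup>2\<close> and by \<open>n\<^sup>2 z\<^sub>p\<^sup>2\<close>.\<close>

definition cutoff :: "nat \<Rightarrow> int \<Rightarrow> int set \<Rightarrow> (int \<Rightarrow> real) \<Rightarrow> real" where
  "cutoff n p J z = real n * max 0 (min \<bar>z 0\<bar> \<bar>z p\<bar> - real n * (\<Sum>i\<in>J. \<bar>z i\<bar>))"

definition clamped_product :: "nat \<Rightarrow> int \<Rightarrow> int set \<Rightarrow> int \<Rightarrow> int \<Rightarrow> (int \<Rightarrow> real) \<Rightarrow> real" where
  "clamped_product n p J s t z = clamp (cutoff n p J z) (z s) * clamp (cutoff n p J z) (z t)"

lemma cutoff_nonneg: "0 \<le> cutoff n p J z"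
  by (simp add: cutoff_def)

lemma cutoff_le: "cutoff n p J z \<le> real n * \<bar>z 0\<bar>" "cutoff n p J z \<le> real n * \<bar>z p\<bar>"
proof -
  have "0 \<le> real n * (\<Sum>i\<in>J. \<bar>z i\<bar>)" by (simp add: sum_nonneg)
  then have "max 0 (min \<bar>z 0\<bar> \<bar>z p\<bar> - real n * (\<Sum>i\<in>J. \<bar>z i\<bar>)) \<le> min \<bar>z 0\<bar> \<bar>z p\<bar>"
    by linarith
  then show "cutoff n p J z \<le> real n * \<bar>z 0\<bar>" "cutoff n p J z \<le> real n * \<bar>z p\<bar>"
    unfolding cutoff_def by (auto intro!: mult_left_mono)
qed

lemma abs_clamped_product_le:
  "\<bar>clamped_product n p J s t z\<bar> \<le> (real n)\<^sup>2 * (z 0)\<^sup>2"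
  "\<bar>clamped_product n p J s t z\<bar> \<le> (real n)\<^sup>2 * (z p)\<^sup>2"
  "\<bar>clamped_product n p J s t z\<bar> \<le> \<bar>z s * z t\<bar>"
proof -
  let ?b = "cutoff n p J z"
  have b: "\<bar>clamped_product n p J s t z\<bar> \<le> ?b * ?b"
    unfolding clamped_product_def abs_mult
    by (intro mult_mono abs_clamp_le cutoff_nonneg) auto
  also have "?b * ?b \<le> (real n * \<bar>z 0\<bar>) * (real n * \<bar>z 0\<bar>)"
    by (intro mult_mono cutoff_le cutoff_nonneg) auto
  finally show "\<bar>clamped_product n p J s t z\<bar> \<le> (real n)\<^sup>2 * (z 0)\<^sup>2"
    by (simp add: power2_eq_square algebra_simps)
  note b
  also have "?b * ?b \<le> (real n * \<bar>z p\<bar>) * (real n * \<bar>z p\<bar>)"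
    by (intro mult_mono cutoff_le cutoff_nonneg) auto
  finally show "\<bar>clamped_product n p J s t z\<bar> \<le> (real n)\<^sup>2 * (z p)\<^sup>2"
    by (simp add: power2_eq_square algebra_simps)
  show "\<bar>clamped_product n p J s t z\<bar> \<le> \<bar>z s * z t\<bar>"
    unfolding clamped_product_def abs_mult
    by (intro mult_mono abs_clamp_le_arg cutoff_nonneg) auto
qed

lemma quadratic_functional_clamped_product:
  assumes "finite J" "J \<subseteq> window h" "0 \<in> window h" "p \<in> window h" "s \<in> window h" "t \<in> window h"
  shows "quadratic_functional h ((real n)\<^sup>2) (clamped_product n p J s t)"
  unfolding quadratic_functional_def
proof (intro conjI allI impI)
  show "continuous_on UNIV (clamped_product n p J s t)"
    unfolding clamped_product_def[abs_def] clamp_def cutoff_def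
    by (intro continuous_intros continuous_on_product_coordinates)
  show "clamped_product n p J s t (\<lambda>t. c * z t) = c\<^sup>2 * clamped_product n p J s t z" if c: "0 < c" for c z
  proof -
    have "min \<bar>c * z 0\<bar> \<bar>c * z p\<bar> = c * min \<bar>z 0\<bar> \<bar>z p\<bar>"
      using c by (auto simp: abs_mult min_def)
    then have "min \<bar>c * z 0\<bar> \<bar>c * z p\<bar> - real n * (\<Sum>i\<in>J. \<bar>c * z i\<bar>)
        = c * (min \<bar>z 0\<bar> \<bar>z p\<bar> - real n * (\<Sum>i\<in>J. \<bar>z i\<bar>))"
      using c by (simp add: abs_mult sum_distrib_left algebra_simps)
    then have "cutoff n p J (\<lambda>t. c * z t) = c * cutoff n p J z"
      using c unfolding cutoff_def by (auto simp: max_def zero_le_mult_iff mult_le_0_iff)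
    then show ?thesis
      using c by (simp add: clamped_product_def clamp_scale power2_eq_square algebra_simps)
  qed
  show "depends_on_window h (clamped_product n p J s t)"
    unfolding depends_on_window_def
  proof (intro allI impI)
    fix z z' :: "int \<Rightarrow> real" assume eq: "\<forall>t\<in>window h. z t = z' t"
    have "cutoff n p J z = cutoff n p J z'"
      unfolding cutoff_def using assms eq
      by (intro arg_cong2[where f = "(*)"] arg_cong2[where f = max] arg_cong2[where f = "(-)"] sum.cong) auto
    then show "clamped_product n p J s t z = clamped_product n p J s t z'"
      using assms eq by (simp add: clamped_product_def)
  qed
qed (rule abs_clamped_product_le)

lemma clamped_product_tendsto:
  assumes "finite J"
  shows "(\<lambda>n. clamped_product n p J s t z)
    \<longlonglongrightarrow> z s * z t * of_bool (z 0 \<noteq> 0 \<and> z p \<noteq> 0 \<and> (\<forall>i\<in>J. z i = 0))"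
proof (rule tendsto_eventually)
  let ?c = "min \<bar>z 0\<bar> \<bar>z p\<bar>"
  show "\<forall>\<^sub>F n in sequentially. clamped_product n p J s t z
      = z s * z t * of_bool (z 0 \<noteq> 0 \<and> z p \<noteq> 0 \<and> (\<forall>i\<in>J. z i = 0))"
  proof (cases "\<forall>i\<in>J. z i = 0")
    case True
    show ?thesis
    proof (cases "?c = 0")
      case c: True
      then have "cutoff n p J z = 0" for n using True by (simp add: cutoff_def)
      moreover have "\<not> (z 0 \<noteq> 0 \<and> z p \<noteq> 0)" using c by (auto simp: min_def split: if_splits)
      ultimately show ?thesis by (auto simp: clamped_product_def clamp_def)
    next
      case False
      then have c: "0 < ?c" "z 0 \<noteq> 0" "z p \<noteq> 0" by (auto simp: min_def split: if_splits)
      obtain k where k: "max \<bar>z s\<bar> \<bar>z t\<bar> < real k * ?c" using reals_Archimedean3[OF c(1)] by blast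
      show ?thesis using eventually_ge_at_top[of k]
      proof eventually_elim
        case (elim n)
        have "real k * ?c \<le> real n * ?c" using elim c(1) by (intro mult_right_mono) auto
        then have "max \<bar>z s\<bar> \<bar>z t\<bar> \<le> real n * ?c" using k by linarith
        moreover have "cutoff n p J z = real n * ?c" using True c(1) by (simp add: cutoff_def)
        ultimately have "max \<bar>z s\<bar> \<bar>z t\<bar> \<le> cutoff n p J z" by simp
        then show ?case using True c by (simp add: clamped_product_def clamp_eq)
      qed
    qed
  next
    case False
    then obtain j where j: "j \<in> J" "z j \<noteq> 0" by blast
    then have pos: "0 < \<bar>z j\<bar>" by simp
    obtain k where k: "?c < real k * \<bar>z j\<bar>" using reals_Archimedean3[OF pos] by blast
    show ?thesis using eventually_ge_at_top[of k]
    proof eventually_elim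
      case (elim n)
      have "?c \<le> real k * \<bar>z j\<bar>" using k by simp
      also have "\<dots> \<le> real n * \<bar>z j\<bar>" using elim by (intro mult_right_mono) auto
      also have "\<dots> \<le> real n * (\<Sum>i\<in>J. \<bar>z i\<bar>)"
        using assms j by (intro mult_left_mono member_le_sum) auto
      finally have "cutoff n p J z = 0" by (simp add: cutoff_def)
      then show ?case using False by (simp add: clamped_product_def clamp_def)
    qed
  qed
qed

context tail_process
begin

lemma functional_measurable:
  assumes "quadratic_functional h C F"
  shows "F \<in> borel_measurable (PiM UNIV (\<lambda>_. borel))"
    "(\<lambda>\<omega>. F (\<lambda>t. X (t + k) \<omega>)) \<in> borel_measurable M"
    "(\<lambda>\<omega>. F (\<lambda>t. \<Theta> t \<omega>)) \<in> borel_measurable N"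
proof -
  show F: "F \<in> borel_measurable (PiM UNIV (\<lambda>_. borel))"
    using assms by (intro continuous_on_borel_PiM) (simp add: quadratic_functional_def)
  show "(\<lambda>\<omega>. F (\<lambda>t. X (t + k) \<omega>)) \<in> borel_measurable M"
    using measurable_comp[OF path_measurable F] by (simp add: comp_def)
  show "(\<lambda>\<omega>. F (\<lambda>t. \<Theta> t \<omega>)) \<in> borel_measurable N"
    using measurable_comp[OF \<Theta>_path_measurable F] by (simp add: comp_def)
qed

text \<open>The ratio \<open>F(X) / X\<^sub>0\<^sup>2\<close> is homogeneous of degree 0, so the Pareto factor \<open>Y\<close> drops out of the
  limit, and \<open>\<Theta>\<^sub>0\<^sup>2 = 1\<close> removes the denominator.\<close>

lemma functional_limit_ratio:
  assumes F: "quadratic_functional h C F"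
  shows "((\<lambda>u. expectation (\<lambda>\<omega>. F (\<lambda>t. X t \<omega>) / (X 0 \<omega>)\<^sup>2 * indicator {z. u < \<bar>z\<bar>} (X 0 \<omega>)) / tail u)
    \<longlongrightarrow> N.expectation (\<lambda>\<omega>. F (\<lambda>t. \<Theta> t \<omega>))) at_top"
proof -
  \<comment> \<open>Agrees with the ratio where the rescaled path has \<open>|z\<^sub>0| \<ge> 1\<close>, but is continuous and bounded everywhere.\<close>
  define g where "g z = F z / max 1 ((z 0)\<^sup>2)" for z
  have hom: "F (\<lambda>t. c * z t) = c\<^sup>2 * F z" if "0 < c" for c z
    using F that by (simp add: quadratic_functional_def)
  have bound: "\<bar>F z\<bar> \<le> C * (z 0)\<^sup>2" for z
    using F by (simp add: quadratic_functional_def)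
  have C: "0 \<le> C" using order_trans[OF abs_ge_zero bound[of "\<lambda>_. 1"]] by simp
  have lim: "((\<lambda>x. expectation (\<lambda>\<omega>. g (\<lambda>t. X t \<omega> / x) * indicator {z. x < \<bar>z\<bar>} (X 0 \<omega>)) / tail x)
    \<longlongrightarrow> N.expectation (\<lambda>\<omega>. g (\<lambda>t. Y \<omega> * \<Theta> t \<omega>))) at_top"
  proof (rule conditional_limit)
    show "continuous_on UNIV g" unfolding g_def using F
      by (intro continuous_intros continuous_on_product_coordinates) (auto simp: quadratic_functional_def max_def)
    show "\<bar>g z\<bar> \<le> C" for z
    proof -
      have "C * (z 0)\<^sup>2 \<le> C * max 1 ((z 0)\<^sup>2)" using C by (intro mult_left_mono) auto
      then have "\<bar>F z\<bar> \<le> C * max 1 ((z 0)\<^sup>2)" using bound[of z] by linarith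
      moreover have "0 < max 1 ((z 0)\<^sup>2)" by (simp add: less_max_iff_disj)
      ultimately have "\<bar>F z\<bar> / max 1 ((z 0)\<^sup>2) \<le> C" by (simp only: pos_divide_le_eq)
      then show ?thesis by (simp add: g_def)
    qed
    have "0 \<in> window h" by (simp add: window_def)
    moreover have "depends_on_window h F" using F by (simp add: quadratic_functional_def)
    ultimately show "depends_on_window h g"
      unfolding g_def depends_on_window_def by (metis (no_types))
  qed
  have "N.expectation (\<lambda>\<omega>. g (\<lambda>t. Y \<omega> * \<Theta> t \<omega>)) = N.expectation (\<lambda>\<omega>. F (\<lambda>t. \<Theta> t \<omega>))"
  proof (rule integral_cong_AE)
    have "(\<lambda>\<omega> t. Y \<omega> * \<Theta> t \<omega>) \<in> measurable N (PiM UNIV (\<lambda>_. borel))"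
      by (rule measurable_PiM_single') auto
    moreover have "g \<in> borel_measurable (PiM UNIV (\<lambda>_. borel))"
      using functional_measurable(1)[OF F] unfolding g_def by measurable
    ultimately show "(\<lambda>\<omega>. g (\<lambda>t. Y \<omega> * \<Theta> t \<omega>)) \<in> borel_measurable N"
      by (rule measurable_compose)
    show "AE \<omega> in N. g (\<lambda>t. Y \<omega> * \<Theta> t \<omega>) = F (\<lambda>t. \<Theta> t \<omega>)"
      using AE_\<Theta>_0 AE_Y_gt_1
    proof eventually_elim
      case (elim \<omega>)
      have "(\<Theta> 0 \<omega>)\<^sup>2 = 1" using elim(1) by (metis power2_abs one_power2)
      then have "max 1 ((Y \<omega> * \<Theta> 0 \<omega>)\<^sup>2) = (Y \<omega>)\<^sup>2"
        using elim(2) by (simp add: power_mult_distrib one_le_power max_def)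
      then show ?case using elim(2) by (simp add: g_def hom)
    qed
  qed (rule functional_measurable(3)[OF F])
  moreover have "\<forall>\<^sub>F x in at_top.
      expectation (\<lambda>\<omega>. g (\<lambda>t. X t \<omega> / x) * indicator {z. x < \<bar>z\<bar>} (X 0 \<omega>)) / tail x
    = expectation (\<lambda>\<omega>. F (\<lambda>t. X t \<omega>) / (X 0 \<omega>)\<^sup>2 * indicator {z. x < \<bar>z\<bar>} (X 0 \<omega>)) / tail x"
    using eventually_gt_at_top[of 0]
  proof eventually_elim
    case (elim x)
    have "g (\<lambda>t. z t / x) = F z / (z 0)\<^sup>2" if "x < \<bar>z 0\<bar>" for z
    proof -
      have "1 \<le> \<bar>z 0 / x\<bar>" using that elim by (simp add: field_simps)
      then have "1 \<le> (z 0 / x)\<^sup>2" by (metis one_le_power power2_abs)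
      then show ?thesis using hom[of "1/x" z] elim by (simp add: g_def power_divide max_def)
    qed
    then show ?case
      by (intro arg_cong2[where f = "(/)"] Bochner_Integration.integral_cong) (auto simp: indicator_def)
  qed
  ultimately show ?thesis using Lim_transform_eventually[OF lim] by simp
qed

text \<open>The conditional mean of \<open>r = F(X) / X\<^sub>0\<^sup>2\<close> given \<open>|X\<^sub>0| > u\<close> tends to \<open>\<rho> = E[F(\<Theta>)]\<close> as \<open>u \<rightarrow> \<infinity>\<close>. Write
  \<open>min (X\<^sub>0\<^sup>2) (x\<^sup>2)\<close> as a sum of indicators of \<open>|X\<^sub>0| > \<surd>i\<close>, up to an error of at most 1. For the centred
  ratio \<open>d = r - \<rho>\<close> all but finitely many summands are at most \<open>e T(\<surd>i)\<close>, and these add up to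
  \<open>e K(x)\<close> plus negligible terms, while the exceptional ones stay bounded and \<open>K(x) \<rightarrow> \<infinity>\<close>.\<close>

lemma functional_limit:
  assumes F: "quadratic_functional h C F"
  shows "((\<lambda>x. expectation (\<lambda>\<omega>. F (\<lambda>t. X t \<omega>) * indicator {z. \<bar>z\<bar> \<le> x} (X 0 \<omega>)) / trunc_moment x)
    \<longlongrightarrow> N.expectation (\<lambda>\<omega>. F (\<lambda>t. \<Theta> t \<omega>))) at_top"
proof -
  let ?I = "\<lambda>u z. indicat_real {z. u < \<bar>z\<bar>} z"
  define \<rho> where "\<rho> = N.expectation (\<lambda>\<omega>. F (\<lambda>t. \<Theta> t \<omega>))"
  define r where "r \<omega> = F (\<lambda>t. X t \<omega>) / (X 0 \<omega>)\<^sup>2" for \<omega>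
  define d where "d \<omega> = r \<omega> - \<rho>" for \<omega>
  define D where "D u = expectation (\<lambda>\<omega>. d \<omega> * ?I u (X 0 \<omega>))" for u
  have bound: "\<bar>F z\<bar> \<le> C * (z 0)\<^sup>2" for z
    using F by (simp add: quadratic_functional_def)
  have C: "0 \<le> C" using order_trans[OF abs_ge_zero bound[of "\<lambda>_. 1"]] by simp
  define B where "B = C + \<bar>\<rho>\<bar>"
  have B: "0 \<le> B" using C by (simp add: B_def)
  have [measurable]: "r \<in> borel_measurable M" "d \<in> borel_measurable M"
    using functional_measurable(2)[OF F, of 0] by (auto simp: r_def[abs_def] d_def[abs_def])
  have r: "\<bar>r \<omega>\<bar> \<le> C" for \<omega>
    using bound[of "\<lambda>t. X t \<omega>"] C by (cases "X 0 \<omega> = 0") (auto simp: r_def divide_le_eq)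
  have d: "\<bar>d \<omega>\<bar> \<le> B" for \<omega> using r[of \<omega>] by (simp add: d_def B_def)
  have int: "integrable M (\<lambda>\<omega>. d \<omega> * f \<omega>)"
    if "f \<in> borel_measurable M" "\<And>\<omega>. \<bar>f \<omega>\<bar> \<le> c" for f :: "'a \<Rightarrow> real" and c
    using that(1) by (intro integrable_const_bound[where B = "B * c"])
      (auto simp: abs_mult intro!: mult_mono d that(2) B)
  have intr: "integrable M (\<lambda>\<omega>. r \<omega> * ?I u (X 0 \<omega>))" for u
    using r C by (intro integrable_const_bound[where B = C]) (auto simp: indicator_def)
  have "((\<lambda>u. D u / tail u) \<longlongrightarrow> \<rho> - \<rho>) at_top"
  proof -
    have "D u / tail u = expectation (\<lambda>\<omega>. r \<omega> * ?I u (X 0 \<omega>)) / tail u - \<rho>" for u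
    proof -
      have "D u = expectation (\<lambda>\<omega>. r \<omega> * ?I u (X 0 \<omega>)) - \<rho> * tail u"
        unfolding D_def d_def left_diff_distrib using intr[of u] integrable_tail[of u]
        by (simp add: expectation_tail)
      then show ?thesis using tail_pos[of u] by (simp add: diff_divide_distrib)
    qed
    then show ?thesis
      using tendsto_diff[OF functional_limit_ratio[OF F] tendsto_const[of \<rho>]] unfolding r_def \<rho>_def by simp
  qed
  then have D_lim: "((\<lambda>u. D u / tail u) \<longlongrightarrow> 0) at_top" by simp
  have D_bound: "\<bar>D u\<bar> \<le> B" for u
  proof -
    have "\<bar>D u\<bar> \<le> expectation (\<lambda>\<omega>. \<bar>d \<omega> * ?I u (X 0 \<omega>)\<bar>)"
      unfolding D_def by (rule integral_abs_bound)
    also have "\<dots> \<le> expectation (\<lambda>\<omega>. B)"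
      using d B by (intro integral_mono integrable_abs int[of _ 1]) (auto simp: indicator_def)
    finally show ?thesis by (simp add: prob_space)
  qed
  let ?G = "\<lambda>x. expectation (\<lambda>\<omega>. d \<omega> * (trunc x (X 0 \<omega>))\<^sup>2)"
  have G: "expectation (\<lambda>\<omega>. F (\<lambda>t. X t \<omega>) * indicator {z. \<bar>z\<bar> \<le> x} (X 0 \<omega>)) = ?G x + \<rho> * trunc_moment x" for x
  proof -
    have "F (\<lambda>t. X t \<omega>) * indicator {z. \<bar>z\<bar> \<le> x} (X 0 \<omega>)
        = d \<omega> * (trunc x (X 0 \<omega>))\<^sup>2 + \<rho> * (trunc x (X 0 \<omega>))\<^sup>2" for \<omega>
      using bound[of "\<lambda>t. X t \<omega>"] by (cases "X 0 \<omega> = 0") (auto simp: d_def r_def trunc_def field_simps)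
    moreover have "integrable M (\<lambda>\<omega>. d \<omega> * (trunc x (X 0 \<omega>))\<^sup>2)"
      by (rule int[of _ "\<bar>x\<bar>\<^sup>2"]) (auto simp: trunc_def intro!: abs_le_square_iff[THEN iffD1])
    ultimately show ?thesis
      using integrable_trunc_power[of x 2] by (simp add: trunc_moment_def)
  qed
  have G_bound: "\<exists>A. \<forall>x\<ge>0. \<bar>?G x\<bar> \<le> A + e * trunc_moment x + (e + B) * (x\<^sup>2 * tail x)"
    if e: "0 < e" for e
  proof -
    have "\<forall>\<^sub>F u in at_top. \<bar>D u / tail u\<bar> < e"
      using tendstoD[OF D_lim e] by (simp add: dist_real_def)
    then obtain u0 where u0: "\<And>u. u0 \<le> u \<Longrightarrow> \<bar>D u / tail u\<bar> < e"
      by (auto simp: eventually_at_top_linorder)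
    define k where "k = nat \<lceil>u0\<^sup>2\<rceil>"
    have D_sqrt: "\<bar>D (sqrt (real i))\<bar> \<le> e * tail (sqrt (real i)) + B * of_bool (i < k)" for i
    proof (cases "i < k")
      case True
      then show ?thesis using D_bound[of "sqrt (real i)"] e
        by (simp add: add_increasing)
    next
      case False
      then have "u0\<^sup>2 \<le> real i" by (simp add: k_def) linarith
      then have "u0 \<le> sqrt (real i)" by (rule real_le_rsqrt)
      from u0[OF this] show ?thesis using tail_pos[of "sqrt (real i)"] False
        by (simp add: pos_divide_less_eq)
    qed
    have "\<bar>?G x\<bar> \<le> (B + B * k + e) + e * trunc_moment x + (e + B) * (x\<^sup>2 * tail x)" if x: "0 \<le> x" for x
    proof -
      define n where "n = nat \<lceil>x\<^sup>2\<rceil>"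
      define S where "S z = (\<Sum>i<n. ?I (sqrt (real i)) z)" for z
      define q where "q z = S z - min (z\<^sup>2) (x\<^sup>2)" for z
      have S_eq: "S z = (\<Sum>i<nat \<lceil>x\<^sup>2\<rceil>. indicat_real {i. real i < z\<^sup>2} i)" for z
        unfolding S_def n_def
      proof (intro sum.cong refl)
        fix i
        have "sqrt (real i) < \<bar>z\<bar> \<longleftrightarrow> real i < z\<^sup>2"
          using real_sqrt_less_iff[of "real i" "z\<^sup>2"] by simp
        then show "?I (sqrt (real i)) z = indicat_real {i. real i < z\<^sup>2} i" by (simp add: indicator_def)
      qed
      have q: "0 \<le> q z" "q z \<le> 1" for z
        using layer_sum[of "z\<^sup>2" "x\<^sup>2"] by (simp_all add: q_def S_eq)
      have [measurable]: "S \<in> borel_measurable borel" "q \<in> borel_measurable borel"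
        unfolding S_def[abs_def] q_def[abs_def] by measurable
      have sq: "(trunc x z)\<^sup>2 = min (z\<^sup>2) (x\<^sup>2) - x\<^sup>2 * ?I x z" for z
        using x abs_le_square_iff[of z x] by (auto simp: trunc_def indicator_def min_def)
      define E where "E u \<omega> = d \<omega> * ?I u (X 0 \<omega>)" for u \<omega>
      have i1: "integrable M (E u)" for u
        unfolding E_def by (rule int[of _ 1]) auto
      have i2: "integrable M (\<lambda>\<omega>. d \<omega> * q (X 0 \<omega>))"
        by (rule int[of _ 1]) (use q in \<open>auto simp: abs_le_iff intro: order_trans[of _ 0]\<close>)
      have "d \<omega> * (trunc x (X 0 \<omega>))\<^sup>2
          = (\<Sum>i<n. E (sqrt (real i)) \<omega>) - d \<omega> * q (X 0 \<omega>) - x\<^sup>2 * E x \<omega>" for \<omega>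
        unfolding E_def sq sum_distrib_left[symmetric] S_def[symmetric] q_def by (simp add: algebra_simps)
      moreover have "D u = expectation (E u)" for u by (simp add: D_def E_def[abs_def])
      ultimately have "?G x = (\<Sum>i<n. D (sqrt (real i))) - expectation (\<lambda>\<omega>. d \<omega> * q (X 0 \<omega>)) - x\<^sup>2 * D x"
        using i1 i2 by simp
      moreover have "\<bar>expectation (\<lambda>\<omega>. d \<omega> * q (X 0 \<omega>))\<bar> \<le> B"
      proof -
        have "\<bar>expectation (\<lambda>\<omega>. d \<omega> * q (X 0 \<omega>))\<bar> \<le> expectation (\<lambda>\<omega>. \<bar>d \<omega> * q (X 0 \<omega>)\<bar>)"
          by (rule integral_abs_bound)
        also have "\<dots> \<le> expectation (\<lambda>\<omega>. B)"
        proof (intro integral_mono integrable_abs i2)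
          have "\<bar>d \<omega>\<bar> * \<bar>q (X 0 \<omega>)\<bar> \<le> B * 1" for \<omega>
            using d q B by (intro mult_mono) auto
          then show "\<bar>d \<omega> * q (X 0 \<omega>)\<bar> \<le> B" for \<omega> by (simp add: abs_mult)
        qed simp
        finally show ?thesis by (simp add: prob_space)
      qed
      moreover have "\<bar>x\<^sup>2 * D x\<bar> \<le> B * (x\<^sup>2 * tail x)"
      proof -
        have "\<bar>D x\<bar> \<le> expectation (\<lambda>\<omega>. \<bar>d \<omega> * ?I x (X 0 \<omega>)\<bar>)"
          unfolding D_def by (rule integral_abs_bound)
        also have "\<dots> \<le> expectation (\<lambda>\<omega>. B * ?I x (X 0 \<omega>))"
          using i1[of x] d integrable_tail unfolding E_def
          by (intro integral_mono integrable_abs) (auto simp: indicator_def)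
        finally have "\<bar>D x\<bar> \<le> B * tail x" by (simp add: expectation_tail)
        then have "x\<^sup>2 * \<bar>D x\<bar> \<le> x\<^sup>2 * (B * tail x)" by (rule mult_left_mono) simp
        then show ?thesis by (simp add: abs_mult algebra_simps)
      qed
      moreover have "\<bar>\<Sum>i<n. D (sqrt (real i))\<bar> \<le> e * (trunc_moment x + x\<^sup>2 * tail x + 1) + B * k"
      proof -
        have "\<bar>\<Sum>i<n. D (sqrt (real i))\<bar> \<le> (\<Sum>i<n. e * tail (sqrt (real i)) + B * of_bool (i < k))"
          by (rule order_trans[OF sum_abs sum_mono[OF D_sqrt]])
        also have "\<dots> = e * (\<Sum>i<n. tail (sqrt (real i))) + B * (\<Sum>i<n. of_bool (i < k))"
          by (simp add: sum.distrib sum_distrib_left)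
        also have "(\<Sum>i<n. of_bool (i < k)) \<le> real k"
        proof -
          have "(\<Sum>i<n. of_bool (i < k)) = (\<Sum>i\<in>{..<n} \<inter> {..<k}. 1 :: real)"
            unfolding of_bool_def lessThan_iff[symmetric] by (rule sum.inter_restrict[symmetric]) simp
          also have "\<dots> \<le> real k" using card_mono[of "{..<k}" "{..<n} \<inter> {..<k}"] by simp
          finally show ?thesis .
        qed
        also have "(\<Sum>i<n. tail (sqrt (real i))) = expectation (\<lambda>\<omega>. S (X 0 \<omega>))"
          unfolding S_def using integrable_tail by (simp add: expectation_tail)
        also have "\<dots> \<le> expectation (\<lambda>\<omega>. (trunc x (X 0 \<omega>))\<^sup>2 + x\<^sup>2 * ?I x (X 0 \<omega>) + 1)"
        proof (rule integral_mono)
          show "integrable M (\<lambda>\<omega>. S (X 0 \<omega>))" unfolding S_def using integrable_tail by simp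
          show "S (X 0 \<omega>) \<le> (trunc x (X 0 \<omega>))\<^sup>2 + x\<^sup>2 * ?I x (X 0 \<omega>) + 1" for \<omega>
            using q(2)[of "X 0 \<omega>"] unfolding sq q_def by simp
        qed (use integrable_trunc_power[of x 2] integrable_tail[of x] in simp)
        also have "\<dots> = trunc_moment x + x\<^sup>2 * tail x + 1"
          using integrable_trunc_power[of x 2] integrable_tail[of x]
          by (simp add: trunc_moment_def expectation_tail prob_space)
        finally show ?thesis using e B by (simp add: mult_left_mono)
      qed
      ultimately show ?thesis by (simp add: algebra_simps)
    qed
    then show ?thesis by blast
  qed
  have "((\<lambda>x. ?G x / trunc_moment x) \<longlongrightarrow> 0) at_top"
  proof (rule tendstoI)
    fix e :: real assume "0 < e"
    then have e2: "0 < e/2" by simp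
    obtain A where A: "\<And>x. 0 \<le> x \<Longrightarrow> \<bar>?G x\<bar> \<le> A + e/2 * trunc_moment x + (e/2 + B) * (x\<^sup>2 * tail x)"
      using G_bound[OF e2] by blast
    have "((\<lambda>x. A / trunc_moment x + e/2 + (e/2 + B) * (x\<^sup>2 * tail x / trunc_moment x))
        \<longlongrightarrow> 0 + e/2 + (e/2 + B) * 0) at_top"
      by (intro tendsto_intros square_tail_negligible tendsto_divide_0[OF tendsto_const]
          filterlim_at_top_imp_at_infinity trunc_moment_at_top)
    then have "\<forall>\<^sub>F x in at_top. A / trunc_moment x + e/2 + (e/2 + B) * (x\<^sup>2 * tail x / trunc_moment x) < e"
      by (rule order_tendstoD) (use \<open>0 < e\<close> in simp)
    then show "\<forall>\<^sub>F x in at_top. dist (?G x / trunc_moment x) 0 < e"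
      using trunc_moment_pos eventually_ge_at_top[of 0]
    proof eventually_elim
      case (elim x)
      have "\<bar>?G x\<bar> / trunc_moment x \<le> (A + e/2 * trunc_moment x + (e/2 + B) * (x\<^sup>2 * tail x)) / trunc_moment x"
        using A[OF elim(3)] elim(2) by (intro divide_right_mono) auto
      also have "\<dots> < e" using elim by (simp add: add_divide_distrib)
      finally show ?case using elim by (simp add: dist_real_def)
    qed
  qed
  then have "((\<lambda>x. ?G x / trunc_moment x + \<rho>) \<longlongrightarrow> 0 + \<rho>) at_top" by (intro tendsto_intros)
  moreover have "\<forall>\<^sub>F x in at_top. ?G x / trunc_moment x + \<rho>
     = expectation (\<lambda>\<omega>. F (\<lambda>t. X t \<omega>) * indicator {z. \<bar>z\<bar> \<le> x} (X 0 \<omega>)) / trunc_moment x"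
    using trunc_moment_pos by eventually_elim (simp add: G add_divide_distrib)
  ultimately show ?thesis unfolding \<rho>_def by (simp add: Lim_transform_eventually)
qed


text \<open>Truncating at \<open>|X\<^sub>0| \<le> x\<close> or at \<open>|X\<^sub>p| \<le> x\<close> makes a difference of order \<open>x\<^sup>2 T(x)\<close> only, because \<open>F\<close> is
  dominated by both squares. By stationarity the second truncation corresponds to the shifted
  functional.\<close>

lemma time_change:
  assumes F: "quadratic_functional h C F" and bound_p: "\<And>z. \<bar>F z\<bar> \<le> C * (z p)\<^sup>2"
  shows "N.expectation (\<lambda>\<omega>. F (\<lambda>t. \<Theta> t \<omega>)) = N.expectation (\<lambda>\<omega>. F (\<lambda>t. \<Theta> (t - p) \<omega>))"
proof -
  define G where "G z = F (\<lambda>t. z (t - p))" for z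
  let ?I = "\<lambda>x z. indicat_real {z. \<bar>z\<bar> \<le> x} z"
  let ?J = "\<lambda>x z. indicat_real {z. x < \<bar>z\<bar>} z"
  have bound: "\<bar>F z\<bar> \<le> C * (z 0)\<^sup>2" for z
    using F by (simp add: quadratic_functional_def)
  have C: "0 \<le> C" using order_trans[OF abs_ge_zero bound[of "\<lambda>_. 1"]] by simp
  have G: "quadratic_functional (h + nat \<bar>p\<bar>) C G"
    unfolding quadratic_functional_def
  proof (intro conjI allI impI)
    have "continuous_on UNIV F" using F by (simp add: quadratic_functional_def)
    moreover have "continuous_on UNIV (\<lambda>z :: int \<Rightarrow> real. \<lambda>t. z (t - p))"
      by (intro continuous_on_coordinatewise_then_product continuous_on_product_coordinates)
    ultimately show "continuous_on UNIV G"
      unfolding G_def[abs_def] by (rule continuous_on_compose2) simp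
    show "depends_on_window (h + nat \<bar>p\<bar>) G"
      unfolding depends_on_window_def
    proof (intro allI impI)
      fix z z' :: "int \<Rightarrow> real" assume eq: "\<forall>t\<in>window (h + nat \<bar>p\<bar>). z t = z' t"
      have "t - p \<in> window (h + nat \<bar>p\<bar>)" if "t \<in> window h" for t
        using that by (auto simp: window_def)
      then have "\<forall>t\<in>window h. z (t - p) = z' (t - p)" using eq by blast
      then show "G z = G z'" using F unfolding G_def quadratic_functional_def depends_on_window_def by simp
    qed
    show "G (\<lambda>t. c * z t) = c\<^sup>2 * G z" if "0 < c" for c z
      using F that by (simp add: quadratic_functional_def G_def)
    show "\<bar>G z\<bar> \<le> C * (z 0)\<^sup>2" for z using bound_p[of "\<lambda>t. z (t - p)"] by (simp add: G_def)
  qed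
  have [measurable]: "(\<lambda>\<omega>. F (\<lambda>t. X t \<omega>)) \<in> borel_measurable M"
    using functional_measurable(2)[OF F, of 0] by simp
  let ?E = "\<lambda>s x. expectation (\<lambda>\<omega>. F (\<lambda>t. X t \<omega>) * ?I x (X s \<omega>))"
  have shift: "expectation (\<lambda>\<omega>. G (\<lambda>t. X t \<omega>) * ?I x (X 0 \<omega>)) = ?E p x" for x
  proof -
    have [measurable]: "G \<in> borel_measurable (PiM UNIV (\<lambda>_. borel))" by (rule functional_measurable(1)[OF G])
    have "(\<lambda>z. G z * ?I x (z 0)) \<in> borel_measurable (PiM UNIV (\<lambda>_. borel))" by measurable
    from expectation_shift[OF this, of p] show ?thesis by (simp add: G_def)
  qed
  have int: "integrable M (\<lambda>\<omega>. F (\<lambda>t. X t \<omega>) * ?I x (X s \<omega>))"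
    if "0 \<le> x" "\<And>z. \<bar>F z\<bar> \<le> C * (z s)\<^sup>2" for x s
  proof (rule integrable_const_bound[where B = "C * x\<^sup>2"])
    have "\<bar>F z * ?I x (z s)\<bar> \<le> C * x\<^sup>2" for z
    proof (cases "\<bar>z s\<bar> \<le> x")
      case True
      then have "(z s)\<^sup>2 \<le> x\<^sup>2" using that(1) by (simp add: abs_le_square_iff[symmetric])
      then have "C * (z s)\<^sup>2 \<le> C * x\<^sup>2" using C by (rule mult_left_mono)
      then show ?thesis using that(2)[of z] True by simp
    qed (use C in simp)
    then show "AE \<omega> in M. norm (F (\<lambda>t. X t \<omega>) * ?I x (X s \<omega>)) \<le> C * x\<^sup>2"
      by (intro AE_I2) (simp only: real_norm_def)
  qed simp
  have diff: "\<bar>?E p x - ?E 0 x\<bar> \<le> 2 * C * (x\<^sup>2 * tail x)" if x: "0 \<le> x" for x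
  proof -
    have pw: "\<bar>F z * ?I x (z p) - F z * ?I x (z 0)\<bar> \<le> C * x\<^sup>2 * (?J x (z 0) + ?J x (z p))" for z
    proof -
      have sq: "\<bar>r\<bar> \<le> x \<Longrightarrow> C * r\<^sup>2 \<le> C * x\<^sup>2" for r
        using x C by (intro mult_left_mono) (auto simp: abs_le_square_iff[symmetric])
      show ?thesis
        using sq[of "z 0"] sq[of "z p"] bound[of z] bound_p[of z] C
        by (cases "\<bar>z 0\<bar> \<le> x"; cases "\<bar>z p\<bar> \<le> x") (auto simp: not_le intro: order_trans)
    qed
    have "\<bar>?E p x - ?E 0 x\<bar> = \<bar>expectation (\<lambda>\<omega>. F (\<lambda>t. X t \<omega>) * ?I x (X p \<omega>) - F (\<lambda>t. X t \<omega>) * ?I x (X 0 \<omega>))\<bar>"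
      using int[OF x bound] int[OF x bound_p] by simp
    also have "\<dots> \<le> expectation (\<lambda>\<omega>. \<bar>F (\<lambda>t. X t \<omega>) * ?I x (X p \<omega>) - F (\<lambda>t. X t \<omega>) * ?I x (X 0 \<omega>)\<bar>)"
      by (rule integral_abs_bound)
    also have "\<dots> \<le> expectation (\<lambda>\<omega>. C * x\<^sup>2 * (?J x (X 0 \<omega>) + ?J x (X p \<omega>)))"
      using int[OF x bound] int[OF x bound_p] integrable_tail' pw by (intro integral_mono) auto
    also have "\<dots> = 2 * C * (x\<^sup>2 * tail x)"
      using integrable_tail'[of x 0] integrable_tail'[of x p] by (simp add: expectation_tail')
    finally show ?thesis .
  qed
  have "((\<lambda>x. (?E p x - ?E 0 x) / trunc_moment x) \<longlongrightarrow> 0) at_top"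
  proof (rule tendsto_rabs_zero_cancel, rule tendsto_sandwich[where f = "\<lambda>_. 0"])
    show "((\<lambda>x. 2 * C * (x\<^sup>2 * tail x / trunc_moment x)) \<longlongrightarrow> 0) at_top"
      using tendsto_mult[OF tendsto_const square_tail_negligible, of "2 * C"] by simp
    show "\<forall>\<^sub>F x in at_top. \<bar>(?E p x - ?E 0 x) / trunc_moment x\<bar> \<le> 2 * C * (x\<^sup>2 * tail x / trunc_moment x)"
      using trunc_moment_pos eventually_ge_at_top[of 0]
    proof eventually_elim
      case (elim x)
      then show ?case using divide_right_mono[OF diff[OF elim(2)], of "trunc_moment x"] by simp
    qed
  qed auto
  moreover have "((\<lambda>x. (?E p x - ?E 0 x) / trunc_moment x)
      \<longlongrightarrow> N.expectation (\<lambda>\<omega>. G (\<lambda>t. \<Theta> t \<omega>)) - N.expectation (\<lambda>\<omega>. F (\<lambda>t. \<Theta> t \<omega>))) at_top"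
    using tendsto_diff[OF functional_limit[OF G] functional_limit[OF F]]
    unfolding shift by (simp add: diff_divide_distrib)
  ultimately have "N.expectation (\<lambda>\<omega>. G (\<lambda>t. \<Theta> t \<omega>)) - N.expectation (\<lambda>\<omega>. F (\<lambda>t. \<Theta> t \<omega>)) = 0"
    by (intro tendsto_unique[OF trivial_limit_at_top_linorder])
  then show ?thesis by (simp add: G_def)
qed

lemma window_exists:
  assumes "finite J"
  obtains h where "J \<subseteq> window h"
proof
  show "J \<subseteq> window (nat (\<Sum>i\<in>J. \<bar>i\<bar>))"
  proof
    fix j assume "j \<in> J"
    then have "\<bar>j\<bar> \<le> (\<Sum>i\<in>J. \<bar>i\<bar>)" using assms by (intro member_le_sum) auto
    then show "j \<in> window (nat (\<Sum>i\<in>J. \<bar>i\<bar>))" by (auto simp: window_def)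
  qed
qed

lemma clamped_product_functional:
  assumes "finite J"
  obtains h where "\<And>n. quadratic_functional h ((real n)\<^sup>2) (clamped_product n p J s t)"
proof -
  obtain h where h: "J \<union> {0, p, s, t} \<subseteq> window h" using window_exists[of "J \<union> {0, p, s, t}"] assms by auto
  show thesis by (rule that, rule quadratic_functional_clamped_product) (use assms h in auto)
qed

text \<open>The functional \<open>min (z\<^sub>t\<^sup>2) (n\<^sup>2 z\<^sub>0\<^sup>2)\<close> has limit at most 1, since on \<open>|X\<^sub>0| \<le> x\<close> it is at most
  \<open>X\<^sub>t\<^sup>2\<close> if \<open>|X\<^sub>t| \<le> x\<close> and at most \<open>n\<^sup>2 x\<^sup>2\<close> otherwise. This gives \<open>E[\<Theta>\<^sub>t\<^sup>2] \<le> 1\<close>.\<close>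

lemma integrable_\<Theta>_square: "integrable N (\<lambda>\<omega>. (\<Theta> t \<omega>)\<^sup>2)"
proof (rule integrable_of_bounded_increasing)
  let ?P = "\<lambda>n. clamped_product n 0 {} t t"
  let ?f = "\<lambda>n \<omega>. (min (real n) \<bar>\<Theta> t \<omega>\<bar>)\<^sup>2"
  show int: "integrable N (?f n)" for n
    by (rule N.integrable_const_bound[where B = "(real n)\<^sup>2"]) (auto intro!: power_mono)
  show "AE \<omega> in N. incseq (\<lambda>n. ?f n \<omega>)"
    by (intro AE_I2 incseq_SucI power_mono) auto
  show "AE \<omega> in N. (\<lambda>n. ?f n \<omega>) \<longlonglongrightarrow> (\<Theta> t \<omega>)\<^sup>2"
  proof (intro AE_I2 tendsto_eventually)
    fix \<omega>
    obtain k where k: "\<bar>\<Theta> t \<omega>\<bar> \<le> real k" using real_arch_simple by blast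
    show "\<forall>\<^sub>F n in sequentially. ?f n \<omega> = (\<Theta> t \<omega>)\<^sup>2"
      using eventually_ge_at_top[of k]
    proof eventually_elim
      case (elim n)
      then have "\<bar>\<Theta> t \<omega>\<bar> \<le> real n" using k by (meson of_nat_mono order_trans)
      then show ?case by (simp add: min_absorb2)
    qed
  qed
  show "N.expectation (?f n) \<le> 1" for n
  proof -
    obtain h where F: "quadratic_functional h ((real n)\<^sup>2) (?P n)"
      using clamped_product_functional[of "{}" 0 t t] by auto
    let ?J = "\<lambda>x z. indicat_real {z. x < \<bar>z\<bar>} z"
    have "N.expectation (?f n) = N.expectation (\<lambda>\<omega>. ?P n (\<lambda>t. \<Theta> t \<omega>))"
    proof (rule integral_cong_AE)
      show "AE \<omega> in N. ?f n \<omega> = ?P n (\<lambda>t. \<Theta> t \<omega>)"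
        using AE_\<Theta>_0
      proof eventually_elim
        case (elim \<omega>)
        have "clamp b r * clamp b r = (min b \<bar>r\<bar>)\<^sup>2" if "0 \<le> b" for b r
        proof -
          have "\<bar>clamp b r\<bar> = min b \<bar>r\<bar>" using that by (auto simp: clamp_def)
          then show ?thesis by (metis power2_abs power2_eq_square)
        qed
        then show ?case using elim by (simp add: clamped_product_def cutoff_def)
      qed
    qed (use functional_measurable(3)[OF F] in auto)
    also have "\<dots> \<le> 1 + (real n)\<^sup>2 * 0"
    proof (rule tendsto_le[OF _ _ functional_limit[OF F]])
      show "((\<lambda>x. 1 + (real n)\<^sup>2 * (x\<^sup>2 * tail x / trunc_moment x)) \<longlongrightarrow> 1 + (real n)\<^sup>2 * 0) at_top"
        by (intro tendsto_intros square_tail_negligible)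
      show "\<forall>\<^sub>F x in at_top. expectation (\<lambda>\<omega>. ?P n (\<lambda>t. X t \<omega>) * indicator {z. \<bar>z\<bar> \<le> x} (X 0 \<omega>)) / trunc_moment x
         \<le> 1 + (real n)\<^sup>2 * (x\<^sup>2 * tail x / trunc_moment x)"
        using trunc_moment_pos eventually_ge_at_top[of 0]
      proof eventually_elim
        case (elim x)
        have it: "integrable M (\<lambda>\<omega>. (trunc x (X t \<omega>))\<^sup>2)"
          by (rule integrable_marginal[OF _ integrable_trunc_power]) simp
        have pw: "?P n z * indicator {z. \<bar>z\<bar> \<le> x} (z 0) \<le> (trunc x (z t))\<^sup>2 + (real n)\<^sup>2 * x\<^sup>2 * ?J x (z t)" for z
        proof (cases "\<bar>z 0\<bar> \<le> x")
          case True
          have "(real n)\<^sup>2 * (z 0)\<^sup>2 \<le> (real n)\<^sup>2 * x\<^sup>2"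
            using True elim by (intro mult_left_mono) (auto simp: abs_le_square_iff[symmetric])
          then have "\<bar>?P n z\<bar> \<le> (real n)\<^sup>2 * x\<^sup>2"
            using abs_clamped_product_le(1)[of n 0 "{}" t t z] by linarith
          moreover have "\<bar>?P n z\<bar> \<le> (z t)\<^sup>2"
            using abs_clamped_product_le(3)[of n 0 "{}" t t z] by (simp add: power2_eq_square)
          ultimately show ?thesis using True by (auto simp: trunc_def indicator_def)
        qed simp
        have "expectation (\<lambda>\<omega>. ?P n (\<lambda>t. X t \<omega>) * indicator {z. \<bar>z\<bar> \<le> x} (X 0 \<omega>))
            \<le> expectation (\<lambda>\<omega>. (trunc x (X t \<omega>))\<^sup>2 + (real n)\<^sup>2 * x\<^sup>2 * ?J x (X t \<omega>))"
        proof (rule integral_mono')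
          show "integrable M (\<lambda>\<omega>. (trunc x (X t \<omega>))\<^sup>2 + (real n)\<^sup>2 * x\<^sup>2 * ?J x (X t \<omega>))"
            using it integrable_tail'[of x t] by simp
          show "?P n (\<lambda>t. X t \<omega>) * indicator {z. \<bar>z\<bar> \<le> x} (X 0 \<omega>)
             \<le> (trunc x (X t \<omega>))\<^sup>2 + (real n)\<^sup>2 * x\<^sup>2 * ?J x (X t \<omega>)" for \<omega>
            by (rule pw)
        qed simp
        also have "\<dots> = trunc_moment x + (real n)\<^sup>2 * (x\<^sup>2 * tail x)"
          using it integrable_tail'[of x t] expectation_marginal[of "\<lambda>z. (trunc x z)\<^sup>2" t]
          by (simp add: trunc_moment_def expectation_tail')
        finally show ?case using elim by (simp add: field_simps)
      qed
    qed simp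
    finally show ?thesis by simp
  qed
qed simp

lemma integrable_\<Theta>_product: "integrable N (\<lambda>\<omega>. \<Theta> s \<omega> * \<Theta> t \<omega>)"
proof (rule Bochner_Integration.integrable_bound)
  show "integrable N (\<lambda>\<omega>. (\<Theta> s \<omega>)\<^sup>2 + (\<Theta> t \<omega>)\<^sup>2)" using integrable_\<Theta>_square by simp
  have "\<bar>a * b\<bar> \<le> a\<^sup>2 + b\<^sup>2" for a b :: real
    using sum_squares_bound[of "\<bar>a\<bar>" "\<bar>b\<bar>"] by (simp add: abs_mult)
      (use zero_le_power2[of a] zero_le_power2[of b] in linarith)
  then show "AE \<omega> in N. norm (\<Theta> s \<omega> * \<Theta> t \<omega>) \<le> norm ((\<Theta> s \<omega>)\<^sup>2 + (\<Theta> t \<omega>)\<^sup>2)" by simp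
qed simp

lemma expectation_clamped_tendsto:
  assumes J: "finite J"
  shows "(\<lambda>n. N.expectation (\<lambda>\<omega>. clamped_product n p J s t (\<lambda>i. \<Theta> (i - q) \<omega>))) \<longlonglongrightarrow>
    N.expectation (\<lambda>\<omega>. \<Theta> (s - q) \<omega> * \<Theta> (t - q) \<omega> *
      of_bool (\<Theta> (- q) \<omega> \<noteq> 0 \<and> \<Theta> (p - q) \<omega> \<noteq> 0 \<and> (\<forall>i\<in>J. \<Theta> (i - q) \<omega> = 0)))"
proof (rule integral_dominated_convergence[where w = "\<lambda>\<omega>. \<bar>\<Theta> (s - q) \<omega> * \<Theta> (t - q) \<omega>\<bar>"])
  show lim: "AE \<omega> in N. (\<lambda>n. clamped_product n p J s t (\<lambda>i. \<Theta> (i - q) \<omega>)) \<longlonglongrightarrow>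
     \<Theta> (s - q) \<omega> * \<Theta> (t - q) \<omega> *
      of_bool (\<Theta> (- q) \<omega> \<noteq> 0 \<and> \<Theta> (p - q) \<omega> \<noteq> 0 \<and> (\<forall>i\<in>J. \<Theta> (i - q) \<omega> = 0))"
    using clamped_product_tendsto[OF J, of p s t "\<lambda>i. \<Theta> (i - q) _"] by (intro AE_I2) simp
  show meas: "(\<lambda>\<omega>. clamped_product n p J s t (\<lambda>i. \<Theta> (i - q) \<omega>)) \<in> borel_measurable N" for n
    unfolding clamped_product_def cutoff_def clamp_def by measurable
  show "(\<lambda>\<omega>. \<Theta> (s - q) \<omega> * \<Theta> (t - q) \<omega> *
      of_bool (\<Theta> (- q) \<omega> \<noteq> 0 \<and> \<Theta> (p - q) \<omega> \<noteq> 0 \<and> (\<forall>i\<in>J. \<Theta> (i - q) \<omega> = 0))) \<in> borel_measurable N"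
    by (rule borel_measurable_LIMSEQ_real[where u = "\<lambda>n \<omega>. clamped_product n p J s t (\<lambda>i. \<Theta> (i - q) \<omega>)", OF _ meas])
      (use clamped_product_tendsto[OF J, of p s t "\<lambda>i. \<Theta> (i - q) _"] in simp)
  show "AE \<omega> in N. norm (clamped_product n p J s t (\<lambda>i. \<Theta> (i - q) \<omega>)) \<le> \<bar>\<Theta> (s - q) \<omega> * \<Theta> (t - q) \<omega>\<bar>" for n
    using abs_clamped_product_le(3)[of n p J s t "\<lambda>i. \<Theta> (i - q) _"] by simp
qed (intro integrable_abs integrable_\<Theta>_product)

text \<open>The time-change formula \<open>E[g(\<Theta>); \<Theta>\<^sub>p \<noteq> 0] = E[g(\<Theta>\<^sub>\<cdot>\<^sub>-\<^sub>p); \<Theta>\<^sub>-\<^sub>p \<noteq> 0]\<close> for the degree-2 functions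
  \<open>g\<close> given by a product of two coordinates, restricted to the vanishing of the coordinates in \<open>J\<close>.\<close>

lemma tail_process_shift:
  assumes J: "finite J"
  shows "N.expectation (\<lambda>\<omega>. \<Theta> s \<omega> * \<Theta> t \<omega> *
      of_bool (\<Theta> 0 \<omega> \<noteq> 0 \<and> \<Theta> p \<omega> \<noteq> 0 \<and> (\<forall>i\<in>J. \<Theta> i \<omega> = 0)))
    = N.expectation (\<lambda>\<omega>. \<Theta> (s - p) \<omega> * \<Theta> (t - p) \<omega> *
      of_bool (\<Theta> (- p) \<omega> \<noteq> 0 \<and> \<Theta> 0 \<omega> \<noteq> 0 \<and> (\<forall>i\<in>J. \<Theta> (i - p) \<omega> = 0)))"
proof -
  obtain h where F: "\<And>n. quadratic_functional h ((real n)\<^sup>2) (clamped_product n p J s t)"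
    using clamped_product_functional[OF J] by blast
  have "N.expectation (\<lambda>\<omega>. clamped_product n p J s t (\<lambda>t. \<Theta> t \<omega>))
      = N.expectation (\<lambda>\<omega>. clamped_product n p J s t (\<lambda>t. \<Theta> (t - p) \<omega>))" for n
    using abs_clamped_product_le(2) by (rule time_change[OF F])
  then show ?thesis
    using LIMSEQ_unique expectation_clamped_tendsto[OF J, of p s t 0] expectation_clamped_tendsto[OF J, of p s t p]
    by simp
qed

text \<open>Replacing \<open>X\<^sub>h\<close> by its clamp at \<open>\<plusminus>n|X\<^sub>0|\<close> produces a quadratic functional. Where
  \<open>n|X\<^sub>0| < |X\<^sub>h| \<le> x\<close> the product \<open>|X\<^sub>0 X\<^sub>h|\<close> is at most \<open>X\<^sub>h\<^sup>2 / n\<close>, which costs \<open>K(x) / n\<close>; the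
  event \<open>|X\<^sub>h| > x\<close> costs \<open>n x\<^sup>2 T(x)\<close>, negligible for fixed \<open>n\<close>.\<close>

lemma autocovariance_limit:
  "((\<lambda>x. expectation (\<lambda>\<omega>. trunc x (X 0 \<omega>) * trunc x (X h \<omega>)) / trunc_moment x)
    \<longlongrightarrow> N.expectation (\<lambda>\<omega>. \<Theta> 0 \<omega> * \<Theta> h \<omega>)) at_top"
proof (rule tendstoI)
  fix e :: real assume e: "0 < e"
  let ?P = "\<lambda>n. clamped_product n 0 {} 0 h"
  let ?J = "\<lambda>x z. indicat_real {z. x < \<bar>z\<bar>} z"
  let ?I = "\<lambda>x z. indicat_real {z. \<bar>z\<bar> \<le> x} z"
  define g where "g = N.expectation (\<lambda>\<omega>. \<Theta> 0 \<omega> * \<Theta> h \<omega>)"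
  define f where "f n = N.expectation (\<lambda>\<omega>. ?P n (\<lambda>i. \<Theta> i \<omega>))" for n
  have "N.expectation (\<lambda>\<omega>. \<Theta> 0 \<omega> * \<Theta> h \<omega> * of_bool (\<Theta> 0 \<omega> \<noteq> 0)) = g"
    unfolding g_def by (intro Bochner_Integration.integral_cong) auto
  then have "f \<longlonglongrightarrow> g"
    using expectation_clamped_tendsto[of "{}" 0 0 h 0] unfolding f_def by simp
  then have "\<forall>\<^sub>F n in sequentially. dist (f n) g < e/4" by (rule tendstoD) (use e in simp)
  moreover have "\<forall>\<^sub>F n in sequentially. 1 / real n < e/4"
    by (rule order_tendstoD[OF lim_1_over_n]) (use e in simp)
  ultimately have "\<forall>\<^sub>F n in sequentially. 0 < n \<and> dist (f n) g < e/4 \<and> 1 / real n < e/4"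
    using eventually_gt_at_top[of 0] by eventually_elim simp
  then obtain n where n: "0 < n" "dist (f n) g < e/4" "1 / real n < e/4"
    using eventually_happens'[OF sequentially_bot] by blast
  obtain w where F: "quadratic_functional w ((real n)\<^sup>2) (?P n)"
    using clamped_product_functional[of "{}" 0 0 h] by auto
  have "\<forall>\<^sub>F x in at_top. dist (expectation (\<lambda>\<omega>. ?P n (\<lambda>t. X t \<omega>) * ?I x (X 0 \<omega>)) / trunc_moment x) (f n) < e/4"
    using tendstoD[OF functional_limit[OF F], of "e/4"] e unfolding f_def by simp
  moreover have "\<forall>\<^sub>F x in at_top. real n * (x\<^sup>2 * tail x / trunc_moment x) < e/4"
    by (rule order_tendstoD[OF tendsto_mult[OF tendsto_const square_tail_negligible]]) (use e in simp)
  ultimately show "\<forall>\<^sub>F x in at_top. dist (expectation (\<lambda>\<omega>. trunc x (X 0 \<omega>) * trunc x (X h \<omega>)) / trunc_moment x)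
      (N.expectation (\<lambda>\<omega>. \<Theta> 0 \<omega> * \<Theta> h \<omega>)) < e"
    using trunc_moment_pos eventually_gt_at_top[of 0]
  proof eventually_elim
    case (elim x)
    define A where "A = expectation (\<lambda>\<omega>. trunc x (X 0 \<omega>) * trunc x (X h \<omega>))"
    define A' where "A' = expectation (\<lambda>\<omega>. ?P n (\<lambda>t. X t \<omega>) * ?I x (X 0 \<omega>))"
    have pw: "\<bar>trunc x (z 0) * trunc x (z h) - ?P n z * ?I x (z 0)\<bar>
        \<le> 1 / real n * (trunc x (z h))\<^sup>2 + real n * x\<^sup>2 * ?J x (z h)" for z
    proof (cases "\<bar>z 0\<bar> \<le> x")
      case True
      have "real n * \<bar>z 0\<bar> \<ge> 1 * \<bar>z 0\<bar>" using n by (intro mult_right_mono) auto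
      then have P: "?P n z = z 0 * clamp (real n * \<bar>z 0\<bar>) (z h)"
        by (simp add: clamped_product_def cutoff_def clamp_eq)
      show ?thesis
      proof (cases "\<bar>z h\<bar> \<le> x")
        case True': True
        show ?thesis
        proof (cases "\<bar>z h\<bar> \<le> real n * \<bar>z 0\<bar>")
          case False
          have "\<bar>z h - clamp (real n * \<bar>z 0\<bar>) (z h)\<bar> \<le> \<bar>z h\<bar>"
            by (rule abs_diff_clamp_le) simp
          then have "\<bar>z 0\<bar> * \<bar>z h - clamp (real n * \<bar>z 0\<bar>) (z h)\<bar> \<le> (\<bar>z h\<bar> / real n) * \<bar>z h\<bar>"
            using False n by (intro mult_mono) (auto simp: field_simps)
          then show ?thesis using True True'
            by (simp add: P trunc_def abs_mult[symmetric] right_diff_distrib power2_eq_square)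
        qed (use True True' in \<open>simp add: P trunc_def clamp_eq\<close>)
      next
        case False
        have "\<bar>z 0\<bar> * \<bar>clamp (real n * \<bar>z 0\<bar>) (z h)\<bar> \<le> x * (real n * x)"
          using True n elim by (intro mult_mono order_trans[OF abs_clamp_le]) auto
        then show ?thesis using True False by (simp add: P trunc_def abs_mult power2_eq_square algebra_simps)
      qed
    qed (use n in \<open>simp add: trunc_def\<close>)
    have it: "integrable M (\<lambda>\<omega>. (trunc x (X h \<omega>))\<^sup>2)"
      by (rule integrable_marginal[OF _ integrable_trunc_power]) simp
    have i1: "integrable M (\<lambda>\<omega>. trunc x (X 0 \<omega>) * trunc x (X h \<omega>))"
      using elim by (intro integrable_const_bound[where B = "x * x"])
        (auto simp: abs_mult intro!: mult_mono abs_trunc_le_level)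
    have [measurable]: "(\<lambda>\<omega>. ?P n (\<lambda>t. X t \<omega>)) \<in> borel_measurable M"
      using functional_measurable(2)[OF F, of 0] by simp
    have i2: "integrable M (\<lambda>\<omega>. ?P n (\<lambda>t. X t \<omega>) * ?I x (X 0 \<omega>))"
    proof (rule integrable_const_bound[where B = "(real n)\<^sup>2 * x\<^sup>2"])
      have "\<bar>?P n z * ?I x (z 0)\<bar> \<le> (real n)\<^sup>2 * x\<^sup>2" for z
      proof (cases "\<bar>z 0\<bar> \<le> x")
        case True
        then have "(real n)\<^sup>2 * (z 0)\<^sup>2 \<le> (real n)\<^sup>2 * x\<^sup>2"
          using elim by (intro mult_left_mono) (auto simp: abs_le_square_iff[symmetric])
        then show ?thesis using True abs_clamped_product_le(1)[of n 0 "{}" 0 h z] by simp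
      qed simp
      then show "AE \<omega> in M. norm (?P n (\<lambda>t. X t \<omega>) * ?I x (X 0 \<omega>)) \<le> (real n)\<^sup>2 * x\<^sup>2"
        by (intro AE_I2) (simp only: real_norm_def)
    qed simp
    have "\<bar>A - A'\<bar> = \<bar>expectation (\<lambda>\<omega>. trunc x (X 0 \<omega>) * trunc x (X h \<omega>) - ?P n (\<lambda>t. X t \<omega>) * ?I x (X 0 \<omega>))\<bar>"
      unfolding A_def A'_def using i1 i2 by simp
    also have "\<dots> \<le> expectation (\<lambda>\<omega>. \<bar>trunc x (X 0 \<omega>) * trunc x (X h \<omega>) - ?P n (\<lambda>t. X t \<omega>) * ?I x (X 0 \<omega>)\<bar>)"
      by (rule integral_abs_bound)
    also have "\<dots> \<le> expectation (\<lambda>\<omega>. 1 / real n * (trunc x (X h \<omega>))\<^sup>2 + real n * x\<^sup>2 * ?J x (X h \<omega>))"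
      using pw i1 i2 it integrable_tail'[of x h] by (intro integral_mono) auto
    also have "\<dots> = 1 / real n * trunc_moment x + real n * (x\<^sup>2 * tail x)"
      using it integrable_tail'[of x h] expectation_marginal[of "\<lambda>z. (trunc x z)\<^sup>2" h]
      by (simp add: trunc_moment_def expectation_tail')
    finally have "\<bar>A - A'\<bar> / trunc_moment x \<le> (1 / real n * trunc_moment x + real n * (x\<^sup>2 * tail x)) / trunc_moment x"
      using elim by (intro divide_right_mono) auto
    then have "\<bar>A / trunc_moment x - A' / trunc_moment x\<bar> \<le> 1 / real n + real n * (x\<^sup>2 * tail x / trunc_moment x)"
      using elim by (simp add: add_divide_distrib diff_divide_distrib[symmetric])
    moreover have "\<bar>A' / trunc_moment x - f n\<bar> < e/4" using elim by (simp add: A'_def dist_real_def)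
    moreover have "\<bar>f n - g\<bar> < e/4" using n by (simp add: dist_real_def)
    ultimately have "\<bar>A / trunc_moment x - g\<bar> < e" using n elim by linarith
    then show ?case by (simp add: A_def g_def dist_real_def)
  qed
qed

end

section \<open>The two forms of the limiting variance\<close>

text \<open>For a path supported in \<open>[-m, m]\<close> the events under the sum say that \<open>-j\<close> is the position of the first
  nonzero coordinate. Only \<open>m\<close> vanishing predecessors are demanded, so that a shift by \<open>j\<close> gives the
  same condition on \<open>[-m, -1]\<close> for every \<open>j\<close>.\<close>

lemma sum_of_bool_first_nonzero:
  fixes z :: "int \<Rightarrow> real"
  assumes z0: "z 0 \<noteq> 0" and far: "\<And>i. int m < \<bar>i\<bar> \<Longrightarrow> z i = 0"
  shows "(\<Sum>j\<in>{0..int m}. of_bool (z 0 \<noteq> 0 \<and> z (- j) \<noteq> 0 \<and> (\<forall>i\<in>{- j - int m..- j - 1}. z i = 0)) :: real) = 1"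
proof -
  let ?P = "\<lambda>j. z 0 \<noteq> 0 \<and> z (- j) \<noteq> 0 \<and> (\<forall>i\<in>{- j - int m..- j - 1}. z i = 0)"
  define S where "S = {j\<in>{0..int m}. z (- j) \<noteq> 0}"
  define k where "k = Max S"
  have S: "finite S" "0 \<in> S" using z0 by (auto simp: S_def intro: finite_subset[of _ "{0..int m}"])
  have k: "k \<in> S" unfolding k_def using S by (intro Max_in) auto
  have max: "j \<le> k" if "j \<in> S" for j unfolding k_def using S that by (intro Max_ge)
  have "?P j \<longleftrightarrow> j = k" if j: "j \<in> {0..int m}" for j
  proof
    assume P: "?P j"
    then have "j \<le> k" using j by (intro max) (simp add: S_def)
    moreover have "\<not> j < k"
    proof
      assume "j < k"
      then have "- k \<in> {- j - int m..- j - 1}" using j k by (auto simp: S_def)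
      then show False using P k by (auto simp: S_def)
    qed
    ultimately show "j = k" by simp
  next
    assume "j = k"
    moreover have "z i = 0" if i: "i \<in> {- k - int m..- k - 1}" for i
    proof (rule ccontr)
      assume nz: "z i \<noteq> 0"
      then have "\<bar>i\<bar> \<le> int m" using far[of i] by linarith
      then have "- i \<in> S" using nz i k by (auto simp: S_def)
      then show False using max[of "- i"] i by auto
    qed
    ultimately show "?P j" using k z0 by (auto simp: S_def)
  qed
  then have "(\<Sum>j\<in>{0..int m}. of_bool (?P j) :: real) = (\<Sum>j\<in>{0..int m}. of_bool (j = k))"
    by (intro sum.cong) auto
  also have "\<dots> = 1" using k by (simp add: of_bool_def S_def)
  finally show ?thesis .
qed

lemma sum_products_eq_square:
  fixes z :: "int \<Rightarrow> real"
  assumes "\<And>i. i < 0 \<Longrightarrow> z i = 0" "\<And>i. int m < i \<Longrightarrow> z i = 0"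
  shows "(\<Sum>h\<in>{- int m..int m}. \<Sum>j\<in>{0..int m}. z j * z (h + j)) = (\<Sum>t = 0..int m. z t)\<^sup>2"
proof -
  have inner: "(\<Sum>h\<in>{- int m..int m}. z (h + j)) = (\<Sum>t = 0..int m. z t)" if "j \<in> {0..int m}" for j
  proof -
    have "(\<Sum>h\<in>{- int m..int m}. z (h + j)) = (\<Sum>t\<in>{j - int m..j + int m}. z t)"
      by (rule sum.reindex_bij_witness[where i = "\<lambda>t. t - j" and j = "\<lambda>h. h + j"]) auto
    also have "\<dots> = (\<Sum>t = 0..int m. z t)"
      using that assms by (intro sum.mono_neutral_right) auto
    finally show ?thesis .
  qed
  have "(\<Sum>h\<in>{- int m..int m}. \<Sum>j\<in>{0..int m}. z j * z (h + j))
      = (\<Sum>j\<in>{0..int m}. z j * (\<Sum>h\<in>{- int m..int m}. z (h + j)))"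
    by (subst sum.swap) (simp add: sum_distrib_left)
  also have "\<dots> = (\<Sum>j\<in>{0..int m}. z j * (\<Sum>t = 0..int m. z t))"
    using inner by simp
  finally show ?thesis by (simp add: power2_eq_square sum_distrib_right)
qed

context tail_process
begin

definition tail_autocov :: "int \<Rightarrow> real" where
  "tail_autocov h = N.expectation (\<lambda>\<omega>. \<Theta> 0 \<omega> * \<Theta> h \<omega>)"

lemma tail_autocov_eq_0: "int m < \<bar>h\<bar> \<Longrightarrow> tail_autocov h = 0"
  unfolding tail_autocov_def
  by (rule integral_eq_zero_AE) (use AE_\<Theta>_eq_0[of h] in \<open>auto elim!: eventually_mono\<close>)

lemma AE_\<Theta>_far: "AE \<omega> in N. \<forall>i. int m < \<bar>i\<bar> \<longrightarrow> \<Theta> i \<omega> = 0"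
  unfolding AE_all_countable using AE_\<Theta>_eq_0 by auto

definition cluster_square :: "'b \<Rightarrow> real" where
  "cluster_square \<omega> = (\<Sum>t = 0..int m. \<Theta> t \<omega>)\<^sup>2 * of_bool (\<forall>i\<in>{- int m..- 1}. \<Theta> i \<omega> = 0)"

text \<open>Decompose \<open>E[\<Theta>\<^sub>0 \<Theta>\<^sub>h]\<close> by the position \<open>-j\<close> of the first nonzero coordinate and shift it to the
  origin; the sum over \<open>j\<close> and \<open>h\<close> completes the square of the cluster sum.\<close>

lemma cluster_variance:
  shows "integrable N cluster_square" "N.expectation cluster_square = (\<Sum>h\<in>{- int m..int m}. tail_autocov h)"
proof -
  let ?H = "{- int m..int m}" and ?T = "{0..int m}"
  define c where "c \<omega> = (of_bool (\<forall>i\<in>{- int m..- 1}. \<Theta> i \<omega> = 0) :: real)" for \<omega>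
  let ?P = "\<lambda>j \<omega>. of_bool (\<Theta> 0 \<omega> \<noteq> 0 \<and> \<Theta> (- j) \<omega> \<noteq> 0 \<and> (\<forall>i\<in>{- j - int m..- j - 1}. \<Theta> i \<omega> = 0)) :: real"
  have [measurable]: "c \<in> borel_measurable N" "?P j \<in> borel_measurable N" for j
    unfolding c_def[abs_def] of_bool_def by measurable
  have int: "integrable N (\<lambda>\<omega>. \<Theta> s \<omega> * \<Theta> t \<omega> * of_bool (Q \<omega>))"
    if [measurable]: "(\<lambda>\<omega>. of_bool (Q \<omega>) :: real) \<in> borel_measurable N" for s t Q
    by (rule Bochner_Integration.integrable_bound[OF integrable_\<Theta>_product[of s t]]) auto
  have summand: "N.expectation (\<lambda>\<omega>. \<Theta> 0 \<omega> * \<Theta> h \<omega> * ?P j \<omega>) = N.expectation (\<lambda>\<omega>. \<Theta> j \<omega> * \<Theta> (h + j) \<omega> * c \<omega>)" for h j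
  proof -
    have meas: "(\<lambda>\<omega>. \<Theta> j \<omega> * \<Theta> (h + j) \<omega> *
        of_bool (\<Theta> j \<omega> \<noteq> 0 \<and> \<Theta> 0 \<omega> \<noteq> 0 \<and> (\<forall>i\<in>{- j - int m..- j - 1}. \<Theta> (i + j) \<omega> = 0))) \<in> borel_measurable N"
      unfolding of_bool_def by measurable
    have "N.expectation (\<lambda>\<omega>. \<Theta> 0 \<omega> * \<Theta> h \<omega> * ?P j \<omega>)
      = N.expectation (\<lambda>\<omega>. \<Theta> j \<omega> * \<Theta> (h + j) \<omega> *
        of_bool (\<Theta> j \<omega> \<noteq> 0 \<and> \<Theta> 0 \<omega> \<noteq> 0 \<and> (\<forall>i\<in>{- j - int m..- j - 1}. \<Theta> (i + j) \<omega> = 0)))"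
      using tail_process_shift[of "{- j - int m..- j - 1}" 0 h "- j"] by simp
    also have "\<dots> = N.expectation (\<lambda>\<omega>. \<Theta> j \<omega> * \<Theta> (h + j) \<omega> * c \<omega>)"
    proof (rule integral_cong_AE[OF meas])
      show "AE \<omega> in N. \<Theta> j \<omega> * \<Theta> (h + j) \<omega> *
          of_bool (\<Theta> j \<omega> \<noteq> 0 \<and> \<Theta> 0 \<omega> \<noteq> 0 \<and> (\<forall>i\<in>{- j - int m..- j - 1}. \<Theta> (i + j) \<omega> = 0))
        = \<Theta> j \<omega> * \<Theta> (h + j) \<omega> * c \<omega>"
        using AE_\<Theta>_0
      proof eventually_elim
        case (elim \<omega>)
        have "(\<forall>i\<in>{- j - int m..- j - 1}. \<Theta> (i + j) \<omega> = 0) \<longleftrightarrow> (\<forall>i\<in>{- int m..- 1}. \<Theta> i \<omega> = 0)"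
        proof safe
          fix i assume A: "\<forall>i\<in>{- j - int m..- j - 1}. \<Theta> (i + j) \<omega> = 0" and i: "i \<in> {- int m..- 1}"
          then have "i - j \<in> {- j - int m..- j - 1}" by auto
          then have "\<Theta> (i - j + j) \<omega> = 0" using A by blast
          then show "\<Theta> i \<omega> = 0" by simp
        qed auto
        then show ?case using elim unfolding c_def by (auto simp del: atLeastAtMost_iff)
      qed
    qed measurable
    finally show ?thesis .
  qed
  have split: "tail_autocov h = (\<Sum>j\<in>?T. N.expectation (\<lambda>\<omega>. \<Theta> j \<omega> * \<Theta> (h + j) \<omega> * c \<omega>))" for h
  proof -
    have "tail_autocov h = N.expectation (\<lambda>\<omega>. \<Sum>j\<in>?T. \<Theta> 0 \<omega> * \<Theta> h \<omega> * ?P j \<omega>)"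
      unfolding tail_autocov_def
    proof (rule integral_cong_AE)
      show "AE \<omega> in N. \<Theta> 0 \<omega> * \<Theta> h \<omega> = (\<Sum>j\<in>?T. \<Theta> 0 \<omega> * \<Theta> h \<omega> * ?P j \<omega>)"
        using AE_\<Theta>_0 AE_\<Theta>_far
      proof eventually_elim
        case (elim \<omega>)
        then have "\<Theta> 0 \<omega> \<noteq> 0" by auto
        then show ?case
          using sum_of_bool_first_nonzero[of "\<lambda>i. \<Theta> i \<omega>" m] elim(2) unfolding sum_distrib_left[symmetric] by simp
      qed
    qed measurable
    also have "\<dots> = (\<Sum>j\<in>?T. N.expectation (\<lambda>\<omega>. \<Theta> 0 \<omega> * \<Theta> h \<omega> * ?P j \<omega>))"
      by (intro Bochner_Integration.integral_sum int) measurable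
    finally show ?thesis by (simp only: summand)
  qed
  have intc: "integrable N (\<lambda>\<omega>. \<Theta> j \<omega> * \<Theta> (h + j) \<omega> * c \<omega>)" for h j
    unfolding c_def by (rule int) (simp add: c_def[symmetric])
  have meas: "cluster_square \<in> borel_measurable N"
    unfolding cluster_square_def[abs_def] c_def[symmetric] by measurable
  have AE: "AE \<omega> in N. (\<Sum>h\<in>?H. \<Sum>j\<in>?T. \<Theta> j \<omega> * \<Theta> (h + j) \<omega> * c \<omega>) = cluster_square \<omega>"
    using AE_\<Theta>_far
  proof eventually_elim
    case (elim \<omega>)
    show ?case
    proof (cases "\<forall>i\<in>{- int m..- 1}. \<Theta> i \<omega> = 0")
      case True
      have "\<Theta> i \<omega> = 0" if "i < 0" for i
        using True elim that by (cases "i < - int m") auto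
      then show ?thesis
        using True elim sum_products_eq_square[of "\<lambda>i. \<Theta> i \<omega>" m] by (simp add: cluster_square_def c_def)
    qed (auto simp: cluster_square_def c_def)
  qed
  have "integrable N (\<lambda>\<omega>. \<Sum>h\<in>?H. \<Sum>j\<in>?T. \<Theta> j \<omega> * \<Theta> (h + j) \<omega> * c \<omega>)"
    using intc by simp
  then show "integrable N cluster_square"
    using integrable_cong_AE[OF _ meas AE] by simp
  have "N.expectation cluster_square = N.expectation (\<lambda>\<omega>. \<Sum>h\<in>?H. \<Sum>j\<in>?T. \<Theta> j \<omega> * \<Theta> (h + j) \<omega> * c \<omega>)"
    using AE by (intro integral_cong_AE meas) (auto elim!: eventually_mono)
  also have "\<dots> = (\<Sum>h\<in>?H. \<Sum>j\<in>?T. N.expectation (\<lambda>\<omega>. \<Theta> j \<omega> * \<Theta> (h + j) \<omega> * c \<omega>))"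
    using intc by simp
  finally show "N.expectation cluster_square = (\<Sum>h\<in>?H. tail_autocov h)" by (simp add: split)
qed

end

text \<open>There are \<open>k - |h|\<close> pairs at lag \<open>h\<close>.\<close>

lemma double_sum_lag:
  fixes g :: "int \<Rightarrow> real"
  assumes far: "\<And>h. int m < \<bar>h\<bar> \<Longrightarrow> g h = 0" and k: "m \<le> k"
  shows "(\<Sum>s\<in>{1..int k}. \<Sum>t\<in>{1..int k}. g (t - s)) = (\<Sum>h\<in>{- int m..int m}. real_of_int (int k - \<bar>h\<bar>) * g h)"
proof -
  have inner: "(\<Sum>t\<in>{1..int k}. g (t - s)) = (\<Sum>h\<in>{- int m..int m}. g h * of_bool (s + h \<in> {1..int k}))" for s
  proof -
    have "(\<Sum>t\<in>{1..int k}. g (t - s)) = (\<Sum>h\<in>{1 - s..int k - s}. g h)"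
      by (rule sum.reindex_bij_witness[where i = "\<lambda>h. h + s" and j = "\<lambda>t. t - s"]) auto
    also have "\<dots> = (\<Sum>h\<in>{- int m..int m} \<inter> {1 - s..int k - s}. g h)"
    proof (rule sum.mono_neutral_right)
      show "\<forall>i\<in>{1 - s..int k - s} - {- int m..int m} \<inter> {1 - s..int k - s}. g i = 0"
      proof
        fix i assume "i \<in> {1 - s..int k - s} - {- int m..int m} \<inter> {1 - s..int k - s}"
        then have "int m < \<bar>i\<bar>" by auto
        then show "g i = 0" by (rule far)
      qed
    qed auto
    also have "\<dots> = (\<Sum>h\<in>{- int m..int m}. if h \<in> {1 - s..int k - s} then g h else 0)"
      by (rule sum.inter_restrict) simp
    also have "\<dots> = (\<Sum>h\<in>{- int m..int m}. g h * of_bool (s + h \<in> {1..int k}))"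
      by (intro sum.cong refl) auto
    finally show ?thesis .
  qed
  have count: "(\<Sum>s\<in>{1..int k}. of_bool (s + h \<in> {1..int k}) :: real) = real_of_int (int k - \<bar>h\<bar>)"
    if "h \<in> {- int m..int m}" for h
  proof -
    have "(\<Sum>s\<in>{1..int k}. of_bool (s + h \<in> {1..int k}) :: real) = real (card ({1..int k} \<inter> {s. s + h \<in> {1..int k}}))"
      by (simp add: of_bool_def sum.If_cases)
    also have "{1..int k} \<inter> {s. s + h \<in> {1..int k}} = {max 1 (1 - h)..min (int k) (int k - h)}" by auto
    also have "real (card \<dots>) = real_of_int (int k - \<bar>h\<bar>)" using that k by auto
    finally show ?thesis .
  qed
  have "(\<Sum>s\<in>{1..int k}. \<Sum>t\<in>{1..int k}. g (t - s))
      = (\<Sum>h\<in>{- int m..int m}. g h * (\<Sum>s\<in>{1..int k}. of_bool (s + h \<in> {1..int k})))"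
    unfolding inner sum_distrib_left by (rule sum.swap)
  also have "\<dots> = (\<Sum>h\<in>{- int m..int m}. real_of_int (int k - \<bar>h\<bar>) * g h)"
    using count by (intro sum.cong refl) simp
  finally show ?thesis .
qed

lemma block_variance_limit:
  fixes g :: "int \<Rightarrow> real"
  assumes far: "\<And>h. int m < \<bar>h\<bar> \<Longrightarrow> g h = 0"
  shows "(\<lambda>k. (\<Sum>s\<in>{1..int k}. \<Sum>t\<in>{1..int k}. g (t - s)) / real (k + m))
    \<longlonglongrightarrow> (\<Sum>h\<in>{- int m..int m}. g h)"
proof (rule Lim_transform_eventually)
  have "(\<lambda>k. real_of_int (int k - \<bar>h\<bar>) / real (k + m)) \<longlonglongrightarrow> 1" for h
    by real_asymp
  then have "(\<lambda>k. \<Sum>h\<in>{- int m..int m}. real_of_int (int k - \<bar>h\<bar>) / real (k + m) * g h)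
      \<longlonglongrightarrow> (\<Sum>h\<in>{- int m..int m}. 1 * g h)"
    by (intro tendsto_intros)
  then show "(\<lambda>k. \<Sum>h\<in>{- int m..int m}. real_of_int (int k - \<bar>h\<bar>) / real (k + m) * g h)
      \<longlonglongrightarrow> (\<Sum>h\<in>{- int m..int m}. g h)" by simp
  show "\<forall>\<^sub>F k in sequentially. (\<Sum>h\<in>{- int m..int m}. real_of_int (int k - \<bar>h\<bar>) / real (k + m) * g h)
     = (\<Sum>s\<in>{1..int k}. \<Sum>t\<in>{1..int k}. g (t - s)) / real (k + m)"
    using eventually_ge_at_top[of m]
  proof eventually_elim
    case (elim k)
    then show ?case using double_sum_lag[of m g k, OF far elim] by (simp add: sum_divide_distrib)
  qed
qed

section \<open>Characteristic functions\<close>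

lemma normal_law_char:
  assumes "0 \<le> v"
  shows "real_distribution (normal_law 0 v)" "char (normal_law 0 v) t = complex_of_real (exp (- (v * t\<^sup>2) / 2))"
proof -
  have "real_distribution (normal_law 0 v) \<and> char (normal_law 0 v) t = complex_of_real (exp (- (v * t\<^sup>2) / 2))"
  proof (cases "v = 0")
    case True
    then show ?thesis
      by (auto simp: normal_law_def real_distribution_def real_distribution_axioms_def char_def
          integral_return prob_space_return)
  next
    case False
    then have v: "0 < v" using assms by simp
    interpret S: real_distribution std_normal_distribution by (rule real_dist_normal_dist)
    have "distributed std_normal_distribution lborel (\<lambda>x. x) std_normal_density"
      unfolding distributed_def by (auto simp: distr_id2)
    from S.normal_density_affine[OF this, of "sqrt v" 0] v
    have "distributed std_normal_distribution lborel (\<lambda>x. sqrt v * x) (normal_density 0 (sqrt v))" by simp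
    then have "distr std_normal_distribution lborel (\<lambda>x. sqrt v * x) = normal_law 0 v"
      unfolding distributed_def normal_law_def using v by simp
    moreover have "distr std_normal_distribution lborel (\<lambda>x. sqrt v * x) = distr std_normal_distribution borel (\<lambda>x. sqrt v * x)"
      by (rule distr_cong) auto
    ultimately have eq: "normal_law 0 v = distr std_normal_distribution borel (\<lambda>x. sqrt v * x)" by simp
    have "char (normal_law 0 v) t = char std_normal_distribution (t * sqrt v)"
      unfolding eq char_def by (subst integral_distr) (auto simp: mult.assoc)
    also have "\<dots> = complex_of_real (exp (- (v * t\<^sup>2) / 2))"
      using v by (simp add: char_std_normal_distribution power_mult_distrib mult.commute)
    finally show ?thesis unfolding eq using S.real_distribution_distr by auto
  qed
  then show "real_distribution (normal_law 0 v)" "char (normal_law 0 v) t = complex_of_real (exp (- (v * t\<^sup>2) / 2))"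
    by auto
qed

lemma iexp_lipschitz: "cmod (iexp x - iexp y) \<le> \<bar>x - y\<bar>"
proof -
  have "iexp x - iexp y = iexp y * (iexp (x - y) - 1)"
    by (simp add: right_diff_distrib exp_add[symmetric])
  moreover have "cmod (iexp (x - y) - 1) \<le> \<bar>x - y\<bar>"
    using iexp_approx1[of "x - y" 0] by simp
  ultimately show ?thesis by (simp add: norm_mult)
qed

lemma (in prob_space) char_L1_bound:
  fixes U V :: "'a \<Rightarrow> real"
  assumes [measurable]: "U \<in> borel_measurable M" "V \<in> borel_measurable M"
    and int: "integrable M (\<lambda>\<omega>. U \<omega> - V \<omega>)"
  shows "cmod (expectation (\<lambda>\<omega>. iexp (\<theta> * U \<omega>)) - expectation (\<lambda>\<omega>. iexp (\<theta> * V \<omega>)))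
    \<le> \<bar>\<theta>\<bar> * expectation (\<lambda>\<omega>. \<bar>U \<omega> - V \<omega>\<bar>)"
proof -
  have i: "integrable M (\<lambda>\<omega>. iexp (\<theta> * f \<omega>))" if "f \<in> borel_measurable M" for f
    using that by (intro integrable_iexp) auto
  have "cmod (expectation (\<lambda>\<omega>. iexp (\<theta> * U \<omega>)) - expectation (\<lambda>\<omega>. iexp (\<theta> * V \<omega>)))
      = cmod (expectation (\<lambda>\<omega>. iexp (\<theta> * U \<omega>) - iexp (\<theta> * V \<omega>)))"
    using i by (subst Bochner_Integration.integral_diff) auto
  also have "\<dots> \<le> expectation (\<lambda>\<omega>. cmod (iexp (\<theta> * U \<omega>) - iexp (\<theta> * V \<omega>)))"
    by (rule integral_norm_bound)
  also have "\<dots> \<le> expectation (\<lambda>\<omega>. \<bar>\<theta>\<bar> * \<bar>U \<omega> - V \<omega>\<bar>)"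
  proof (rule integral_mono)
    show "integrable M (\<lambda>\<omega>. cmod (iexp (\<theta> * U \<omega>) - iexp (\<theta> * V \<omega>)))"
      using i[of U] i[of V] by (intro integrable_norm Bochner_Integration.integrable_diff) auto
    show "cmod (iexp (\<theta> * U \<omega>) - iexp (\<theta> * V \<omega>)) \<le> \<bar>\<theta>\<bar> * \<bar>U \<omega> - V \<omega>\<bar>" for \<omega>
      using iexp_lipschitz[of "\<theta> * U \<omega>" "\<theta> * V \<omega>"]
      by (simp add: abs_mult[symmetric] right_diff_distrib)
  qed (use int in auto)
  finally show ?thesis by simp
qed

lemma exp_minus_approx:
  fixes y :: real assumes "0 \<le> y"
  shows "\<bar>exp (- y) - (1 - y)\<bar> \<le> y\<^sup>2"
proof -
  have "1 \<le> (1 - y + y\<^sup>2) * (1 + y)"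
    using assms by (simp add: algebra_simps power2_eq_square)
  also have "\<dots> \<le> (1 - y + y\<^sup>2) * exp y"
  proof (rule mult_left_mono)
    have "1 - y + y\<^sup>2 = (y - 1/2)\<^sup>2 + 3/4" by (simp add: power2_eq_square algebra_simps)
    then show "0 \<le> 1 - y + y\<^sup>2" by simp
  qed simp
  finally have "exp (- y) \<le> 1 - y + y\<^sup>2" by (simp add: exp_minus field_simps)
  moreover have "1 - y \<le> exp (- y)" using exp_ge_add_one_self[of "- y"] by simp
  ultimately show ?thesis by simp
qed

text \<open>The means of the truncated variables are not zero but of smaller order, so the first-order term
  is kept as an error.\<close>

lemma (in prob_space) char_second_order:
  fixes U :: "'a \<Rightarrow> real"
  assumes [measurable]: "U \<in> borel_measurable M" and bdd: "\<And>\<omega>. \<bar>U \<omega>\<bar> \<le> c"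
  defines "v \<equiv> expectation (\<lambda>\<omega>. (U \<omega>)\<^sup>2)"
  shows "cmod (expectation (\<lambda>\<omega>. iexp (\<theta> * U \<omega>)) - exp (- (\<theta>\<^sup>2 * v / 2)))
    \<le> \<bar>\<theta>\<bar> * \<bar>expectation U\<bar> + \<bar>\<theta>\<bar>^3 * expectation (\<lambda>\<omega>. \<bar>U \<omega>\<bar>^3) + (\<theta>\<^sup>2 * v / 2)\<^sup>2"
proof -
  have c: "0 \<le> c" using bdd order_trans[OF abs_ge_zero] by blast
  have int: "integrable M (\<lambda>\<omega>. (U \<omega>)^j)" for j
    by (rule integrable_const_bound[where B = "c^j"]) (auto simp: power_abs intro!: power_mono bdd)
  have int3: "integrable M (\<lambda>\<omega>. \<bar>U \<omega>\<bar>^3)" using integrable_abs[OF int[of 3]] by (simp add: power_abs)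
  have intU: "integrable M U" using int[of 1] by simp
  have ie: "integrable M (\<lambda>\<omega>. iexp (\<theta> * U \<omega>))" by (intro integrable_iexp) auto
  define p where "p \<omega> = 1 + \<i> * complex_of_real (\<theta> * U \<omega>) - complex_of_real (\<theta>\<^sup>2 / 2 * (U \<omega>)\<^sup>2)" for \<omega>
  have a: "integrable M (\<lambda>\<omega>. complex_of_real (\<theta> * U \<omega>))" "integrable M (\<lambda>\<omega>. complex_of_real (\<theta>\<^sup>2 / 2 * (U \<omega>)\<^sup>2))"
    using intU int[of 2] by (auto intro!: integrable_of_real integrable_mult_right simp del: of_real_mult of_real_power of_real_divide)
  have ip: "integrable M p"
    unfolding p_def using a
    by (intro Bochner_Integration.integrable_diff Bochner_Integration.integrable_add integrable_mult_right) auto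
  have Ep: "integral\<^sup>L M p = 1 + \<i> * complex_of_real (\<theta> * expectation U) - complex_of_real (\<theta>\<^sup>2 * v / 2)"
  proof -
    have b: "expectation (\<lambda>\<omega>. complex_of_real (\<theta> * U \<omega>)) = complex_of_real (\<theta> * expectation U)"
      "expectation (\<lambda>\<omega>. complex_of_real (\<theta>\<^sup>2 / 2 * (U \<omega>)\<^sup>2)) = complex_of_real (\<theta>\<^sup>2 / 2 * v)"
      unfolding v_def integral_complex_of_real by simp_all
    have "integral\<^sup>L M p = expectation (\<lambda>\<omega>. 1 + \<i> * complex_of_real (\<theta> * U \<omega>)) - expectation (\<lambda>\<omega>. complex_of_real (\<theta>\<^sup>2 / 2 * (U \<omega>)\<^sup>2))"
      unfolding p_def using a by (intro Bochner_Integration.integral_diff) auto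
    also have "expectation (\<lambda>\<omega>. 1 + \<i> * complex_of_real (\<theta> * U \<omega>)) = expectation (\<lambda>\<omega>. 1) + expectation (\<lambda>\<omega>. \<i> * complex_of_real (\<theta> * U \<omega>))"
      using a by (intro Bochner_Integration.integral_add) auto
    also have "expectation (\<lambda>\<omega>. \<i> * complex_of_real (\<theta> * U \<omega>)) = \<i> * complex_of_real (\<theta> * expectation U)"
      unfolding integral_mult_right_zero b ..
    finally show ?thesis unfolding b by (simp add: prob_space)
  qed
  have "cmod (expectation (\<lambda>\<omega>. iexp (\<theta> * U \<omega>)) - integral\<^sup>L M p) = cmod (expectation (\<lambda>\<omega>. iexp (\<theta> * U \<omega>) - p \<omega>))"
    using ie ip by (subst Bochner_Integration.integral_diff) auto
  also have "\<dots> \<le> expectation (\<lambda>\<omega>. cmod (iexp (\<theta> * U \<omega>) - p \<omega>))"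
    by (rule integral_norm_bound)
  also have "\<dots> \<le> expectation (\<lambda>\<omega>. \<bar>\<theta>\<bar>^3 * \<bar>U \<omega>\<bar>^3)"
  proof (rule integral_mono)
    show "integrable M (\<lambda>\<omega>. cmod (iexp (\<theta> * U \<omega>) - p \<omega>))"
      using ie ip by (intro integrable_norm Bochner_Integration.integrable_diff)
    show "cmod (iexp (\<theta> * U \<omega>) - p \<omega>) \<le> \<bar>\<theta>\<bar>^3 * \<bar>U \<omega>\<bar>^3" for \<omega>
    proof -
      have "(\<Sum>k\<le>2. (\<i> * complex_of_real (\<theta> * U \<omega>))^k / fact k) = p \<omega>"
        unfolding p_def by (simp add: numeral_2_eq_2 power_mult_distrib)
      then have "cmod (iexp (\<theta> * U \<omega>) - p \<omega>) \<le> \<bar>\<theta> * U \<omega>\<bar>^3 / 6"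
        using iexp_approx1[of "\<theta> * U \<omega>" 2] by (simp add: fact_numeral numeral_3_eq_3)
      also have "\<dots> \<le> \<bar>\<theta> * U \<omega>\<bar>^3" by simp
      finally show ?thesis by (simp add: abs_mult power_mult_distrib)
    qed
  qed (use int3 in auto)
  finally have 1: "cmod (expectation (\<lambda>\<omega>. iexp (\<theta> * U \<omega>)) - integral\<^sup>L M p) \<le> \<bar>\<theta>\<bar>^3 * expectation (\<lambda>\<omega>. \<bar>U \<omega>\<bar>^3)"
    by simp
  have v: "0 \<le> \<theta>\<^sup>2 * v / 2" unfolding v_def by simp
  have "integral\<^sup>L M p - exp (- (\<theta>\<^sup>2 * v / 2))
      = \<i> * complex_of_real (\<theta> * expectation U) - complex_of_real (exp (- (\<theta>\<^sup>2 * v / 2)) - (1 - \<theta>\<^sup>2 * v / 2))"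
    unfolding Ep by simp
  also have "cmod \<dots> \<le> cmod (\<i> * complex_of_real (\<theta> * expectation U)) + cmod (complex_of_real (exp (- (\<theta>\<^sup>2 * v / 2)) - (1 - \<theta>\<^sup>2 * v / 2)))"
    by (rule norm_triangle_ineq4)
  also have "\<dots> \<le> \<bar>\<theta>\<bar> * \<bar>expectation U\<bar> + (\<theta>\<^sup>2 * v / 2)\<^sup>2"
    using exp_minus_approx[OF v] unfolding norm_of_real norm_mult by (simp add: abs_mult)
  finally have 2: "cmod (integral\<^sup>L M p - exp (- (\<theta>\<^sup>2 * v / 2))) \<le> \<bar>\<theta>\<bar> * \<bar>expectation U\<bar> + (\<theta>\<^sup>2 * v / 2)\<^sup>2" .
  show ?thesis
    using norm_triangle_le[OF add_mono[OF 1 2]] by (simp add: algebra_simps)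
qed

section \<open>Block decomposition and the normal limit\<close>

lemma abs_sum_cube_le:
  fixes x :: "'i \<Rightarrow> real"
  assumes "finite I"
  shows "\<bar>\<Sum>t\<in>I. x t\<bar>^3 \<le> real (card I)^3 * (\<Sum>t\<in>I. \<bar>x t\<bar>^3)"
proof (cases "I = {}")
  case False
  define c where "c = Max ((\<lambda>t. \<bar>x t\<bar>) ` I)"
  have "c \<in> (\<lambda>t. \<bar>x t\<bar>) ` I" unfolding c_def using assms False by (intro Max_in) auto
  then obtain u where u: "u \<in> I" "c = \<bar>x u\<bar>" by blast
  have "\<bar>x t\<bar> \<le> c" if "t \<in> I" for t unfolding c_def using assms that by (intro Max_ge) auto
  then have "\<bar>\<Sum>t\<in>I. x t\<bar> \<le> real (card I) * c"
    by (intro order_trans[OF sum_abs sum_bounded_above])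
  then have "\<bar>\<Sum>t\<in>I. x t\<bar>^3 \<le> (real (card I) * c)^3" by (intro power_mono) auto
  also have "\<dots> = real (card I)^3 * \<bar>x u\<bar>^3" by (simp add: u power_mult_distrib)
  also have "\<dots> \<le> real (card I)^3 * (\<Sum>t\<in>I. \<bar>x t\<bar>^3)"
    using assms u by (intro mult_left_mono member_le_sum) auto
  finally show ?thesis .
qed simp

locale normalized_tail_process = tail_process +
  fixes a :: "nat \<Rightarrow> real"
  assumes normalization: "\<forall>\<^sub>F n in sequentially. 0 < a n \<and>
    real n * tail (a n) + real n / (a n)\<^sup>2 * trunc_moment (a n) = 1"
begin

text \<open>If \<open>a n \<le> A\<close> for some large \<open>n\<close>, then \<open>n T(A) \<le> n T(a n) \<le> 1\<close>, impossible as \<open>T(A) > 0\<close>.\<close>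

lemma a_at_top: "filterlim a at_top sequentially"
  unfolding filterlim_at_top
proof
  fix A :: real
  obtain k where k: "1 / tail A < real k" using reals_Archimedean2 by blast
  show "\<forall>\<^sub>F n in sequentially. A \<le> a n"
    using normalization eventually_ge_at_top[of k]
  proof eventually_elim
    case (elim n)
    show ?case
    proof (rule ccontr)
      assume "\<not> A \<le> a n"
      then have "real n * tail A \<le> real n * tail (a n)" by (intro mult_left_mono tail_mono) auto
      also have "\<dots> \<le> 1" using elim trunc_moment_nonneg[of "a n"] by (smt (verit) mult_nonneg_nonneg of_nat_0_le_iff divide_nonneg_nonneg zero_le_power2)
      finally have "real n \<le> 1 / tail A" using tail_pos[of A] by (simp add: field_simps)
      then show False using k elim by linarith
    qed
  qed
qed

lemma a_pos: "\<forall>\<^sub>F n in sequentially. 0 < a n"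
  using normalization by eventually_elim simp

lemma n_tail: "(\<lambda>n. real n * tail (a n)) \<longlonglongrightarrow> 0"
proof (rule tendsto_sandwich[where f = "\<lambda>_. 0"])
  show "(\<lambda>n. (a n)\<^sup>2 * tail (a n) / trunc_moment (a n)) \<longlonglongrightarrow> 0"
    by (rule filterlim_compose[OF square_tail_negligible a_at_top])
  show "\<forall>\<^sub>F n in sequentially. real n * tail (a n) \<le> (a n)\<^sup>2 * tail (a n) / trunc_moment (a n)"
    using normalization eventually_compose_filterlim[OF trunc_moment_pos a_at_top]
  proof eventually_elim
    case (elim n)
    have "real n / (a n)\<^sup>2 * trunc_moment (a n) \<le> 1" using elim(1) tail_nonneg[of "a n"] by (smt (verit) mult_nonneg_nonneg of_nat_0_le_iff)
    then have "real n \<le> (a n)\<^sup>2 / trunc_moment (a n)" using elim by (simp add: field_simps)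
    then have "real n * tail (a n) \<le> (a n)\<^sup>2 / trunc_moment (a n) * tail (a n)"
      by (rule mult_right_mono) simp
    then show ?case by simp
  qed
qed auto

lemma n_moment: "(\<lambda>n. real n / (a n)\<^sup>2 * trunc_moment (a n)) \<longlonglongrightarrow> 1"
proof (rule Lim_transform_eventually)
  show "(\<lambda>n. 1 - real n * tail (a n)) \<longlonglongrightarrow> 1"
    using tendsto_diff[OF tendsto_const n_tail, of 1] by simp
  show "\<forall>\<^sub>F n in sequentially. 1 - real n * tail (a n) = real n / (a n)\<^sup>2 * trunc_moment (a n)"
    using normalization by eventually_elim simp
qed

definition scaled :: "nat \<Rightarrow> real \<Rightarrow> real" where
  "scaled n z = trunc (a n) z / a n"

abbreviation scaled_mean :: "nat \<Rightarrow> real" where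
  "scaled_mean n \<equiv> expectation (\<lambda>\<omega>. scaled n (X 0 \<omega>))"

abbreviation scaled_third :: "nat \<Rightarrow> real" where
  "scaled_third n \<equiv> expectation (\<lambda>\<omega>. \<bar>scaled n (X 0 \<omega>)\<bar>^3)"

definition scaled_moment :: "nat \<Rightarrow> real" where
  "scaled_moment n = expectation (\<lambda>\<omega>. (scaled n (X 0 \<omega>))\<^sup>2)"

lemma scaled_measurable [measurable]: "scaled n \<in> borel_measurable borel"
  unfolding scaled_def by measurable

lemma abs_scaled_le_1: "\<bar>scaled n z\<bar> \<le> 1"
  by (auto simp: scaled_def trunc_def divide_le_eq)

lemma integrable_scaled_product: "integrable M (\<lambda>\<omega>. scaled n (X s \<omega>) * scaled n (X t \<omega>))"
proof (rule integrable_const_bound[where B = 1])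
  show "AE \<omega> in M. norm (scaled n (X s \<omega>) * scaled n (X t \<omega>)) \<le> 1"
    using mult_mono[OF abs_scaled_le_1 abs_scaled_le_1] by (auto simp: abs_mult)
qed simp

lemma integrable_scaled: "integrable M (\<lambda>\<omega>. scaled n (X t \<omega>))"
  by (rule integrable_const_bound[where B = 1]) (auto simp: abs_scaled_le_1)

lemma scaled_moment_eq: "scaled_moment n = trunc_moment (a n) / (a n)\<^sup>2"
  by (simp add: scaled_moment_def scaled_def trunc_moment_def power_divide)

lemma n_scaled_moment: "(\<lambda>n. real n * scaled_moment n) \<longlonglongrightarrow> 1"
  using n_moment by (simp add: scaled_moment_eq)

lemma scaled_moment_nonneg: "0 \<le> scaled_moment n"
  by (simp add: scaled_moment_def)

lemma scaled_moment_tendsto_0: "scaled_moment \<longlonglongrightarrow> 0"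
proof (rule Lim_transform_eventually)
  show "(\<lambda>n. real n * scaled_moment n * (1 / real n)) \<longlonglongrightarrow> 0"
    using tendsto_mult[OF n_scaled_moment lim_1_over_n] by simp
  show "\<forall>\<^sub>F n in sequentially. real n * scaled_moment n * (1 / real n) = scaled_moment n"
    using eventually_gt_at_top[of 0] by eventually_elim simp
qed

lemma n_truncation_error: "(\<lambda>n. real n * (mean_excess (a n) / a n)) \<longlonglongrightarrow> 0"
proof (rule tendsto_sandwich[where f = "\<lambda>_. 0"])
  show "(\<lambda>n. 6 * (real n * tail (a n))) \<longlonglongrightarrow> 0"
    using tendsto_mult[OF tendsto_const n_tail, of 6] by simp
  show "\<forall>\<^sub>F n in sequentially. real n * (mean_excess (a n) / a n) \<le> 6 * (real n * tail (a n))"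
    using a_pos eventually_compose_filterlim[OF first_moment_tail a_at_top]
  proof eventually_elim
    case (elim n)
    then have "mean_excess (a n) / a n \<le> 6 * tail (a n)"
      by (simp add: field_simps)
    then have "real n * (mean_excess (a n) / a n) \<le> real n * (6 * tail (a n))"
      by (rule mult_left_mono) simp
    then show ?case by simp
  qed
  show "\<forall>\<^sub>F n in sequentially. 0 \<le> real n * (mean_excess (a n) / a n)"
    using a_pos by eventually_elim (simp add: mean_excess_def)
qed auto

lemma n_scaled_third: "(\<lambda>n. real n * scaled_third n) \<longlonglongrightarrow> 0"
proof (rule Lim_transform_eventually)
  let ?E = "\<lambda>x. expectation (\<lambda>\<omega>. \<bar>trunc x (X 0 \<omega>)\<bar>^3)"
  show "(\<lambda>n. ?E (a n) / (a n * trunc_moment (a n)) * (real n / (a n)\<^sup>2 * trunc_moment (a n))) \<longlonglongrightarrow> 0"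
    using tendsto_mult[OF filterlim_compose[OF third_moment_negligible a_at_top] n_moment] by simp
  show "\<forall>\<^sub>F n in sequentially. ?E (a n) / (a n * trunc_moment (a n)) * (real n / (a n)\<^sup>2 * trunc_moment (a n))
      = real n * scaled_third n"
    using a_pos eventually_compose_filterlim[OF trunc_moment_pos a_at_top]
  proof eventually_elim
    case (elim n)
    have "scaled_third n = ?E (a n) / (a n)^3"
      using elim by (simp add: scaled_def power_divide)
    moreover have "e / (a n * K) * (real n / (a n)\<^sup>2 * K) = real n * (e / (a n)^3)" if "0 < K" for e K
      using elim that by (simp add: power3_eq_cube power2_eq_square mult_ac)
    ultimately show ?case using elim by simp
  qed
qed

text \<open>As \<open>X\<^sub>0\<close> is centred, the mean of its truncation is minus the mean of the part cut off.\<close>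

lemma n_scaled_mean:
  assumes mean: "expectation (X 0) = 0"
  shows "(\<lambda>n. real n * scaled_mean n) \<longlonglongrightarrow> 0"
proof (rule tendsto_rabs_zero_cancel, rule tendsto_sandwich[where f = "\<lambda>_. 0", OF _ _ _ n_truncation_error])
  show "\<forall>\<^sub>F n in sequentially. \<bar>real n * scaled_mean n\<bar>
      \<le> real n * (mean_excess (a n) / a n)"
    using a_pos
  proof eventually_elim
    case (elim n)
    have int: "integrable M (\<lambda>\<omega>. trunc (a n) (X 0 \<omega>))" using integrable_trunc_power[of "a n" 1] by simp
    have "\<bar>expectation (\<lambda>\<omega>. trunc (a n) (X 0 \<omega>))\<bar> = \<bar>expectation (\<lambda>\<omega>. X 0 \<omega> - trunc (a n) (X 0 \<omega>))\<bar>"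
      using int integrable_Z mean by simp
    also have "\<dots> \<le> mean_excess (a n)"
      unfolding mean_excess_def by (rule integral_abs_bound)
    finally show ?case using elim by (simp add: scaled_def abs_mult mult_left_mono divide_right_mono)
  qed
qed auto

definition part_sum :: "nat \<Rightarrow> int set \<Rightarrow> 'a \<Rightarrow> real" where
  "part_sum n I \<omega> = (\<Sum>t\<in>I. scaled n (X t \<omega>))"

lemma part_sum_measurable [measurable]: "part_sum n I \<in> borel_measurable M"
  unfolding part_sum_def[abs_def] by measurable

lemma scaled_sum_approx:
  "(\<lambda>n. expectation (\<lambda>\<omega>. \<bar>(\<Sum>t = 1..n. X (int t) \<omega>) / a n - part_sum n {1..int n} \<omega>\<bar>)) \<longlonglongrightarrow> 0"
proof (rule tendsto_sandwich[where f = "\<lambda>_. 0", OF _ _ _ n_truncation_error])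
  show "\<forall>\<^sub>F n in sequentially. expectation (\<lambda>\<omega>. \<bar>(\<Sum>t = 1..n. X (int t) \<omega>) / a n - part_sum n {1..int n} \<omega>\<bar>)
      \<le> real n * (mean_excess (a n) / a n)"
    using a_pos
  proof eventually_elim
    case (elim n)
    have int: "integrable M (\<lambda>\<omega>. \<bar>X t \<omega> - trunc (a n) (X t \<omega>)\<bar>)" for t
    proof (rule integrable_marginal[where f = "\<lambda>z. \<bar>z - trunc (a n) z\<bar>"])
      show "integrable M (\<lambda>\<omega>. \<bar>X 0 \<omega> - trunc (a n) (X 0 \<omega>)\<bar>)"
        using integrable_trunc_power[of "a n" 1] integrable_Z by simp
    qed measurable
    have ints: "integrable M (\<lambda>\<omega>. X t \<omega>)" for t
      using integrable_Z integrable_marginal[of "\<lambda>z. z" t] by simp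
    have "(\<Sum>t = 1..n. X (int t) \<omega>) / a n - part_sum n {1..int n} \<omega>
        = (\<Sum>t\<in>{1..int n}. (X t \<omega> - trunc (a n) (X t \<omega>)) / a n)" for \<omega>
    proof -
      have "(\<Sum>t = 1..n. X (int t) \<omega>) = (\<Sum>t\<in>{1..int n}. X t \<omega>)"
        by (rule sum.reindex_bij_witness[where i = nat and j = int]) auto
      then show ?thesis
        by (simp add: part_sum_def scaled_def sum_subtractf[symmetric] sum_divide_distrib diff_divide_distrib)
    qed
    moreover have "\<bar>\<Sum>t\<in>{1..int n}. (X t \<omega> - trunc (a n) (X t \<omega>)) / a n\<bar>
        \<le> (\<Sum>t\<in>{1..int n}. \<bar>X t \<omega> - trunc (a n) (X t \<omega>)\<bar> / a n)" for \<omega>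
      using elim by (intro order_trans[OF sum_abs]) simp
    ultimately have "expectation (\<lambda>\<omega>. \<bar>(\<Sum>t = 1..n. X (int t) \<omega>) / a n - part_sum n {1..int n} \<omega>\<bar>)
        \<le> expectation (\<lambda>\<omega>. \<Sum>t\<in>{1..int n}. \<bar>X t \<omega> - trunc (a n) (X t \<omega>)\<bar> / a n)"
      using int ints elim
      by (intro integral_mono') (auto intro!: sum_nonneg)
    also have "\<dots> = (\<Sum>t\<in>{1..int n}. expectation (\<lambda>\<omega>. \<bar>X t \<omega> - trunc (a n) (X t \<omega>)\<bar>) / a n)"
      using int by simp
    also have "\<dots> = (\<Sum>t\<in>{1..int n}. mean_excess (a n) / a n)"
      unfolding mean_excess_def by (intro sum.cong refl arg_cong2[where f = "(/)"]
          expectation_marginal[where f = "\<lambda>z. \<bar>z - trunc (a n) z\<bar>"]) measurable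
    also have "\<dots> = real n * (mean_excess (a n) / a n)" by simp
    finally show ?case .
  qed
qed auto

lemma expectation_scaled_product:
  "expectation (\<lambda>\<omega>. scaled n (X s \<omega>) * scaled n (X t \<omega>))
   = expectation (\<lambda>\<omega>. scaled n (X 0 \<omega>) * scaled n (X (t - s) \<omega>))"
  using expectation_shift[of "\<lambda>z. scaled n (z 0) * scaled n (z (t - s))" s] by simp

lemma abs_expectation_scaled_product: "\<bar>expectation (\<lambda>\<omega>. scaled n (X s \<omega>) * scaled n (X t \<omega>))\<bar> \<le> scaled_moment n"
proof -
  have sq: "integrable M (\<lambda>\<omega>. (scaled n (X t \<omega>))\<^sup>2)" for t
    using integrable_scaled_product[of n t t] by (simp add: power2_eq_square)
  have E: "expectation (\<lambda>\<omega>. (scaled n (X t \<omega>))\<^sup>2) = scaled_moment n" for t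
    unfolding scaled_moment_def by (rule expectation_marginal[where f = "\<lambda>z. (scaled n z)\<^sup>2"]) measurable
  have "\<bar>expectation (\<lambda>\<omega>. scaled n (X s \<omega>) * scaled n (X t \<omega>))\<bar>
      \<le> expectation (\<lambda>\<omega>. \<bar>scaled n (X s \<omega>) * scaled n (X t \<omega>)\<bar>)"
    by (rule integral_abs_bound)
  also have "\<dots> \<le> expectation (\<lambda>\<omega>. (scaled n (X s \<omega>))\<^sup>2 / 2 + (scaled n (X t \<omega>))\<^sup>2 / 2)"
  proof (intro integral_mono integrable_abs integrable_scaled_product)
    have "\<bar>x * y\<bar> \<le> x\<^sup>2 / 2 + y\<^sup>2 / 2" for x y :: real
      using sum_squares_bound[of "\<bar>x\<bar>" "\<bar>y\<bar>"] by (simp add: abs_mult)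
    then show "\<bar>scaled n (X s \<omega>) * scaled n (X t \<omega>)\<bar> \<le> (scaled n (X s \<omega>))\<^sup>2 / 2 + (scaled n (X t \<omega>))\<^sup>2 / 2" for \<omega> .
  qed (use sq in simp)
  also have "\<dots> = scaled_moment n" using sq by (simp add: E)
  finally show ?thesis .
qed

text \<open>Each index has at most \<open>2 m + 1\<close> neighbours with which it is correlated; all other products have
  expectation equal to the squared mean.\<close>

lemma part_sum_L1:
  assumes "finite I"
  shows "expectation (\<lambda>\<omega>. \<bar>part_sum n I \<omega>\<bar>)
    \<le> sqrt (real (card I) * (real (2 * m + 1) * scaled_moment n)
        + (real (card I) * scaled_mean n)\<^sup>2)"
proof (rule real_le_rsqrt)
  define \<mu> where "\<mu> = scaled_mean n"
  let ?c = "\<lambda>s t. expectation (\<lambda>\<omega>. scaled n (X s \<omega>) * scaled n (X t \<omega>))"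
  have sq: "(part_sum n I \<omega>)\<^sup>2 = (\<Sum>s\<in>I. \<Sum>t\<in>I. scaled n (X s \<omega>) * scaled n (X t \<omega>))" for \<omega>
    by (simp add: part_sum_def power2_eq_square sum_product)
  have int1: "integrable M (part_sum n I)" unfolding part_sum_def[abs_def] using integrable_scaled by simp
  have int2: "integrable M (\<lambda>\<omega>. (part_sum n I \<omega>)\<^sup>2)" unfolding sq using integrable_scaled_product by simp
  have "0 \<le> expectation (\<lambda>\<omega>. (\<bar>part_sum n I \<omega>\<bar> - expectation (\<lambda>\<omega>. \<bar>part_sum n I \<omega>\<bar>))\<^sup>2)" by simp
  also have "\<dots> = expectation (\<lambda>\<omega>. (part_sum n I \<omega>)\<^sup>2) - (expectation (\<lambda>\<omega>. \<bar>part_sum n I \<omega>\<bar>))\<^sup>2"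
    using int1 int2 by (subst variance_eq) auto
  finally have "(expectation (\<lambda>\<omega>. \<bar>part_sum n I \<omega>\<bar>))\<^sup>2 \<le> expectation (\<lambda>\<omega>. (part_sum n I \<omega>)\<^sup>2)" by simp
  also have "\<dots> = (\<Sum>s\<in>I. \<Sum>t\<in>I. ?c s t)"
    unfolding sq using integrable_scaled_product by simp
  also have "\<dots> \<le> (\<Sum>s\<in>I. real (2 * m + 1) * scaled_moment n + real (card I) * \<mu>\<^sup>2)"
  proof (rule sum_mono)
    fix s assume "s \<in> I"
    have "(\<Sum>t\<in>I. ?c s t) \<le> (\<Sum>t\<in>I. (if t \<in> {s - int m..s + int m} then scaled_moment n else 0) + \<mu>\<^sup>2)"
    proof (rule sum_mono)
      fix t
      show "?c s t \<le> (if t \<in> {s - int m..s + int m} then scaled_moment n else 0) + \<mu>\<^sup>2"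
      proof (cases "t \<in> {s - int m..s + int m}")
        case True
        have "?c s t \<le> scaled_moment n" using abs_expectation_scaled_product[of n s t] by simp
        then show ?thesis using True by (simp add: add_increasing2)
      next
        case False
        then have "int m < \<bar>s - t\<bar>" by auto
        from indep_var_compose[OF indep_coordinates[OF this], of "scaled n" borel "scaled n" borel]
        have "?c s t = expectation (\<lambda>\<omega>. scaled n (X s \<omega>)) * expectation (\<lambda>\<omega>. scaled n (X t \<omega>))"
          by (intro indep_var_lebesgue_integral integrable_scaled) (simp add: comp_def)
        also have "\<dots> = \<mu>\<^sup>2"
          unfolding \<mu>_def expectation_marginal[OF scaled_measurable, of n s] expectation_marginal[OF scaled_measurable, of n t]
          by (simp add: power2_eq_square)
        finally show ?thesis using False by (simp only: if_False)
      qed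
    qed
    also have "\<dots> = (\<Sum>t\<in>I \<inter> {s - int m..s + int m}. scaled_moment n) + real (card I) * \<mu>\<^sup>2"
      by (simp add: sum.distrib sum.inter_restrict[OF assms] del: sum_constant) simp
    also have "(\<Sum>t\<in>I \<inter> {s - int m..s + int m}. scaled_moment n) \<le> (\<Sum>t\<in>{s - int m..s + int m}. scaled_moment n)"
      by (intro sum_mono2) (auto simp: scaled_moment_nonneg)
    also have "\<dots> = real (2 * m + 1) * scaled_moment n" by simp
    finally show "(\<Sum>t\<in>I. ?c s t) \<le> real (2 * m + 1) * scaled_moment n + real (card I) * \<mu>\<^sup>2" by simp
  qed
  also have "\<dots> = real (card I) * (real (2 * m + 1) * scaled_moment n) + (real (card I) * \<mu>)\<^sup>2"
    by (simp add: power2_eq_square algebra_simps)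
  finally show "(expectation (\<lambda>\<omega>. \<bar>part_sum n I \<omega>\<bar>))\<^sup>2
    \<le> real (card I) * (real (2 * m + 1) * scaled_moment n) + (real (card I) * scaled_mean n)\<^sup>2"
    by (simp add: \<mu>_def)
qed

text \<open>Block \<open>l\<close> is followed by a gap of \<open>m\<close> indices, which makes different blocks independent.\<close>

definition block :: "nat \<Rightarrow> nat \<Rightarrow> int set" where
  "block k l = {int (l * (k + m)) + 1..int (l * (k + m) + k)}"

text \<open>The first \<open>q\<close> blocks depend on the path up to \<open>q (k + m) - m\<close>, the next one on the path from
  \<open>q (k + m) + 1\<close> on.\<close>

lemma block_char_power:
  "expectation (\<lambda>\<omega>. iexp (\<theta> * (\<Sum>l<q. part_sum n (block k l) \<omega>)))
   = expectation (\<lambda>\<omega>. iexp (\<theta> * part_sum n {1..int k} \<omega>)) ^ q"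
proof (induction q)
  case 0
  then show ?case by (simp add: prob_space)
next
  case (Suc q)
  let ?U = "\<lambda>z :: int \<Rightarrow> real. \<Sum>l<q. \<Sum>t\<in>block k l. scaled n (z t)"
  let ?V = "\<lambda>z :: int \<Rightarrow> real. \<Sum>t\<in>block k q. scaled n (z t)"
  let ?s = "int (q * (k + m)) - int m" and ?u = "int (q * (k + m)) + 1"
  have past: "t \<le> ?s" if "l < q" "t \<in> block k l" for l t
  proof -
    have "Suc l * (k + m) \<le> q * (k + m)" using that by (intro mult_right_mono) auto
    then have "l * (k + m) + k + m \<le> q * (k + m)" by simp
    then have "int (l * (k + m) + k) + int m \<le> int (q * (k + m))" by (metis of_nat_add of_nat_le_iff)
    then show ?thesis using that(2) by (simp add: block_def)
  qed
  have future: "?u \<le> t" if "t \<in> block k q" for t using that by (simp add: block_def)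
  have "indep_var borel (\<lambda>\<omega>. iexp (\<theta> * ?U (\<lambda>i\<in>{..?s}. X i \<omega>))) borel (\<lambda>\<omega>. iexp (\<theta> * ?V (\<lambda>i\<in>{?u..}. X i \<omega>)))"
  proof (rule past_future_indep)
    have [measurable]: "(\<lambda>z. scaled n (z t)) \<in> borel_measurable (PiM {..?s} (\<lambda>_. borel))" if "l < q" "t \<in> block k l" for l t
    proof -
      have "(\<lambda>z. z t) \<in> measurable (PiM {..?s} (\<lambda>_. borel :: real measure)) borel"
        using past[OF that] by (intro measurable_component_singleton) simp
      then show ?thesis by (rule measurable_compose[OF _ scaled_measurable])
    qed
    show "(\<lambda>z. iexp (\<theta> * ?U z)) \<in> borel_measurable (PiM {..?s} (\<lambda>_. borel))" by measurable
    have [measurable]: "(\<lambda>z. scaled n (z t)) \<in> borel_measurable (PiM {?u..} (\<lambda>_. borel))" if "t \<in> block k q" for t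
    proof -
      have "(\<lambda>z. z t) \<in> measurable (PiM {?u..} (\<lambda>_. borel :: real measure)) borel"
        using future[OF that] by (intro measurable_component_singleton) simp
      then show ?thesis by (rule measurable_compose[OF _ scaled_measurable])
    qed
    show "(\<lambda>z. iexp (\<theta> * ?V z)) \<in> borel_measurable (PiM {?u..} (\<lambda>_. borel))" by measurable
  qed simp
  moreover have U: "?U (\<lambda>i\<in>{..?s}. X i \<omega>) = (\<Sum>l<q. part_sum n (block k l) \<omega>)" for \<omega>
    unfolding part_sum_def using past by (intro sum.cong refl) auto
  moreover have V: "?V (\<lambda>i\<in>{?u..}. X i \<omega>) = part_sum n (block k q) \<omega>" for \<omega>
    unfolding part_sum_def using future by (intro sum.cong refl) auto
  ultimately have ind: "indep_var borel (\<lambda>\<omega>. iexp (\<theta> * (\<Sum>l<q. part_sum n (block k l) \<omega>)))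
      borel (\<lambda>\<omega>. iexp (\<theta> * part_sum n (block k q) \<omega>))" by (simp only:)
  have "expectation (\<lambda>\<omega>. iexp (\<theta> * (\<Sum>l<Suc q. part_sum n (block k l) \<omega>)))
      = expectation (\<lambda>\<omega>. iexp (\<theta> * (\<Sum>l<q. part_sum n (block k l) \<omega>)) * iexp (\<theta> * part_sum n (block k q) \<omega>))"
    by (simp add: distrib_left exp_add)
  also have "\<dots> = expectation (\<lambda>\<omega>. iexp (\<theta> * (\<Sum>l<q. part_sum n (block k l) \<omega>)))
      * expectation (\<lambda>\<omega>. iexp (\<theta> * part_sum n (block k q) \<omega>))"
    by (intro indep_var_lebesgue_integral ind integrable_iexp) auto
  also have "expectation (\<lambda>\<omega>. iexp (\<theta> * part_sum n (block k q) \<omega>)) = expectation (\<lambda>\<omega>. iexp (\<theta> * part_sum n {1..int k} \<omega>))"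
  proof -
    let ?f = "\<lambda>z :: int \<Rightarrow> real. iexp (\<theta> * (\<Sum>t\<in>{1..int k}. scaled n (z t)))"
    have "part_sum n (block k q) \<omega> = (\<Sum>t\<in>{1..int k}. scaled n (X (t + int (q * (k + m))) \<omega>))" for \<omega>
      unfolding part_sum_def block_def
      by (rule sum.reindex_bij_witness[where i = "\<lambda>t. t + int (q * (k + m))" and j = "\<lambda>t. t - int (q * (k + m))"]) auto
    moreover have "?f \<in> borel_measurable (PiM UNIV (\<lambda>_. borel))" by measurable
    ultimately show ?thesis
      using expectation_shift[of ?f "int (q * (k + m))"] by (simp add: part_sum_def)
  qed
  finally show ?case by (simp only: Suc.IH power_Suc mult.commute)
qed

text \<open>For a fixed block length: replace the characteristic function of one block by that of the normal law
  with the same second moment. The number of blocks is at most \<open>n\<close>, so the accumulated error is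
  \<open>n\<close> times the sum of a mean, a third moment and the square of a second moment of the scaled
  variables, and each of these is \<open>o(1/n)\<close>. The length is \<open>Suc k\<close> so that blocks are nonempty.\<close>

lemma block_char_limit:
  assumes mean: "expectation (X 0) = 0"
  shows "(\<lambda>n. expectation (\<lambda>\<omega>. iexp (\<theta> * (\<Sum>l<n div (k + Suc m). part_sum n (block (Suc k) l) \<omega>))))
    \<longlonglongrightarrow> complex_of_real (exp (- (\<theta>\<^sup>2 * ((\<Sum>s\<in>{1..int (Suc k)}. \<Sum>t\<in>{1..int (Suc k)}. tail_autocov (t - s)) / real (Suc k + m)) / 2)))"
proof -
  let ?I = "{1..int (Suc k)}"
  let ?q = "\<lambda>n. n div (k + Suc m)"
  let ?B = "\<lambda>n. part_sum n ?I"
  define v where "v n = expectation (\<lambda>\<omega>. (?B n \<omega>)\<^sup>2)" for n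
  define V where "V = (\<Sum>s\<in>?I. \<Sum>t\<in>?I. tail_autocov (t - s))"
  have q_le: "real (?q n) \<le> real n" for n by simp
  have q_lim: "(\<lambda>n. real (?q n) / real n) \<longlonglongrightarrow> 1 / real (Suc k + m)"
  proof (rule tendsto_sandwich)
    let ?d = "real (Suc k + m)"
    show "\<forall>\<^sub>F n in sequentially. real (?q n) / real n \<le> 1 / ?d"
      using eventually_gt_at_top[of 0]
    proof eventually_elim
      case (elim n)
      have "real (?q n) \<le> real n / ?d" using of_nat_div_le_of_nat[of n "k + Suc m", where 'a = real] by simp
      then show ?case using elim by (simp add: field_simps)
    qed
    show "\<forall>\<^sub>F n in sequentially. 1 / ?d - 1 / real n \<le> real (?q n) / real n"
      using eventually_gt_at_top[of 0]
    proof eventually_elim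
      case (elim n)
      have "n < (?q n + 1) * (Suc k + m)" using dividend_less_div_times[of "k + Suc m" n] by simp
      then have "real n < real ((?q n + 1) * (Suc k + m))" by (simp only: of_nat_less_iff)
      then have "real n / ?d - 1 \<le> real (?q n)" by (simp add: field_simps)
      then have "(real n / ?d - 1) / real n \<le> real (?q n) / real n" by (rule divide_right_mono) simp
      then show ?case using elim by (simp add: diff_divide_distrib)
    qed
    show "(\<lambda>n. 1 / ?d - 1 / real n) \<longlonglongrightarrow> 1 / ?d"
      using tendsto_diff[OF tendsto_const lim_1_over_n] by simp
  qed simp
  have sq: "(?B n \<omega>)\<^sup>2 = (\<Sum>s\<in>?I. \<Sum>t\<in>?I. scaled n (X s \<omega>) * scaled n (X t \<omega>))" for n \<omega>
    by (simp add: part_sum_def power2_eq_square sum_product)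
  have v_eq: "v n = (\<Sum>s\<in>?I. \<Sum>t\<in>?I. expectation (\<lambda>\<omega>. scaled n (X 0 \<omega>) * scaled n (X (t - s) \<omega>)))" for n
    unfolding v_def sq using integrable_scaled_product by (simp add: expectation_scaled_product[symmetric])
  have v_lim: "(\<lambda>n. real n * v n) \<longlonglongrightarrow> V"
    unfolding v_eq V_def sum_distrib_left
  proof (intro tendsto_sum)
    fix s t :: int
    let ?h = "t - s"
    have "(\<lambda>n. expectation (\<lambda>\<omega>. trunc (a n) (X 0 \<omega>) * trunc (a n) (X ?h \<omega>)) / trunc_moment (a n)
        * (real n / (a n)\<^sup>2 * trunc_moment (a n))) \<longlonglongrightarrow> tail_autocov ?h * 1"
      unfolding tail_autocov_def
      by (intro tendsto_mult n_moment filterlim_compose[OF autocovariance_limit a_at_top])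
    moreover have "\<forall>\<^sub>F n in sequentially. expectation (\<lambda>\<omega>. trunc (a n) (X 0 \<omega>) * trunc (a n) (X ?h \<omega>)) / trunc_moment (a n)
        * (real n / (a n)\<^sup>2 * trunc_moment (a n)) = real n * expectation (\<lambda>\<omega>. scaled n (X 0 \<omega>) * scaled n (X ?h \<omega>))"
      using a_pos eventually_compose_filterlim[OF trunc_moment_pos a_at_top]
      by eventually_elim (simp add: scaled_def power2_eq_square)
    ultimately show "(\<lambda>n. real n * expectation (\<lambda>\<omega>. scaled n (X 0 \<omega>) * scaled n (X ?h \<omega>))) \<longlonglongrightarrow> tail_autocov ?h"
      by (simp add: Lim_transform_eventually)
  qed
  have v_nonneg: "0 \<le> v n" for n by (simp add: v_def)
  have v_0: "v \<longlonglongrightarrow> 0"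
  proof (rule Lim_transform_eventually)
    show "(\<lambda>n. real n * v n * (1 / real n)) \<longlonglongrightarrow> 0"
      using tendsto_mult[OF v_lim lim_1_over_n] by simp
    show "\<forall>\<^sub>F n in sequentially. real n * v n * (1 / real n) = v n"
      using eventually_gt_at_top[of 0] by eventually_elim simp
  qed
  have qv: "(\<lambda>n. real (?q n) * v n) \<longlonglongrightarrow> V / real (Suc k + m)"
  proof (rule Lim_transform_eventually)
    show "(\<lambda>n. real (?q n) / real n * (real n * v n)) \<longlonglongrightarrow> V / real (Suc k + m)"
      using tendsto_mult[OF q_lim v_lim] by simp
    show "\<forall>\<^sub>F n in sequentially. real (?q n) / real n * (real n * v n) = real (?q n) * v n"
      using eventually_gt_at_top[of 0] by eventually_elim simp
  qed
  let ?\<phi> = "\<lambda>n. expectation (\<lambda>\<omega>. iexp (\<theta> * ?B n \<omega>))"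
  let ?e = "\<lambda>n. complex_of_real (exp (- (\<theta>\<^sup>2 * v n / 2)))"
  define r where "r n = \<bar>\<theta>\<bar> * (real (Suc k) * \<bar>real n * scaled_mean n\<bar>)
     + \<bar>\<theta>\<bar>^3 * (real (Suc k)^4 * (real n * scaled_third n))
     + (\<theta>\<^sup>2 / 2)\<^sup>2 * (real n * v n * v n)" for n
  have r_lim: "r \<longlonglongrightarrow> 0"
  proof -
    have "r \<longlonglongrightarrow> \<bar>\<theta>\<bar> * (real (Suc k) * \<bar>0\<bar>) + \<bar>\<theta>\<bar>^3 * (real (Suc k)^4 * 0) + (\<theta>\<^sup>2 / 2)\<^sup>2 * (V * 0)"
      unfolding r_def by (intro tendsto_intros n_scaled_mean[OF mean] n_scaled_third v_lim v_0)
    then show ?thesis by simp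
  qed
  have est: "cmod (?\<phi> n ^ ?q n - ?e n ^ ?q n) \<le> r n" for n
  proof -
    have B_bound: "\<bar>?B n \<omega>\<bar> \<le> real (Suc k)" for \<omega>
      unfolding part_sum_def using sum_bounded_above[of ?I "\<lambda>t. \<bar>scaled n (X t \<omega>)\<bar>" 1] abs_scaled_le_1
      by (intro order_trans[OF sum_abs]) simp
    have EB: "expectation (?B n) = real (Suc k) * scaled_mean n"
    proof -
      have "expectation (?B n) = (\<Sum>t\<in>?I. expectation (\<lambda>\<omega>. scaled n (X t \<omega>)))"
        unfolding part_sum_def[abs_def] using integrable_scaled by simp
      also have "\<dots> = (\<Sum>t\<in>?I. scaled_mean n)"
        by (intro sum.cong refl expectation_marginal[OF scaled_measurable])
      finally show ?thesis by simp
    qed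
    have i3: "integrable M (\<lambda>\<omega>. \<bar>scaled n (X t \<omega>)\<bar>^3)" for t
      by (rule integrable_const_bound[where B = 1]) (auto simp: abs_scaled_le_1 power_le_one)
    have EB3: "expectation (\<lambda>\<omega>. \<bar>?B n \<omega>\<bar>^3) \<le> real (Suc k)^4 * scaled_third n"
    proof -
      have "\<bar>?B n \<omega>\<bar>^3 \<le> real (Suc k)^3 * (\<Sum>t\<in>?I. \<bar>scaled n (X t \<omega>)\<bar>^3)" for \<omega>
        using abs_sum_cube_le[of ?I "\<lambda>t. scaled n (X t \<omega>)"] by (simp add: part_sum_def add.commute)
      then have "expectation (\<lambda>\<omega>. \<bar>?B n \<omega>\<bar>^3) \<le> expectation (\<lambda>\<omega>. real (Suc k)^3 * (\<Sum>t\<in>?I. \<bar>scaled n (X t \<omega>)\<bar>^3))"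
        using i3 by (intro integral_mono') (auto intro!: mult_nonneg_nonneg sum_nonneg)
      also have "\<dots> = real (Suc k)^3 * (\<Sum>t\<in>?I. expectation (\<lambda>\<omega>. \<bar>scaled n (X t \<omega>)\<bar>^3))"
        using i3 by simp
      also have "\<dots> = real (Suc k)^4 * scaled_third n"
      proof -
        have "(\<Sum>t\<in>?I. expectation (\<lambda>\<omega>. \<bar>scaled n (X t \<omega>)\<bar>^3)) = (\<Sum>t\<in>?I. scaled_third n)"
          by (intro sum.cong refl expectation_marginal[where f = "\<lambda>z. \<bar>scaled n z\<bar>^3"]) measurable
        then show ?thesis by (simp add: power4_eq_xxxx power3_eq_cube)
      qed
      finally show ?thesis .
    qed
    have "cmod (?\<phi> n ^ ?q n - ?e n ^ ?q n) \<le> real (?q n) * cmod (?\<phi> n - ?e n)"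
    proof (rule norm_power_diff)
      have "cmod (?\<phi> n) \<le> expectation (\<lambda>\<omega>. cmod (iexp (\<theta> * ?B n \<omega>)))" by (rule integral_norm_bound)
      then show "cmod (?\<phi> n) \<le> 1" by (simp add: prob_space)
      show "cmod (?e n) \<le> 1" unfolding norm_of_real using v_nonneg[of n] by simp
    qed
    also have "\<dots> \<le> real n * (\<bar>\<theta>\<bar> * \<bar>expectation (?B n)\<bar> + \<bar>\<theta>\<bar>^3 * expectation (\<lambda>\<omega>. \<bar>?B n \<omega>\<bar>^3) + (\<theta>\<^sup>2 * v n / 2)\<^sup>2)"
      using char_second_order[OF part_sum_measurable B_bound, of \<theta>] unfolding v_def
      by (intro mult_mono q_le) auto
    also have "\<dots> \<le> real n * (\<bar>\<theta>\<bar> * \<bar>expectation (?B n)\<bar>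
        + \<bar>\<theta>\<bar>^3 * (real (Suc k)^4 * scaled_third n) + (\<theta>\<^sup>2 * v n / 2)\<^sup>2)"
      using EB3 by (intro mult_left_mono add_mono) auto
    also have "\<dots> = r n"
      unfolding EB r_def abs_mult by (simp add: algebra_simps power2_eq_square)
    finally show ?thesis .
  qed
  have "(\<lambda>n. ?\<phi> n ^ ?q n - ?e n ^ ?q n) \<longlonglongrightarrow> 0"
    by (rule Lim_null_comparison[OF _ r_lim]) (use est in simp)
  moreover have "(\<lambda>n. ?e n ^ ?q n) \<longlonglongrightarrow> complex_of_real (exp (- (\<theta>\<^sup>2 * (V / real (Suc k + m)) / 2)))"
  proof -
    have "?e n ^ ?q n = complex_of_real (exp (- (\<theta>\<^sup>2 * (real (?q n) * v n) / 2)))" for n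
      by (simp add: of_real_power[symmetric] exp_of_nat_mult[symmetric] algebra_simps del: of_real_power)
    moreover have "(\<lambda>n. complex_of_real (exp (- (\<theta>\<^sup>2 * (real (?q n) * v n) / 2))))
        \<longlonglongrightarrow> complex_of_real (exp (- (\<theta>\<^sup>2 * (V / real (Suc k + m)) / 2)))"
      by (intro tendsto_intros qv) simp
    ultimately show ?thesis by simp
  qed
  ultimately have "(\<lambda>n. (?\<phi> n ^ ?q n - ?e n ^ ?q n) + ?e n ^ ?q n)
      \<longlonglongrightarrow> 0 + complex_of_real (exp (- (\<theta>\<^sup>2 * (V / real (Suc k + m)) / 2)))"
    by (rule tendsto_add)
  then have "(\<lambda>n. ?\<phi> n ^ ?q n) \<longlonglongrightarrow> complex_of_real (exp (- (\<theta>\<^sup>2 * (V / real (Suc k + m)) / 2)))"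
    by simp
  then show ?thesis unfolding block_char_power V_def .
qed


text \<open>All gaps together with the incomplete last block.\<close>

definition remainder :: "nat \<Rightarrow> nat \<Rightarrow> int set" where
  "remainder k n = {1..int n} - (\<Union>l<n div (k + m). block k l)"

lemma block_subset:
  assumes "l < n div (k + m)"
  shows "block k l \<subseteq> {1..int n}"
proof -
  have "Suc l * (k + m) \<le> n div (k + m) * (k + m)" using assms by (intro mult_right_mono) auto
  also have "\<dots> \<le> n" by simp
  finally have "l * (k + m) + k \<le> n" by simp
  then have "int (l * (k + m) + k) \<le> int n" by (simp only: of_nat_le_iff)
  moreover have "0 \<le> int (l * (k + m))" by (simp only: of_nat_0_le_iff)
  ultimately show ?thesis unfolding block_def by (intro subsetI) (simp only: atLeastAtMost_iff, linarith)
qed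

lemma block_disjoint:
  assumes "l \<noteq> l'"
  shows "block k l \<inter> block k l' = {}"
proof -
  have *: "block k l \<inter> block k l' = {}" if "l < l'" for l l'
  proof -
    have "Suc l * (k + m) \<le> l' * (k + m)" using that by (intro mult_right_mono) auto
    then have "l * (k + m) + k \<le> l' * (k + m)" by simp
    then have "int (l * (k + m) + k) \<le> int (l' * (k + m))" by (simp only: of_nat_le_iff)
    then show ?thesis unfolding block_def by (auto simp del: of_nat_add of_nat_mult)
  qed
  from assms show ?thesis using *[of l l'] *[of l' l] by (cases "l < l'") auto
qed

lemma card_block: "card (block k l) = k"
  by (simp add: block_def)

lemma finite_block: "finite (block k l)"
  by (simp add: block_def)

lemma card_remainder:
  "card (remainder k n) + n div (k + m) * k = n"
proof -
  let ?U = "\<Union>l<n div (k + m). block k l"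
  have "card ?U = (\<Sum>l<n div (k + m). card (block k l))"
    by (intro card_UN_disjoint ballI impI block_disjoint) (auto simp: finite_block)
  also have "\<dots> = n div (k + m) * k" by (simp add: card_block)
  finally have U: "card ?U = n div (k + m) * k" .
  have sub: "?U \<subseteq> {1..int n}" using block_subset by blast
  have "card (remainder k n) = card {1..int n} - card ?U"
    unfolding remainder_def using sub by (intro card_Diff_subset) (auto intro: finite_subset)
  moreover have "card ?U \<le> card {1..int n}" using sub by (intro card_mono) auto
  ultimately show ?thesis unfolding U by simp
qed

lemma card_remainder_le:
  assumes "0 < k"
  shows "real (card (remainder k n)) \<le> real n * real m / real (k + m) + real (k + m)"
proof -
  let ?q = "n div (k + m)"
  have "n < (?q + 1) * (k + m)" using dividend_less_div_times[of "k + m" n] assms by simp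
  then have "card (remainder k n) \<le> ?q * m + (k + m)"
    using card_remainder[of k n] by (simp add: algebra_simps)
  then have "real (card (remainder k n)) \<le> real (?q * m + (k + m))" by (simp only: of_nat_le_iff)
  also have "\<dots> = real ?q * real m + real (k + m)" by simp
  also have "real ?q * real m \<le> real n / real (k + m) * real m"
    by (intro mult_right_mono of_nat_div_le_of_nat) simp
  finally show ?thesis by simp
qed

lemma part_sum_split:
  "part_sum n {1..int n} \<omega> = (\<Sum>l<n div (k + m). part_sum n (block k l) \<omega>) + part_sum n (remainder k n) \<omega>"
proof -
  let ?U = "\<Union>l<n div (k + m). block k l"
  have "?U \<subseteq> {1..int n}" using block_subset by blast
  then have "part_sum n {1..int n} \<omega> = part_sum n (remainder k n) \<omega> + part_sum n ?U \<omega>"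
    unfolding part_sum_def remainder_def by (intro sum.subset_diff) auto
  also have "part_sum n ?U \<omega> = (\<Sum>l<n div (k + m). part_sum n (block k l) \<omega>)"
    unfolding part_sum_def
    by (intro sum.UNION_disjoint ballI impI block_disjoint) (auto simp: finite_block)
  finally show ?thesis by simp
qed

lemma remainder_L1_limit:
  assumes mean: "expectation (X 0) = 0" and k: "0 < k"
  obtains u where "\<And>n. expectation (\<lambda>\<omega>. \<bar>part_sum n (remainder k n) \<omega>\<bar>) \<le> u n"
    "u \<longlonglongrightarrow> sqrt (real m * real (2 * m + 1) / real (k + m))"
proof
  let ?\<mu> = "\<lambda>n. scaled_mean n"
  let ?C = "real (2 * m + 1)" and ?d = "real (k + m)"
  define u where "u n = sqrt (real m / ?d * ?C * (real n * scaled_moment n)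
     + ?d * ?C * scaled_moment n + \<bar>real n * ?\<mu> n\<bar>\<^sup>2)" for n
  have "u \<longlonglongrightarrow> sqrt (real m / ?d * ?C * 1 + ?d * ?C * 0 + \<bar>0\<bar>\<^sup>2)"
    unfolding u_def
    by (intro tendsto_intros n_scaled_moment scaled_moment_tendsto_0 n_scaled_mean[OF mean])
  then show "u \<longlonglongrightarrow> sqrt (real m * ?C / ?d)" by simp
  show "expectation (\<lambda>\<omega>. \<bar>part_sum n (remainder k n) \<omega>\<bar>) \<le> u n" for n
  proof -
    let ?r = "real (card (remainder k n))"
    have fin: "finite (remainder k n)" by (simp add: remainder_def)
    have "?r * (?C * scaled_moment n) \<le> (real n * real m / ?d + ?d) * (?C * scaled_moment n)"
      by (intro mult_right_mono card_remainder_le k mult_nonneg_nonneg scaled_moment_nonneg) simp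
    moreover have "(?r * ?\<mu> n)\<^sup>2 \<le> \<bar>real n * ?\<mu> n\<bar>\<^sup>2"
    proof -
      have "card (remainder k n) \<le> n" using card_remainder[of k n] by simp
      then have "\<bar>?r * ?\<mu> n\<bar> \<le> \<bar>real n * ?\<mu> n\<bar>" unfolding abs_mult by (intro mult_right_mono) auto
      then show ?thesis by (simp only: power2_abs abs_le_square_iff)
    qed
    ultimately have "sqrt (?r * (?C * scaled_moment n) + (?r * ?\<mu> n)\<^sup>2)
        \<le> sqrt ((real n * real m / ?d + ?d) * (?C * scaled_moment n) + \<bar>real n * ?\<mu> n\<bar>\<^sup>2)"
      by (intro real_sqrt_le_mono add_mono)
    also have "(real n * real m / ?d + ?d) * (?C * scaled_moment n) + \<bar>real n * ?\<mu> n\<bar>\<^sup>2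
       = real m / ?d * ?C * (real n * scaled_moment n) + ?d * ?C * scaled_moment n + \<bar>real n * ?\<mu> n\<bar>\<^sup>2"
      by (simp only: distrib_right distrib_left times_divide_eq_left times_divide_eq_right mult_ac)
    finally show ?thesis using part_sum_L1[OF fin, of n] unfolding u_def by linarith
  qed
qed

text \<open>Fix a block length for which both the variance of a block, per index, is close to its limit and the
  remainder is small, and only then let \<open>n\<close> tend to infinity.\<close>

lemma char_limit:
  assumes mean: "expectation (X 0) = 0"
  shows "(\<lambda>n. expectation (\<lambda>\<omega>. iexp (\<theta> * ((\<Sum>t = 1..n. X (int t) \<omega>) / a n))))
    \<longlonglongrightarrow> complex_of_real (exp (- (N.expectation cluster_square * \<theta>\<^sup>2) / 2))"
proof (rule tendstoI)
  fix e :: real assume e: "0 < e"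
  let ?S = "\<lambda>n \<omega>. (\<Sum>t = 1..n. X (int t) \<omega>) / a n"
  let ?v = "\<lambda>k. (\<Sum>s\<in>{1..int k}. \<Sum>t\<in>{1..int k}. tail_autocov (t - s)) / real (k + m)"
  let ?L = "complex_of_real (exp (- (N.expectation cluster_square * \<theta>\<^sup>2) / 2))"
  let ?Lk = "\<lambda>k. complex_of_real (exp (- (\<theta>\<^sup>2 * ?v (Suc k) / 2)))"
  let ?\<rho> = "\<lambda>k. \<bar>\<theta>\<bar> * sqrt (real m * real (2 * m + 1) / real (Suc k + m))"
  have "(\<lambda>k. ?v (Suc k)) \<longlonglongrightarrow> N.expectation cluster_square"
    unfolding cluster_variance(2)
    by (rule LIMSEQ_Suc[OF block_variance_limit]) (rule tail_autocov_eq_0)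
  then have "?Lk \<longlonglongrightarrow> complex_of_real (exp (- (\<theta>\<^sup>2 * N.expectation cluster_square / 2)))"
    by (intro tendsto_intros) auto
  then have "?Lk \<longlonglongrightarrow> ?L" by (simp add: mult.commute)
  then have "\<forall>\<^sub>F k in sequentially. dist (?Lk k) ?L < e/4" by (rule tendstoD) (use e in simp)
  moreover have "?\<rho> \<longlonglongrightarrow> \<bar>\<theta>\<bar> * sqrt 0"
  proof (intro tendsto_intros)
    have "(\<lambda>k. real m * real (2 * m + 1) * (1 / real (k + Suc m))) \<longlonglongrightarrow> real m * real (2 * m + 1) * 0"
      by (intro tendsto_mult tendsto_const LIMSEQ_ignore_initial_segment[OF lim_1_over_n])
    then show "(\<lambda>k. real m * real (2 * m + 1) / real (Suc k + m)) \<longlonglongrightarrow> 0" by simp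
  qed
  then have "\<forall>\<^sub>F k in sequentially. ?\<rho> k < e/4" by (rule order_tendstoD) (use e in simp)
  ultimately have "\<forall>\<^sub>F k in sequentially. dist (?Lk k) ?L < e/4 \<and> ?\<rho> k < e/4" by eventually_elim simp
  then obtain k where k: "dist (?Lk k) ?L < e/4" "?\<rho> k < e/4"
    using eventually_happens'[OF sequentially_bot] by blast
  let ?Bs = "\<lambda>n \<omega>. \<Sum>l<n div (k + Suc m). part_sum n (block (Suc k) l) \<omega>"
  obtain u where u: "\<And>n. expectation (\<lambda>\<omega>. \<bar>part_sum n (remainder (Suc k) n) \<omega>\<bar>) \<le> u n"
    "u \<longlonglongrightarrow> sqrt (real m * real (2 * m + 1) / real (Suc k + m))"
    using remainder_L1_limit[OF mean, of "Suc k"] by blast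
  have [measurable]: "?S n \<in> borel_measurable M" for n by measurable
  have int: "integrable M (part_sum n I)" for n I
    unfolding part_sum_def[abs_def] using integrable_scaled by simp
  have intS: "integrable M (?S n)" for n
    using integrable_Z integrable_marginal[of "\<lambda>z. z"] by simp
  have rest: "cmod (expectation (\<lambda>\<omega>. iexp (\<theta> * part_sum n {1..int n} \<omega>)) - expectation (\<lambda>\<omega>. iexp (\<theta> * ?Bs n \<omega>)))
      \<le> \<bar>\<theta>\<bar> * u n" for n
  proof -
    have eq: "part_sum n {1..int n} \<omega> - ?Bs n \<omega> = part_sum n (remainder (Suc k) n) \<omega>" for \<omega>
      using part_sum_split[of n \<omega> "Suc k"] by simp
    have "cmod (expectation (\<lambda>\<omega>. iexp (\<theta> * part_sum n {1..int n} \<omega>)) - expectation (\<lambda>\<omega>. iexp (\<theta> * ?Bs n \<omega>)))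
      \<le> \<bar>\<theta>\<bar> * expectation (\<lambda>\<omega>. \<bar>part_sum n {1..int n} \<omega> - ?Bs n \<omega>\<bar>)"
      by (rule char_L1_bound) (use int in \<open>auto simp: eq\<close>)
    also have "\<dots> \<le> \<bar>\<theta>\<bar> * u n" unfolding eq by (intro mult_left_mono u) simp
    finally show ?thesis .
  qed
  have approx: "cmod (expectation (\<lambda>\<omega>. iexp (\<theta> * ?S n \<omega>)) - expectation (\<lambda>\<omega>. iexp (\<theta> * part_sum n {1..int n} \<omega>)))
      \<le> \<bar>\<theta>\<bar> * expectation (\<lambda>\<omega>. \<bar>?S n \<omega> - part_sum n {1..int n} \<omega>\<bar>)" for n
    by (intro char_L1_bound Bochner_Integration.integrable_diff int intS) auto
  have "\<forall>\<^sub>F n in sequentially. \<bar>\<theta>\<bar> * u n < e/4"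
    using k(2) by (intro order_tendstoD(2)[OF tendsto_mult[OF tendsto_const u(2)]])
  moreover have "\<forall>\<^sub>F n in sequentially. \<bar>\<theta>\<bar> * expectation (\<lambda>\<omega>. \<bar>?S n \<omega> - part_sum n {1..int n} \<omega>\<bar>) < e/4"
    using e by (intro order_tendstoD(2)[OF tendsto_mult[OF tendsto_const scaled_sum_approx]]) simp
  moreover have "\<forall>\<^sub>F n in sequentially. dist (expectation (\<lambda>\<omega>. iexp (\<theta> * ?Bs n \<omega>))) (?Lk k) < e/4"
    by (rule tendstoD[OF block_char_limit[OF mean]]) (use e in simp)
  ultimately show "\<forall>\<^sub>F n in sequentially. dist (expectation (\<lambda>\<omega>. iexp (\<theta> * ?S n \<omega>))) ?L < e"
  proof eventually_elim
    case (elim n)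
    define p1 where "p1 = expectation (\<lambda>\<omega>. iexp (\<theta> * ?S n \<omega>))"
    define p2 where "p2 = expectation (\<lambda>\<omega>. iexp (\<theta> * part_sum n {1..int n} \<omega>))"
    define p3 where "p3 = expectation (\<lambda>\<omega>. iexp (\<theta> * ?Bs n \<omega>))"
    have "dist p1 ?L \<le> dist p1 p2 + dist p2 p3 + dist p3 (?Lk k) + dist (?Lk k) ?L"
      using dist_triangle[of p1 ?L p2] dist_triangle[of p2 ?L p3] dist_triangle[of p3 ?L "?Lk k"] by linarith
    moreover have "dist p1 p2 < e/4" using approx[of n] elim(2) unfolding dist_norm p1_def p2_def by linarith
    moreover have "dist p2 p3 < e/4" using rest[of n] elim(1) unfolding dist_norm p2_def p3_def by linarith
    moreover have "dist p3 (?Lk k) < e/4" using elim(3) unfolding p3_def .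
    ultimately show ?case using k(1) unfolding p1_def by linarith
  qed
qed

lemma normal_limit:
  assumes mean: "expectation (X 0) = 0"
  shows "weak_conv_m (\<lambda>n. distr M borel (\<lambda>\<omega>. (\<Sum>t = 1..n. X (int t) \<omega>) / a n))
    (normal_law 0 (N.expectation cluster_square))"
proof (rule levy_continuity)
  have v: "0 \<le> N.expectation cluster_square"
    by (intro integral_nonneg_AE AE_I2) (simp add: cluster_square_def)
  show "real_distribution (distr M borel (\<lambda>\<omega>. (\<Sum>t = 1..n. X (int t) \<omega>) / a n))" for n
    by (rule real_distribution_distr) measurable
  show "real_distribution (normal_law 0 (N.expectation cluster_square))"
    by (rule normal_law_char(1)[OF v])
  show "(\<lambda>n. char (distr M borel (\<lambda>\<omega>. (\<Sum>t = 1..n. X (int t) \<omega>) / a n)) t)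
      \<longlonglongrightarrow> char (normal_law 0 (N.expectation cluster_square)) t" for t
  proof -
    have "char (distr M borel (\<lambda>\<omega>. (\<Sum>t = 1..n. X (int t) \<omega>) / a n)) t
        = expectation (\<lambda>\<omega>. iexp (t * ((\<Sum>t = 1..n. X (int t) \<omega>) / a n)))" for n
      unfolding char_def by (rule integral_distr) measurable
    then show ?thesis using char_limit[OF mean, of t] by (simp only: normal_law_char(2)[OF v])
  qed
qed

end

theorem proposition3p2:
  fixes M :: "'a measure" and N :: "'b measure"
    and X :: "int \<Rightarrow> 'a \<Rightarrow> real" and \<Theta> :: "int \<Rightarrow> 'b \<Rightarrow> real"
    and m :: nat and a :: "nat \<Rightarrow> real"
  defines "W \<equiv> (\<lambda>\<omega>. (\<Sum>t = 0..int m. \<Theta> t \<omega>)\<^sup>2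
                   * indicator {\<omega>. \<forall>i\<in>{1..m}. \<Theta> (- int i) \<omega> = 0} \<omega>)"
  assumes "prob_space M"
    and "strictly_stationary M X"
    and "m_dependent m M X"
    and "regularly_varying 2 M X N \<Theta>"
    and "integrable M (X 0)" and "integral\<^sup>L M (X 0) = 0"
    and "(\<integral>\<^sup>+\<omega>. ennreal ((X 0 \<omega> - integral\<^sup>L M (X 0))\<^sup>2) \<partial>M) = \<infinity>"
    and "eventually (\<lambda>n. a n > 0 \<and>
           real n * \<P>(\<omega> in M. \<bar>X 0 \<omega>\<bar> > a n)
           + real n / (a n)\<^sup>2 * (\<integral>\<omega>. (X 0 \<omega>)\<^sup>2 * indicator {\<omega>. \<bar>X 0 \<omega>\<bar> \<le> a n} \<omega> \<partial>M) = 1)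
         sequentially"
  shows "integrable N W \<and>
    weak_conv_m (\<lambda>n. distr M borel (\<lambda>\<omega>. (\<Sum>t = 1..n. X (int t) \<omega>) / a n))
                (normal_law 0 (integral\<^sup>L N W))"
proof -
  interpret M: prob_space M by (rule assms(2))
  obtain L where L: "slowly_varying L" "\<And>x. 0 < x \<Longrightarrow> M.prob {\<omega> \<in> space M. x < \<bar>X 0 \<omega>\<bar>} = L x * x powr (-2)"
    using assms(5) unfolding regularly_varying_def regularly_varying_marginal_def by auto
  obtain Y where Y: "\<And>x. 1 < x \<Longrightarrow> measure N {\<omega> \<in> space N. x < Y \<omega>} = x powr (-2)"
      "indep_rvs N borel Y (PiM UNIV (\<lambda>_. borel)) (\<lambda>\<omega> t. \<Theta> t \<omega>)"
      "\<And>h. weak_conv_vec {- int h..int h}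
           (\<lambda>x. distr (uniform_measure M {\<omega> \<in> space M. \<bar>X 0 \<omega>\<bar> > x})
                  (PiM {- int h..int h} (\<lambda>_. borel))
                  (\<lambda>\<omega>. \<lambda>t\<in>{- int h..int h}. X t \<omega> / x))
           (distr N (PiM {- int h..int h} (\<lambda>_. borel))
                  (\<lambda>\<omega>. \<lambda>t\<in>{- int h..int h}. Y \<omega> * \<Theta> t \<omega>))
           at_top"
    using assms(5) unfolding regularly_varying_def spectral_tail_process_def by auto
  interpret N: prob_space N
    using assms(5) unfolding regularly_varying_def spectral_tail_process_def by auto
  interpret tail_process M X L N \<Theta> Y m
  proof unfold_locales
    show "X 0 \<in> borel_measurable M" using assms(3) by (simp add: strictly_stationary_def)
    show "(\<integral>\<^sup>+\<omega>. ennreal ((X 0 \<omega>)\<^sup>2) \<partial>M) = \<infinity>" using assms(7,8) by simp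
  qed (fact L Y assms)+
  interpret normalized_tail_process M X L N \<Theta> Y m a
  proof unfold_locales
    have "(\<integral>\<omega>. (X 0 \<omega>)\<^sup>2 * indicator {\<omega>. \<bar>X 0 \<omega>\<bar> \<le> c} \<omega> \<partial>M) = trunc_moment c" for c
      unfolding trunc_moment_def
      by (intro Bochner_Integration.integral_cong) (auto simp: trunc_def indicator_def)
    then show "\<forall>\<^sub>F n in sequentially. 0 < a n \<and> real n * tail (a n) + real n / (a n)\<^sup>2 * trunc_moment (a n) = 1"
      using assms(9) by (simp add: tail_def)
  qed
  have "(\<forall>i\<in>{1..m}. \<Theta> (- int i) \<omega> = 0) \<longleftrightarrow> (\<forall>i\<in>{- int m..- 1}. \<Theta> i \<omega> = 0)" for \<omega>
  proof safe
    fix i assume A: "\<forall>i\<in>{1..m}. \<Theta> (- int i) \<omega> = 0" and i: "i \<in> {- int m..- 1}"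
    then have "nat (- i) \<in> {1..m}" by auto
    then have "\<Theta> (- int (nat (- i))) \<omega> = 0" using A by blast
    then show "\<Theta> i \<omega> = 0" using i by simp
  qed auto
  then have W: "W = cluster_square"
    unfolding W_def cluster_square_def[abs_def] by (auto simp: fun_eq_iff indicator_def)
  show ?thesis
    unfolding W using cluster_variance(1) normal_limit[OF assms(7)] by blast
qed

end
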